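(* Let $f$ be a real-valued function on triples of partitions such that for all partitions $\alpha,\beta,\gamma$ and all positive integers $i$, $$f(\alpha,\beta,\bar\gamma)\ge f(\alpha,\beta,\gamma^{\dagger i}).$$ Set $\mathcal{M}_f(\alpha,\beta,\gamma)=|\gamma|+f(\alpha,\beta,\bar\gamma)$ and assume also that whenever $\overline{g}_{\alpha,\beta}^{\gamma}>0$, $$\mathcal{M}_f(\alpha,\beta,\gamma)\ge\max\left(|\alpha|+\alpha_1,\ |\beta|+\beta_1,\ |\gamma|+\gamma_1\right).$$ Then whenever $\overline{g}_{\alpha,\beta}^{\gamma}>0$, $$\operatorname{stab}(\alpha,\beta,\gamma)\le\mathcal{M}_f(\alpha,\beta,\gamma).$$
   Context: A partition is a finite weakly decreasing sequence of positive integers, identified with an infinite sequence by appending zeros; $|\lambda|$ is the sum of its parts; $\bar\lambda=(\lambda_2,\lambda_3,\ldots)$. For a partition $\lambda$ and a positive integer $i$, $\lambda^{\dagger i}$ is the partition obtained by adding $1$ to the first $i-1$ terms and erasing the $i$-th term: $\lambda^{\dagger i}=(1+\lambda_1,\ldots,1+\lambda_{i-1},\lambda_{i+1},\lambda_{i+2},\ldots)$. For a partition $\alpha=(\alpha_1,\ldots,\alpha_k)$ and an integer $n$, $\alpha[n]=(n-|\alpha|,\alpha_1,\ldots,\alpha_k)$; it is a partition iff $n-|\alpha|\ge\alpha_1$. For partitions $\lambda,\mu,\nu$ of $n$, the Kronecker coefficient $g_{\mu,\nu}^{\lambda}$ is the multiplicity of the irreducible $\mathfrak{S}_n$-representation $V_\lambda$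 in $V_\mu\otimes V_\nu$ (over $\mathbb{C}$). For partitions $\alpha,\beta,\gamma$, the sequence $g_{\alpha[n],\beta[n]}^{\gamma[n]}$ is eventually constant as $n\to\infty$ (Murnaghan); the reduced Kronecker coefficient $\overline{g}_{\alpha,\beta}^{\gamma}$ is its stable value. $\operatorname{stab}(\alpha,\beta,\gamma)$ is the smallest integer $N$ such that $\alpha[N],\beta[N],\gamma[N]$ are partitions and $g_{\alpha[n],\beta[n]}^{\gamma[n]}=\overline{g}_{\alpha,\beta}^{\gamma}$ for all $n\ge N$. *)

theory Defs
  imports
    Complex_Main
    "HOL-Library.Function_Algebras"
    "HOL-Library.FuncSet"
    "HOL-Combinatorics.Permutations"
    "HOL-Algebra.Sym_Groups"
begin

section \<open>Partitions\<close>

text \<open>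
  A partition is given by its infinite sequence of parts, padded with zeros and indexed from 0:
  the part written \<open>\<lambda>\<^sub>i\<close> in the literature (\<open>i \<ge> 1\<close>) is \<open>l (i - 1)\<close>.
\<close>

definition is_partition :: "(nat \<Rightarrow> nat) \<Rightarrow> bool" where
  "is_partition l \<longleftrightarrow> antimono l \<and> finite {i. l i \<noteq> 0}"

definition psize :: "(nat \<Rightarrow> nat) \<Rightarrow> nat" where
  "psize l = (\<Sum>i | l i \<noteq> 0. l i)"

definition cut_first :: "(nat \<Rightarrow> nat) \<Rightarrow> nat \<Rightarrow> nat" where
  "cut_first l = (\<lambda>k. l (Suc k))"

text \<open>The partition \<open>\<lambda>\<^sup>\<dagger>\<^sup>i\<close>, for \<open>i \<ge> 1\<close> (the index \<open>i\<close> itself is counted from 1).\<close>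

definition dagger :: "(nat \<Rightarrow> nat) \<Rightarrow> nat \<Rightarrow> nat \<Rightarrow> nat" where
  "dagger l i = (\<lambda>k. if k < i - 1 then 1 + l k else l (Suc k))"

text \<open>
  The sequence \<open>\<alpha>[n] = (n - |\<alpha>|, \<alpha>\<^sub>1, \<alpha>\<^sub>2, \<dots>)\<close>. The subtraction is truncated, but this never
  turns a non-partition into a partition, by the lemma \<open>partition_pad_iff\<close> below.
\<close>

definition pad :: "(nat \<Rightarrow> nat) \<Rightarrow> nat \<Rightarrow> nat \<Rightarrow> nat" where
  "pad a n = (\<lambda>k. case k of 0 \<Rightarrow> n - psize a | Suc j \<Rightarrow> a j)"

lemma partition_pad_iff:
  assumes "is_partition a"
  shows "is_partition (pad a n) \<longleftrightarrow> psize a + a 0 \<le> n"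
proof
  assume "is_partition (pad a n)"
  then have "pad a n (Suc 0) \<le> pad a n 0"
    unfolding is_partition_def antimono_def by blast
  then have le: "a 0 \<le> n - psize a"
    by (simp add: pad_def)
  show "psize a + a 0 \<le> n"
  proof (cases "a 0 = 0")
    case True
    have "a i = 0" for i
    proof -
      have "a i \<le> a 0"
        using assms antimonoD[of a 0 i] by (simp add: is_partition_def)
      with True show ?thesis by simp
    qed
    then show ?thesis by (simp add: psize_def)
  qed (use le in linarith)
next
  assume le: "psize a + a 0 \<le> n"
  have "antimono (pad a n)"
  proof (rule antimonoI)
    fix x y :: nat assume "x \<le> y"
    show "pad a n y \<le> pad a n x"
    proof (cases y)
      case (Suc j)
      have *: "a j \<le> a i" if "i \<le> j" for i
        using assms antimonoD[of a i j] that by (simp add: is_partition_def)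
      show ?thesis
      proof (cases x)
        case 0
        then show ?thesis using Suc le *[of 0] by (simp add: pad_def)
      next
        case (Suc i)
        then show ?thesis using \<open>y = Suc j\<close> \<open>x \<le> y\<close> *[of i] by (simp add: pad_def)
      qed
    next
      case 0
      then show ?thesis using \<open>x \<le> y\<close> by simp
    qed
  qed
  moreover have "{i. pad a n i \<noteq> 0} \<subseteq> insert 0 (Suc ` {i. a i \<noteq> 0})"
  proof
    fix i assume "i \<in> {i. pad a n i \<noteq> 0}"
    then show "i \<in> insert 0 (Suc ` {i. a i \<noteq> 0})"
      by (cases i) (auto simp: pad_def)
  qed
  then have "finite {i. pad a n i \<noteq> 0}"
    by (rule finite_subset) (use assms in \<open>auto simp: is_partition_def\<close>)
  ultimately show "is_partition (pad a n)" by (simp add: is_partition_def)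
qed


section \<open>Group representations on spaces of complex functions\<close>

definition cscale :: "complex \<Rightarrow> ('b \<Rightarrow> complex) \<Rightarrow> 'b \<Rightarrow> complex" where
  "cscale c v = (\<lambda>x. c * v x)"

interpretation cfun: vector_space "cscale :: complex \<Rightarrow> ('b \<Rightarrow> complex) \<Rightarrow> 'b \<Rightarrow> complex"
  by unfold_locales (auto simp: cscale_def algebra_simps fun_eq_iff)

text \<open>
  In the following, \<open>r\<close> is a linear action of the group \<open>G\<close> on a space of all complex functions
  on some type, and a representation of \<open>G\<close> is an invariant subspace \<open>V\<close> for such an action.
\<close>

definition subrep ::
  "('g, 'm) monoid_scheme \<Rightarrow> ('g \<Rightarrow> ('b \<Rightarrow> complex) \<Rightarrow> ('b \<Rightarrow> complex)) \<Rightarrow> ('b \<Rightarrow> complex) set \<Rightarrow> bool"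
where
  "subrep G r V \<longleftrightarrow> cfun.subspace V \<and> (\<forall>g\<in>carrier G. \<forall>v\<in>V. r g v \<in> V)"

definition irrep ::
  "('g, 'm) monoid_scheme \<Rightarrow> ('g \<Rightarrow> ('b \<Rightarrow> complex) \<Rightarrow> ('b \<Rightarrow> complex)) \<Rightarrow> ('b \<Rightarrow> complex) set \<Rightarrow> bool"
where
  "irrep G r V \<longleftrightarrow> subrep G r V \<and> V \<noteq> {0} \<and>
    (\<forall>U. subrep G r U \<and> U \<subseteq> V \<longrightarrow> U = {0} \<or> U = V)"

definition rep_iso ::
  "('g, 'm) monoid_scheme
    \<Rightarrow> ('g \<Rightarrow> ('a \<Rightarrow> complex) \<Rightarrow> ('a \<Rightarrow> complex)) \<Rightarrow> ('a \<Rightarrow> complex) set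
    \<Rightarrow> ('g \<Rightarrow> ('b \<Rightarrow> complex) \<Rightarrow> ('b \<Rightarrow> complex)) \<Rightarrow> ('b \<Rightarrow> complex) set \<Rightarrow> bool"
where
  "rep_iso G r V s W \<longleftrightarrow> (\<exists>\<phi>. bij_betw \<phi> V W \<and>
     (\<forall>x\<in>V. \<forall>y\<in>V. \<phi> (x + y) = \<phi> x + \<phi> y) \<and>
     (\<forall>c. \<forall>x\<in>V. \<phi> (cscale c x) = cscale c (\<phi> x)) \<and>
     (\<forall>g\<in>carrier G. \<forall>x\<in>V. \<phi> (r g x) = s g (\<phi> x)))"

text \<open>\<open>W\<close> is the internal direct sum of the irreducible subrepresentations \<open>U 0, \<dots>, U (k - 1)\<close>.\<close>

definition irrep_decomp ::
  "('g, 'm) monoid_scheme \<Rightarrow> ('g \<Rightarrow> ('b \<Rightarrow> complex) \<Rightarrow> ('b \<Rightarrow> complex)) \<Rightarrow> ('b \<Rightarrow> complex) set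
    \<Rightarrow> nat \<Rightarrow> (nat \<Rightarrow> ('b \<Rightarrow> complex) set) \<Rightarrow> bool"
where
  "irrep_decomp G r W k U \<longleftrightarrow>
    (\<forall>i<k. irrep G r (U i)) \<and> bij_betw (\<lambda>u. \<Sum>i<k. u i) (PiE {..<k} U) W"

text \<open>
  The multiplicity of the irreducible representation \<open>V\<close> in \<open>W\<close>: the number of summands isomorphic
  to \<open>V\<close> in a decomposition of \<open>W\<close> into irreducibles.
\<close>

definition irrep_mult ::
  "('g, 'm) monoid_scheme
    \<Rightarrow> ('g \<Rightarrow> ('a \<Rightarrow> complex) \<Rightarrow> ('a \<Rightarrow> complex)) \<Rightarrow> ('a \<Rightarrow> complex) set
    \<Rightarrow> ('g \<Rightarrow> ('b \<Rightarrow> complex) \<Rightarrow> ('b \<Rightarrow> complex)) \<Rightarrow> ('b \<Rightarrow> complex) set \<Rightarrow> nat"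
where
  "irrep_mult G r V s W =
    (THE m. \<exists>k U. irrep_decomp G s W k U \<and> m = card {i. i < k \<and> rep_iso G r V s (U i)})"

text \<open>
  The tensor product of spaces of functions on \<open>'a\<close> and on \<open>'b\<close>, realized inside the functions
  on \<open>'a \<times> 'b\<close>, with \<open>v \<otimes> w\<close> the function \<open>(x, y) \<mapsto> v x * w y\<close>.
\<close>

definition tensor :: "('a \<Rightarrow> complex) set \<Rightarrow> ('b \<Rightarrow> complex) set \<Rightarrow> ('a \<times> 'b \<Rightarrow> complex) set" where
  "tensor V W = cfun.span {(\<lambda>(x, y). v x * w y) | v w. v \<in> V \<and> w \<in> W}"


section \<open>Specht modules\<close>

text \<open>
  A tableau of shape \<open>l\<close>, with \<open>n\<close> the size of \<open>l\<close>, is a bijection \<open>T\<close> from the entries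
  \<open>1, \<dots>, n\<close> to the cells (row, column) of the Young diagram. Its tabloid is encoded by the
  function \<open>fst \<circ> T\<close> sending each entry to its row. Permutations of the entries act on functions of
  tabloids; on the indicator function of a tabloid \<open>t\<close> the action of \<open>g\<close> gives the indicator
  function of the permuted tabloid \<open>t \<circ> inv g\<close>.
\<close>

definition young_diagram :: "(nat \<Rightarrow> nat) \<Rightarrow> (nat \<times> nat) set" where
  "young_diagram l = {(i, j). j < l i}"

definition tableaux :: "(nat \<Rightarrow> nat) \<Rightarrow> (nat \<Rightarrow> nat \<times> nat) set" where
  "tableaux l = {T \<in> extensional {1..psize l}. bij_betw T {1..psize l} (young_diagram l)}"

definition act :: "(nat \<Rightarrow> nat) \<Rightarrow> ((nat \<Rightarrow> nat) \<Rightarrow> complex) \<Rightarrow> (nat \<Rightarrow> nat) \<Rightarrow> complex" where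
  "act g v = (\<lambda>t. v (t \<circ> g))"

definition column_stabilizer :: "nat \<Rightarrow> (nat \<Rightarrow> nat \<times> nat) \<Rightarrow> (nat \<Rightarrow> nat) set" where
  "column_stabilizer n T = {q \<in> carrier (sym_group n). \<forall>k\<in>{1..n}. snd (T (q k)) = snd (T k)}"

definition polytabloid :: "nat \<Rightarrow> (nat \<Rightarrow> nat \<times> nat) \<Rightarrow> (nat \<Rightarrow> nat) \<Rightarrow> complex" where
  "polytabloid n T =
    (\<Sum>q\<in>column_stabilizer n T. cscale (of_int (sign q)) (act q (\<lambda>t. of_bool (t = fst \<circ> T))))"

text \<open>The irreducible representation \<open>V\<^sub>\<lambda>\<close> of the symmetric group, with the action \<open>act\<close>.\<close>

definition specht :: "(nat \<Rightarrow> nat) \<Rightarrow> ((nat \<Rightarrow> nat) \<Rightarrow> complex) set" where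
  "specht l = cfun.span (polytabloid (psize l) ` tableaux l)"

text \<open>The diagonal action on tensor products: \<open>tensor_act g (v \<otimes> w) = act g v \<otimes> act g w\<close>.\<close>

definition tensor_act ::
  "(nat \<Rightarrow> nat) \<Rightarrow> ((nat \<Rightarrow> nat) \<times> (nat \<Rightarrow> nat) \<Rightarrow> complex)
    \<Rightarrow> (nat \<Rightarrow> nat) \<times> (nat \<Rightarrow> nat) \<Rightarrow> complex"
where
  "tensor_act g F = (\<lambda>(s, t). F (s \<circ> g, t \<circ> g))"


section \<open>Kronecker and reduced Kronecker coefficients\<close>

text \<open>\<open>kronecker \<mu> \<nu> \<lambda>\<close> is meant for partitions of the same size; the last argument is the upper index.\<close>

definition kronecker :: "(nat \<Rightarrow> nat) \<Rightarrow> (nat \<Rightarrow> nat) \<Rightarrow> (nat \<Rightarrow> nat) \<Rightarrow> nat" where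
  "kronecker \<mu> \<nu> l =
    irrep_mult (sym_group (psize l)) act (specht l) tensor_act (tensor (specht \<mu>) (specht \<nu>))"

definition reduced_kronecker :: "(nat \<Rightarrow> nat) \<Rightarrow> (nat \<Rightarrow> nat) \<Rightarrow> (nat \<Rightarrow> nat) \<Rightarrow> nat" where
  "reduced_kronecker \<alpha> \<beta> \<gamma> =
    (THE v. \<forall>\<^sub>F n in sequentially. kronecker (pad \<alpha> n) (pad \<beta> n) (pad \<gamma> n) = v)"

text \<open>
  The minimum over all integers is attained in \<open>nat\<close>, since \<open>\<alpha>[N]\<close> is a partition only if
  \<open>N \<ge> |\<alpha>| + \<alpha>\<^sub>1 \<ge> 0\<close>.
\<close>

definition stab :: "(nat \<Rightarrow> nat) \<Rightarrow> (nat \<Rightarrow> nat) \<Rightarrow> (nat \<Rightarrow> nat) \<Rightarrow> nat" where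
  "stab \<alpha> \<beta> \<gamma> =
    (LEAST N. is_partition (pad \<alpha> N) \<and> is_partition (pad \<beta> N) \<and> is_partition (pad \<gamma> N) \<and>
      (\<forall>n\<ge>N. kronecker (pad \<alpha> n) (pad \<beta> n) (pad \<gamma> n) = reduced_kronecker \<alpha> \<beta> \<gamma>))"

definition M_bound ::
  "((nat \<Rightarrow> nat) \<Rightarrow> (nat \<Rightarrow> nat) \<Rightarrow> (nat \<Rightarrow> nat) \<Rightarrow> real)
    \<Rightarrow> (nat \<Rightarrow> nat) \<Rightarrow> (nat \<Rightarrow> nat) \<Rightarrow> (nat \<Rightarrow> nat) \<Rightarrow> real"
where
  "M_bound f \<alpha> \<beta> \<gamma> = real (psize \<gamma>) + f \<alpha> \<beta> (cut_first \<gamma>)"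

end

theory Submission
  imports Defs
begin

text \<open>
  For \<open>\<mu>\<close> a partition of \<open>n\<close> let \<open>\<chi>\<^sup>\<mu>\<close> be the character of the Specht module, and for any partition \<open>\<delta>\<close> let
  \<open>X\<^sub>n(\<delta>)\<close> be the class function on the symmetric group given by the Jacobi-Trudi determinant with row
  lengths \<open>\<delta>[n] = (n - |\<delta>|, \<delta>\<^sub>1, \<delta>\<^sub>2, \<dots>)\<close>, whether or not these decrease. Everything rests on Murnaghan's
  expansion: there are coefficients \<open>c\<^sub>\<delta>\<close>, almost all zero and independent of \<open>n\<close>, with
  \<open>X\<^sub>n(\<alpha>) X\<^sub>n(\<beta>) = \<Sum>\<^sub>\<delta> c\<^sub>\<delta> X\<^sub>n(\<delta>)\<close> for every \<open>n\<close>. When \<open>n\<close> is large all \<open>\<delta>[n]\<close> in the sum are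
  partitions, the \<open>X\<^sub>n(\<delta>)\<close> are distinct irreducible characters, and so \<open>c\<^sub>\<delta>\<close> is the reduced Kronecker
  coefficient (\<open>kronecker_expansion\<close>). When \<open>n\<close> is small, permuting the rows of the determinant shows
  that \<open>X\<^sub>n(\<delta>)\<close> is zero or, up to sign, a character \<open>\<chi>\<^sup>\<mu>\<close>, and the latter forces \<open>\<delta> = \<mu>\<^sup>\<dagger>\<^sup>i\<close> for some \<open>i\<close>
  (\<open>jt_inner_nonzero\<close>). Taking \<open>\<mu> = \<gamma>[n]\<close>, whose first dagger is \<open>\<gamma>\<close> itself, the Kronecker coefficient
  at \<open>n\<close> has its stable value as soon as the reduced coefficients at \<open>\<gamma>[n]\<^sup>\<dagger>\<^sup>i\<close> with \<open>i \<ge> 2\<close> vanish.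
  Such a partition has first part \<open>n - |\<gamma>| + 1\<close> and remaining parts \<open>\<gamma>\<^sup>\<dagger>\<^sup>(\<^sup>i\<^sup>-\<^sup>1\<^sup>)\<close>, so if its coefficient
  were positive, the two hypotheses on \<open>f\<close> would give \<open>n + 1 \<le> M\<^sub>f(\<alpha>, \<beta>, \<gamma>)\<close>; this fails from
  \<open>n = \<lfloor>M\<^sub>f(\<alpha>, \<beta>, \<gamma>)\<rfloor>\<close> on.

  Three things carry the expansion. First, multiplicities are inner products of characters
  (\<open>irrep_mult_eq\<close>). A representation is an invariant subspace of the functions on a finite set, and
  its character is the trace of the group element composed with a projection onto the subspace; the
  Hermitian projection replaces Maschke's theorem, and Schur's lemma is applied to averaged operators.

  Second, the Specht character is a Jacobi-Trudi determinant in permutation characters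
  (\<open>specht_char_jacobi_trudi\<close>). The determinants are orthonormal, because the inner product of two
  permutation characters counts nonnegative integer matrices with given margins and a sign-reversing
  involution on the columns leaves only horizontal strips (\<open>pieri_cancel\<close>,
  \<open>jacobi_trudi_orthonormal\<close>). On the side of the modules, the column antisymmetrizer of a tableau
  of shape \<open>\<lambda>\<close> kills every permutation module whose shape properly dominates \<open>\<lambda>\<close>, and maps the one of
  shape \<open>\<lambda>\<close> to a line (\<open>antisymmetrizer_multiple\<close>). So the Specht character and the determinant both
  have norm 1 and their inner product is 1, and they are equal.

  Third, as functions of \<open>n\<close> and the permutation, the permutation characters of the shapes \<open>w[n]\<close> span
  the same space as the \<open>X\<^sub>n(\<delta>)\<close>, by a triangularity argument (\<open>stable_perm_char_partition_span\<close>), and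
  their span is closed under products, since a product of two permutation characters is the sum over
  matrices of the permutation characters of their entries (\<open>stable_perm_char_mult\<close>).
\<close>

section \<open>Hermitian projections\<close>

lemma fun_sum_apply: "(\<Sum>i\<in>A. f i) x = (\<Sum>i\<in>A. f i x)"
  by (induction A rule: infinite_finite_induct) auto

definition supported :: "'b set \<Rightarrow> ('b \<Rightarrow> complex) set" where
  "supported X = {f. \<forall>x. x \<notin> X \<longrightarrow> f x = 0}"

lemma subspace_supported: "cfun.subspace (supported X)"
  by (auto simp: cfun.subspace_def supported_def cscale_def)

lemma subspace_lincomb:
  assumes "cfun.subspace V" "\<And>i. i \<in> A \<Longrightarrow> v i \<in> V"
  shows "(\<lambda>y. \<Sum>i\<in>A. c i * v i y) \<in> V"
proof -
  have "(\<Sum>i\<in>A. cscale (c i) (v i)) \<in> V"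
    using assms by (intro cfun.subspace_sum cfun.subspace_scale)
  moreover have "(\<Sum>i\<in>A. cscale (c i) (v i)) = (\<lambda>y. \<Sum>i\<in>A. c i * v i y)"
    by (rule ext) (simp add: fun_sum_apply cscale_def)
  ultimately show ?thesis by simp
qed

text \<open>
  The function \<open>P x\<close> is the image of the indicator function of \<open>x\<close> under a linear idempotent with image
  \<open>V\<close>; kernels are used because they can be tensored and traced without choosing a basis.
\<close>

definition projector :: "'b set \<Rightarrow> ('b \<Rightarrow> complex) set \<Rightarrow> ('b \<Rightarrow> 'b \<Rightarrow> complex) \<Rightarrow> bool" where
  "projector X V P \<longleftrightarrow> (\<forall>x\<in>X. P x \<in> V) \<and> (\<forall>f\<in>V. \<forall>y. f y = (\<Sum>x\<in>X. f x * P x y))"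

definition hermitian :: "'b set \<Rightarrow> ('b \<Rightarrow> 'b \<Rightarrow> complex) \<Rightarrow> bool" where
  "hermitian X P \<longleftrightarrow> (\<forall>x\<in>X. \<forall>y\<in>X. P y x = cnj (P x y))"

lemma projector_mem: "projector X V P \<Longrightarrow> x \<in> X \<Longrightarrow> P x \<in> V"
  by (simp add: projector_def)

lemma projector_fix: "projector X V P \<Longrightarrow> f \<in> V \<Longrightarrow> (\<Sum>x\<in>X. f x * P x y) = f y"
  by (simp add: projector_def)

text \<open>
  An orthonormal subset \<open>B\<close> of \<open>V\<close> gives the kernel \<open>\<Sum>\<^sub>b cnj (b x) b y\<close>, of trace \<open>card B\<close>. Its
  diagonal entries are at most 1, which bounds \<open>card B\<close> by \<open>card X\<close>, so there is a largest \<open>B\<close>; if some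
  vector of \<open>V\<close> differed from its projection, the normalized difference would enlarge \<open>B\<close>.
  The integer trace serves as the dimension of \<open>V\<close>.
\<close>

lemma hermitian_projector_exists:
  fixes X :: "'b set"
  assumes X: "finite X" and V: "cfun.subspace V" "V \<subseteq> supported X"
  obtains P and d :: nat where "projector X V P" "hermitian X P" "(\<Sum>x\<in>X. P x x) = of_nat d"
proof -
  define ip where "ip f h = (\<Sum>x\<in>X. f x * cnj (h x))" for f h :: "'b \<Rightarrow> complex"
  define ON where "ON B \<longleftrightarrow> finite B \<and> B \<subseteq> V \<and> (\<forall>b\<in>B. \<forall>c\<in>B. ip b c = of_bool (b = c))" for B
  define P where "P B x y = (\<Sum>b\<in>B. cnj (b x) * b y)" for B :: "('b \<Rightarrow> complex) set" and x y
  have trace: "(\<Sum>x\<in>X. P B x x) = of_nat (card B)" if "ON B" for B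
  proof -
    have "(\<Sum>x\<in>X. P B x x) = (\<Sum>b\<in>B. ip b b)"
      unfolding P_def ip_def by (subst sum.swap) (simp add: mult.commute)
    also have "\<dots> = of_nat (card B)" using that by (simp add: ON_def)
    finally show ?thesis .
  qed
  have le1: "Re (P B x x) \<le> 1" "Im (P B x x) = 0" if "ON B" "x \<in> X" for B x
  proof -
    have "(\<Sum>y\<in>X. P B x y * cnj (P B x y)) = (\<Sum>y\<in>X. \<Sum>b\<in>B. \<Sum>c\<in>B. cnj (b x) * c x * (b y * cnj (c y)))"
      unfolding P_def by (simp add: sum_product algebra_simps)
    also have "\<dots> = (\<Sum>b\<in>B. \<Sum>c\<in>B. cnj (b x) * c x * ip b c)"
      unfolding ip_def sum_distrib_left
      by (subst sum.swap, rule sum.cong[OF refl], subst sum.swap, rule refl)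
    also have "\<dots> = (\<Sum>b\<in>B. cnj (b x) * b x)"
    proof (rule sum.cong[OF refl])
      fix b assume b: "b \<in> B"
      have "(\<Sum>c\<in>B. cnj (b x) * c x * ip b c) = (\<Sum>c\<in>B. if b = c then cnj (b x) * c x else 0)"
        using that b by (intro sum.cong) (auto simp: ON_def)
      then show "(\<Sum>c\<in>B. cnj (b x) * c x * ip b c) = cnj (b x) * b x"
        using that b by (simp add: ON_def)
    qed
    finally have eq: "(\<Sum>y\<in>X. P B x y * cnj (P B x y)) = P B x x" by (simp add: P_def)
    have eq': "P B x x = of_real (\<Sum>y\<in>X. (cmod (P B x y))\<^sup>2)"
      unfolding eq[symmetric] of_real_sum by (rule sum.cong) (simp_all add: complex_norm_square del: of_real_power)
    show im: "Im (P B x x) = 0" unfolding eq' by (rule Im_complex_of_real)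
    define s where "s = Re (P B x x)"
    have s: "P B x x = of_real s" using im unfolding s_def complex_eq_iff by simp
    have "s = (\<Sum>y\<in>X. (cmod (P B x y))\<^sup>2)" unfolding s_def eq' by (rule Re_complex_of_real)
    also have "\<dots> \<ge> (cmod (P B x x))\<^sup>2"
      using X that(2) by (intro member_le_sum) auto
    finally have "s\<^sup>2 \<le> s" by (simp add: s)
    show "Re (P B x x) \<le> 1"
    proof (rule ccontr)
      assume "\<not> ?thesis"
      then have "s > 1" by (simp add: s_def)
      then have "s * s > s * 1" by (intro mult_strict_left_mono) auto
      with \<open>s\<^sup>2 \<le> s\<close> show False by (simp add: power2_eq_square)
    qed
  qed
  have bound: "card B \<le> card X" if "ON B" for B
  proof -
    have "real (card B) = Re (\<Sum>x\<in>X. P B x x)" using trace[OF that] by simp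
    also have "\<dots> \<le> (\<Sum>x\<in>X. 1)" unfolding Re_sum by (intro sum_mono le1 that)
    finally show ?thesis by simp
  qed
  have "\<exists>B. ON B \<and> (\<forall>B'. ON B' \<longrightarrow> card B' \<le> card B)"
    by (rule ex_has_greatest_nat[of ON "{}" card "Suc (card X)"])
       (use bound in \<open>auto simp: ON_def less_Suc_eq_le\<close>)
  then obtain B where B: "ON B" and max: "\<And>B'. ON B' \<Longrightarrow> card B' \<le> card B" by blast
  have BV: "b \<in> V" if "b \<in> B" for b using B that by (auto simp: ON_def)
  have finB: "finite B" using B by (simp add: ON_def)
  have "projector X V (P B)"
    unfolding projector_def
  proof (intro conjI ballI allI)
    fix x show "P B x \<in> V"
      unfolding P_def by (rule subspace_lincomb[OF V(1) BV])
  next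
    fix f y assume f: "f \<in> V"
    define h where "h = f - (\<lambda>y. \<Sum>b\<in>B. ip f b * b y)"
    have hV: "h \<in> V" unfolding h_def
      by (intro cfun.subspace_diff V(1) f subspace_lincomb BV)
    have hb: "ip h c = 0" if c: "c \<in> B" for c
    proof -
      have "ip h c = ip f c - (\<Sum>x\<in>X. \<Sum>b\<in>B. ip f b * (b x * cnj (c x)))"
        by (simp add: h_def ip_def algebra_simps sum_subtractf sum_distrib_left sum_distrib_right)
      also have "(\<Sum>x\<in>X. \<Sum>b\<in>B. ip f b * (b x * cnj (c x))) = (\<Sum>b\<in>B. ip f b * ip b c)"
        by (subst sum.swap) (simp add: ip_def sum_distrib_left)
      also have "\<dots> = (\<Sum>b\<in>B. if b = c then ip f b else 0)"
        using B c by (intro sum.cong) (auto simp: ON_def)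
      also have "\<dots> = ip f c" using finB c by simp
      finally show ?thesis by simp
    qed
    have "h = 0"
    proof (rule ccontr)
      assume "h \<noteq> 0"
      then obtain x0 where x0: "h x0 \<noteq> 0" by (auto simp: fun_eq_iff)
      with hV V(2) have "x0 \<in> X" by (auto simp: supported_def)
      define s where "s = (\<Sum>x\<in>X. (cmod (h x))\<^sup>2)"
      have ips: "ip h h = of_real s"
        unfolding ip_def s_def of_real_sum by (rule sum.cong) (simp_all add: complex_norm_square del: of_real_power)
      have "s > 0" unfolding s_def
        by (rule sum_pos2[OF X \<open>x0 \<in> X\<close>]) (use x0 in auto)
      define h' where "h' = cscale (of_real (1 / sqrt s)) h"
      have h'V: "h' \<in> V" unfolding h'_def by (intro cfun.subspace_scale V(1) hV)
      have h'h': "ip h' h' = 1"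
      proof -
        have "ip h' h' = of_real (1 / sqrt s) * of_real (1 / sqrt s) * ip h h"
          unfolding ip_def h'_def cscale_def sum_distrib_left
          by (rule sum.cong) simp_all
        also have "\<dots> = of_real (1 / sqrt s * (1 / sqrt s) * s)" by (simp only: ips of_real_mult)
        also have "1 / sqrt s * (1 / sqrt s) * s = 1" using \<open>s > 0\<close> by (simp add: field_simps)
        finally show ?thesis by simp
      qed
      have h'b: "ip h' b = 0" if "b \<in> B" for b
      proof -
        have "ip h' b = of_real (1 / sqrt s) * ip h b"
          by (simp add: ip_def h'_def cscale_def sum_distrib_left algebra_simps)
        then show ?thesis using hb[OF that] by simp
      qed
      have bh': "ip b h' = 0" if "b \<in> B" for b
      proof -
        have "ip b h' = cnj (ip h' b)" by (simp add: ip_def mult.commute)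
        then show ?thesis using h'b[OF that] by simp
      qed
      have "h' \<notin> B" using h'b[of h'] h'h' by auto
      have "ON (insert h' B)"
        using B h'V h'h' h'b bh' \<open>h' \<notin> B\<close> by (auto simp: ON_def)
      from max[OF this] \<open>h' \<notin> B\<close> finB show False by simp
    qed
    then have "f y = (\<Sum>b\<in>B. ip f b * b y)" by (simp add: h_def fun_eq_iff)
    also have "\<dots> = (\<Sum>x\<in>X. f x * P B x y)"
      unfolding ip_def P_def sum_distrib_left sum_distrib_right
      by (subst sum.swap) (simp add: algebra_simps)
    finally show "f y = (\<Sum>x\<in>X. f x * P B x y)" .
  qed
  moreover have "hermitian X (P B)" by (simp add: hermitian_def P_def mult.commute)
  ultimately show ?thesis using trace[OF B] that by blast
qed

text \<open>
  The trace of a Hermitian idempotent is the sum of the squared absolute values of its entries.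
\<close>

lemma hermitian_projector_trace_zero:
  assumes "finite X" "V \<subseteq> supported X" "projector X V P" "hermitian X P" "(\<Sum>x\<in>X. P x x) = 0"
  shows "V \<subseteq> {0}"
proof
  fix f assume f: "f \<in> V"
  have "(\<Sum>x\<in>X. P x x) = (\<Sum>x\<in>X. \<Sum>y\<in>X. P x y * P y x)"
    using projector_fix[OF assms(3) projector_mem[OF assms(3)]] by simp
  also have "\<dots> = of_real (\<Sum>x\<in>X. \<Sum>y\<in>X. (cmod (P x y))\<^sup>2)"
    unfolding of_real_sum using assms(4)
    by (intro sum.cong refl) (metis hermitian_def complex_norm_square)
  finally have "complex_of_real (\<Sum>x\<in>X. \<Sum>y\<in>X. (cmod (P x y))\<^sup>2) = 0"
    unfolding assms(5) by (rule sym)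
  then have 0: "(\<Sum>x\<in>X. \<Sum>y\<in>X. (cmod (P x y))\<^sup>2) = 0" by (simp only: of_real_eq_0_iff)
  have P0: "P x y = 0" if "x \<in> X" "y \<in> X" for x y
  proof -
    have "(\<Sum>y\<in>X. (cmod (P x y))\<^sup>2) = 0"
      using 0 assms(1) that by (subst (asm) sum_nonneg_eq_0_iff) (auto intro: sum_nonneg)
    then have "(cmod (P x y))\<^sup>2 = 0"
      using assms(1) that by (subst (asm) sum_nonneg_eq_0_iff) auto
    then show ?thesis by simp
  qed
  have "f y = 0" for y
  proof (cases "y \<in> X")
    case True
    then show ?thesis using projector_fix[OF assms(3) f, of y] by (simp add: P0)
  next
    case False
    then show ?thesis using f assms(2) by (auto simp: supported_def)
  qed
  then show "f \<in> {0}" by (simp add: fun_eq_iff)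
qed

section \<open>Characters of invariant subspaces\<close>

lemma hermitianD: "hermitian X P \<Longrightarrow> x \<in> X \<Longrightarrow> y \<in> X \<Longrightarrow> cnj (P x y) = P y x"
  unfolding hermitian_def by metis

text \<open>
  A right action \<open>\<rho>\<close> on points becomes a left action on functions.
\<close>

definition pull :: "('g \<Rightarrow> 'b \<Rightarrow> 'b) \<Rightarrow> 'g \<Rightarrow> ('b \<Rightarrow> complex) \<Rightarrow> 'b \<Rightarrow> complex" where
  "pull \<rho> g f = (\<lambda>x. f (\<rho> g x))"

text \<open>
  The trace of \<open>pull \<rho> g\<close> composed with the idempotent of kernel \<open>P\<close>.
\<close>

definition char_on :: "'b set \<Rightarrow> ('g \<Rightarrow> 'b \<Rightarrow> 'b) \<Rightarrow> ('b \<Rightarrow> 'b \<Rightarrow> complex) \<Rightarrow> 'g \<Rightarrow> complex" where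
  "char_on X \<rho> P g = (\<Sum>x\<in>X. P x (\<rho> g x))"

definition is_hom ::
  "('g, 'm) monoid_scheme \<Rightarrow> ('g \<Rightarrow> 'a \<Rightarrow> 'a) \<Rightarrow> ('a \<Rightarrow> complex) set
    \<Rightarrow> ('g \<Rightarrow> 'b \<Rightarrow> 'b) \<Rightarrow> ('b \<Rightarrow> complex) set \<Rightarrow> (('a \<Rightarrow> complex) \<Rightarrow> ('b \<Rightarrow> complex)) \<Rightarrow> bool"
where
  "is_hom G \<rho> V \<sigma> W \<phi> \<longleftrightarrow> \<phi> ` V \<subseteq> W \<and>
     (\<forall>x\<in>V. \<forall>y\<in>V. \<phi> (x + y) = \<phi> x + \<phi> y) \<and>
     (\<forall>c. \<forall>x\<in>V. \<phi> (cscale c x) = cscale c (\<phi> x)) \<and>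
     (\<forall>g\<in>carrier G. \<forall>x\<in>V. \<phi> (pull \<rho> g x) = pull \<sigma> g (\<phi> x))"

lemma is_homI:
  assumes "\<And>x. x \<in> V \<Longrightarrow> \<phi> x \<in> W" "\<And>x y. x \<in> V \<Longrightarrow> y \<in> V \<Longrightarrow> \<phi> (x + y) = \<phi> x + \<phi> y"
    "\<And>c x. x \<in> V \<Longrightarrow> \<phi> (cscale c x) = cscale c (\<phi> x)"
    "\<And>g x. g \<in> carrier G \<Longrightarrow> x \<in> V \<Longrightarrow> \<phi> (pull \<rho> g x) = pull \<sigma> g (\<phi> x)"
  shows "is_hom G \<rho> V \<sigma> W \<phi>"
  using assms by (auto simp: is_hom_def)

lemma is_homD:
  assumes "is_hom G \<rho> V \<sigma> W \<phi>"
  shows "x \<in> V \<Longrightarrow> \<phi> x \<in> W" "x \<in> V \<Longrightarrow> y \<in> V \<Longrightarrow> \<phi> (x + y) = \<phi> x + \<phi> y"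
    "x \<in> V \<Longrightarrow> \<phi> (cscale c x) = cscale c (\<phi> x)"
    "g \<in> carrier G \<Longrightarrow> x \<in> V \<Longrightarrow> \<phi> (pull \<rho> g x) = pull \<sigma> g (\<phi> x)"
  using assms unfolding is_hom_def by blast+

lemma linear_lincomb:
  fixes \<phi> :: "('a \<Rightarrow> complex) \<Rightarrow> ('b \<Rightarrow> complex)"
  assumes add: "\<And>x y. x \<in> V \<Longrightarrow> y \<in> V \<Longrightarrow> \<phi> (x + y) = \<phi> x + \<phi> y"
    and scale: "\<And>c x. x \<in> V \<Longrightarrow> \<phi> (cscale c x) = cscale c (\<phi> x)"
    and V: "cfun.subspace V" "\<And>i. i \<in> A \<Longrightarrow> v i \<in> V"
  shows "\<phi> (\<lambda>y. \<Sum>i\<in>A. c i * v i y) = (\<lambda>y. \<Sum>i\<in>A. c i * \<phi> (v i) y)"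
  using V(2)
proof (induction A rule: infinite_finite_induct)
  case (insert a A)
  have "\<phi> (\<lambda>y. \<Sum>i\<in>insert a A. c i * v i y) = \<phi> (cscale (c a) (v a) + (\<lambda>y. \<Sum>i\<in>A. c i * v i y))"
    using insert by (auto simp: cscale_def plus_fun_def)
  also have "\<dots> = cscale (c a) (\<phi> (v a)) + \<phi> (\<lambda>y. \<Sum>i\<in>A. c i * v i y)"
    using insert.prems V(1) by (simp add: add scale cfun.subspace_scale subspace_lincomb)
  also have "\<dots> = (\<lambda>y. \<Sum>i\<in>insert a A. c i * \<phi> (v i) y)"
    using insert by (auto simp: cscale_def plus_fun_def)
  finally show ?case .
next
  case empty
  have "\<phi> (cscale 0 0) = cscale 0 (\<phi> 0)" by (rule scale[OF cfun.subspace_0[OF V(1)]])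
  then show ?case by (simp add: cscale_def zero_fun_def)
next
  case (infinite A)
  have "\<phi> (cscale 0 0) = cscale 0 (\<phi> 0)" by (rule scale[OF cfun.subspace_0[OF V(1)]])
  then show ?case using infinite by (simp add: cscale_def zero_fun_def)
qed

lemma is_hom_lincomb:
  assumes "is_hom G \<rho> V \<sigma> W \<phi>" "cfun.subspace V" "\<And>i. i \<in> A \<Longrightarrow> v i \<in> V"
  shows "\<phi> (\<lambda>y. \<Sum>i\<in>A. c i * v i y) = (\<lambda>y. \<Sum>i\<in>A. c i * \<phi> (v i) y)"
  by (rule linear_lincomb[OF is_homD(2,3)[OF assms(1)] assms(2,3)])

lemma subspace_pull: "subrep G (pull \<rho>) V \<Longrightarrow> cfun.subspace V"
  by (simp add: subrep_def)

lemma subrep_pull: "subrep G (pull \<rho>) V \<Longrightarrow> g \<in> carrier G \<Longrightarrow> f \<in> V \<Longrightarrow> pull \<rho> g f \<in> V"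
  by (simp add: subrep_def)

lemma pull_linear: "pull \<rho> g 0 = 0" "pull \<rho> g (x + y) = pull \<rho> g x + pull \<rho> g y"
  "pull \<rho> g (cscale c x) = cscale c (pull \<rho> g x)"
  by (simp_all add: pull_def cscale_def fun_eq_iff)

lemma subrep_span:
  assumes "\<And>g s. g \<in> carrier G \<Longrightarrow> s \<in> S \<Longrightarrow> pull \<rho> g s \<in> cfun.span S"
  shows "subrep G (pull \<rho>) (cfun.span S)"
  unfolding subrep_def
proof (intro conjI ballI cfun.subspace_span)
  fix g v assume g: "g \<in> carrier G" and v: "v \<in> cfun.span S"
  show "pull \<rho> g v \<in> cfun.span S"
    using v
  proof (rule cfun.span_induct)
    show "cfun.subspace {v. pull \<rho> g v \<in> cfun.span S}"
      by (rule cfun.subspaceI) (simp_all add: pull_linear cfun.span_zero cfun.span_add cfun.span_scale)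
  qed (rule assms[OF g])
qed

locale fin_action = group G for G (structure) +
  fixes \<rho> :: "'a \<Rightarrow> 'b \<Rightarrow> 'b" and X :: "'b set"
  assumes fin_G: "finite (carrier G)" and fin_X: "finite X"
    and closed: "g \<in> carrier G \<Longrightarrow> x \<in> X \<Longrightarrow> \<rho> g x \<in> X"
    and act_mult: "g \<in> carrier G \<Longrightarrow> h \<in> carrier G \<Longrightarrow> \<rho> (g \<otimes> h) x = \<rho> h (\<rho> g x)"
    and act_one: "\<rho> \<one> x = x"
begin

lemma act_inv [simp]: "g \<in> carrier G \<Longrightarrow> \<rho> g (\<rho> (inv g) x) = x" "g \<in> carrier G \<Longrightarrow> \<rho> (inv g) (\<rho> g x) = x"
  using act_mult[of "inv g" g x] act_mult[of g "inv g" x] by (simp_all add: act_one)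

lemma sum_act: "g \<in> carrier G \<Longrightarrow> (\<Sum>x\<in>X. F (\<rho> g x)) = (\<Sum>x\<in>X. F x)"
  by (rule sum.reindex_bij_witness[of _ "\<rho> (inv g)" "\<rho> g"]) (auto intro: closed)

lemma char_on_inv:
  assumes "hermitian X P" "g \<in> carrier G"
  shows "char_on X \<rho> P (inv g) = cnj (char_on X \<rho> P g)"
proof -
  have "char_on X \<rho> P (inv g) = (\<Sum>x\<in>X. P (\<rho> g x) x)"
    unfolding char_on_def using sum_act[OF assms(2), of "\<lambda>x. P x (\<rho> (inv g) x)"] assms(2) by simp
  also have "\<dots> = cnj (char_on X \<rho> P g)"
    unfolding char_on_def cnj_sum using assms closed
    by (intro sum.cong refl) (simp add: hermitianD)
  finally show ?thesis .
qed

text \<open>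
  Two idempotents \<open>P\<close>, \<open>Q\<close> with the same image satisfy \<open>PQ = Q\<close> and \<open>QP = P\<close>; taking adjoints in the
  first gives \<open>QP = Q\<close>.
\<close>

lemma hermitian_projector_unique:
  assumes "projector X V P" "hermitian X P" "projector X V Q" "hermitian X Q" "x \<in> X" "y \<in> X"
  shows "P x y = Q x y"
proof -
  have "Q y x = (\<Sum>z\<in>X. Q y z * P z x)"
    using projector_fix[OF assms(1) projector_mem[OF assms(3,6)]] by simp
  then have "cnj (Q y x) = (\<Sum>z\<in>X. cnj (Q y z) * cnj (P z x))" by simp
  also have "\<dots> = (\<Sum>z\<in>X. P x z * Q z y)"
    using assms(2,4,5,6) by (intro sum.cong refl) (simp add: hermitianD)
  also have "\<dots> = P x y"
    by (rule projector_fix[OF assms(3) projector_mem[OF assms(1,5)]])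
  finally show ?thesis using assms(4-6) by (simp add: hermitianD)
qed

text \<open>
  Translating the kernel by \<open>g\<close> gives another Hermitian projector onto the same invariant subspace.
\<close>

lemma hermitian_projector_equivariant:
  assumes V: "subrep G (pull \<rho>) V" and P: "projector X V P" "hermitian X P"
    and g: "g \<in> carrier G" and xy: "x \<in> X" "y \<in> X"
  shows "P (\<rho> g x) (\<rho> g y) = P x y"
proof -
  define Q where "Q x = pull \<rho> g (P (\<rho> g x))" for x
  have "projector X V Q"
    unfolding projector_def
  proof (intro conjI ballI allI)
    fix x assume "x \<in> X" then show "Q x \<in> V"
      unfolding Q_def using g closed by (intro subrep_pull[OF V] projector_mem[OF P(1)])
  next
    fix f y assume f: "f \<in> V"
    have "(\<Sum>x\<in>X. f x * Q x y) = (\<Sum>x\<in>X. f (\<rho> (inv g) (\<rho> g x)) * P (\<rho> g x) (\<rho> g y))"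
      using g by (simp add: Q_def pull_def)
    also have "\<dots> = (\<Sum>x\<in>X. pull \<rho> (inv g) f x * P x (\<rho> g y))"
      unfolding sum_act[OF g, of "\<lambda>x. f (\<rho> (inv g) x) * P x (\<rho> g y)"] by (simp add: pull_def)
    also have "\<dots> = pull \<rho> (inv g) f (\<rho> g y)"
      using g by (intro projector_fix[OF P(1)] subrep_pull[OF V] f) auto
    finally show "f y = (\<Sum>x\<in>X. f x * Q x y)" using g by (simp add: pull_def)
  qed
  moreover have "hermitian X Q"
    unfolding hermitian_def Q_def pull_def using P(2) g closed by (simp add: hermitianD)
  ultimately have "Q x y = P x y" using hermitian_projector_unique P xy by blast
  then show ?thesis by (simp add: Q_def pull_def)
qed

end

locale two_actions = fin_action G \<rho> X + other: fin_action G \<sigma> Y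
  for G (structure) and \<rho> :: "'a \<Rightarrow> 'b \<Rightarrow> 'b" and X and \<sigma> :: "'a \<Rightarrow> 'c \<Rightarrow> 'c" and Y
begin

text \<open>
  The trace of \<open>\<psi> \<circ> (\<phi> \<circ> g)\<close> equals the trace of \<open>(\<phi> \<circ> g) \<circ> \<psi>\<close>, where \<open>\<psi>\<close> is the inverse of the
  isomorphism \<open>\<phi>\<close>.
\<close>

lemma char_on_rep_iso:
  assumes V: "subrep G (pull \<rho>) V" "projector X V P"
    and W: "subrep G (pull \<sigma>) W" "projector Y W Q"
    and iso: "rep_iso G (pull \<rho>) V (pull \<sigma>) W" and g: "g \<in> carrier G"
  shows "char_on X \<rho> P g = char_on Y \<sigma> Q g"
proof -
  from iso obtain \<phi> where \<phi>: "bij_betw \<phi> V W" and hom: "is_hom G \<rho> V \<sigma> W \<phi>"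
    unfolding rep_iso_def is_hom_def bij_betw_def by auto
  define \<psi> where "\<psi> = inv_into V \<phi>"
  note sV = subspace_pull[OF V(1)] and sW = subspace_pull[OF W(1)]
  have \<phi>W: "\<phi> f \<in> W" if "f \<in> V" for f using \<phi> that by (auto simp: bij_betw_def)
  have \<psi>V: "\<psi> f \<in> V" if "f \<in> W" for f using \<phi> that by (auto simp: \<psi>_def bij_betw_def inv_into_into)
  have \<phi>\<psi>: "\<phi> (\<psi> f) = f" if "f \<in> W" for f using \<phi> that by (auto simp: \<psi>_def bij_betw_inv_into_right)
  have \<psi>\<phi>: "\<psi> (\<phi> f) = f" if "f \<in> V" for f using \<phi> that by (auto simp: \<psi>_def bij_betw_inv_into_left)
  have lin: "\<psi> (\<lambda>y. \<Sum>i\<in>Y. c i * Q i y) = (\<lambda>y. \<Sum>i\<in>Y. c i * \<psi> (Q i) y)" for c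
  proof -
    have "\<phi> (\<lambda>y. \<Sum>i\<in>Y. c i * \<psi> (Q i) y) = (\<lambda>y. \<Sum>i\<in>Y. c i * \<phi> (\<psi> (Q i)) y)"
      by (rule is_hom_lincomb[OF hom sV]) (auto intro: \<psi>V projector_mem[OF W(2)])
    also have "\<dots> = (\<lambda>y. \<Sum>i\<in>Y. c i * Q i y)"
      using projector_mem[OF W(2)] by (simp add: \<phi>\<psi>)
    finally have "\<psi> (\<lambda>y. \<Sum>i\<in>Y. c i * Q i y) = \<psi> (\<phi> (\<lambda>y. \<Sum>i\<in>Y. c i * \<psi> (Q i) y))" by simp
    also have "\<dots> = (\<lambda>y. \<Sum>i\<in>Y. c i * \<psi> (Q i) y)"
      by (rule \<psi>\<phi>[OF subspace_lincomb[OF sV]]) (auto intro: \<psi>V projector_mem[OF W(2)])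
    finally show ?thesis .
  qed
  have "P x (\<rho> g x) = (\<Sum>y\<in>Y. \<phi> (P x) (\<sigma> g y) * \<psi> (Q y) x)" if x: "x \<in> X" for x
  proof -
    let ?h = "pull \<rho> g (P x)"
    have PV: "P x \<in> V" using x by (rule projector_mem[OF V(2)])
    have hV: "?h \<in> V" using PV g by (intro subrep_pull[OF V(1)])
    have "?h = \<psi> (\<phi> ?h)" using hV by (simp add: \<psi>\<phi>)
    also have "\<phi> ?h = (\<lambda>z. \<Sum>y\<in>Y. \<phi> ?h y * Q y z)"
      using projector_fix[OF W(2) \<phi>W[OF hV]] by (simp add: fun_eq_iff)
    also have "\<psi> \<dots> = (\<lambda>z. \<Sum>y\<in>Y. \<phi> ?h y * \<psi> (Q y) z)" by (rule lin)
    finally have "?h x = (\<Sum>y\<in>Y. \<phi> ?h y * \<psi> (Q y) x)" by (rule fun_cong)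
    moreover have "\<phi> ?h = pull \<sigma> g (\<phi> (P x))" by (rule is_homD(4)[OF hom g PV])
    ultimately show ?thesis by (simp add: pull_def)
  qed
  then have "char_on X \<rho> P g = (\<Sum>x\<in>X. \<Sum>y\<in>Y. \<phi> (P x) (\<sigma> g y) * \<psi> (Q y) x)"
    by (simp add: char_on_def)
  also have "\<dots> = (\<Sum>y\<in>Y. \<Sum>x\<in>X. \<psi> (Q y) x * \<phi> (P x) (\<sigma> g y))"
    by (subst sum.swap) (simp add: mult.commute)
  also have "\<dots> = (\<Sum>y\<in>Y. Q y (\<sigma> g y))"
  proof (rule sum.cong[OF refl])
    fix y assume "y \<in> Y"
    then have QW: "Q y \<in> W" by (rule projector_mem[OF W(2)])
    have "\<psi> (Q y) = (\<lambda>z. \<Sum>x\<in>X. \<psi> (Q y) x * P x z)"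
      using projector_fix[OF V(2) \<psi>V[OF QW]] by (simp add: fun_eq_iff)
    then have "\<phi> (\<psi> (Q y)) = \<phi> (\<lambda>z. \<Sum>x\<in>X. \<psi> (Q y) x * P x z)" by simp
    also have "\<dots> = (\<lambda>z. \<Sum>x\<in>X. \<psi> (Q y) x * \<phi> (P x) z)"
      by (rule is_hom_lincomb[OF hom sV]) (rule projector_mem[OF V(2)])
    finally have "Q y = (\<lambda>z. \<Sum>x\<in>X. \<psi> (Q y) x * \<phi> (P x) z)" unfolding \<phi>\<psi>[OF QW] .
    then show "(\<Sum>x\<in>X. \<psi> (Q y) x * \<phi> (P x) (\<sigma> g y)) = Q y (\<sigma> g y)"
      by (rule fun_cong[OF sym])
  qed
  finally show ?thesis by (simp add: char_on_def)
qed

text \<open>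
  The group average of \<open>g \<circ> E \<circ> g\<^sup>-\<^sup>1\<close>, up to normalization, for the rank one operator \<open>E\<close> sending
  \<open>f\<close> to \<open>f x\<close> times the projection of the indicator function of \<open>y\<close>.
\<close>

definition avg_hom :: "('c \<Rightarrow> 'c \<Rightarrow> complex) \<Rightarrow> 'b \<Rightarrow> 'c \<Rightarrow> ('b \<Rightarrow> complex) \<Rightarrow> 'c \<Rightarrow> complex" where
  "avg_hom Q x y f = (\<lambda>z. \<Sum>g\<in>carrier G. f (\<rho> (inv g) x) * Q y (\<sigma> g z))"

lemma is_hom_avg:
  assumes W: "subrep G (pull \<sigma>) W" "projector Y W Q" and y: "y \<in> Y"
  shows "is_hom G \<rho> V \<sigma> W (avg_hom Q x y)"
proof (rule is_homI)
  fix f assume "f \<in> V"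
  have "(\<lambda>z. \<Sum>g\<in>carrier G. f (\<rho> (inv g) x) * pull \<sigma> g (Q y) z) \<in> W"
    by (intro subspace_lincomb subspace_pull[OF W(1)] subrep_pull[OF W(1)] projector_mem[OF W(2)] y)
  then show "avg_hom Q x y f \<in> W" by (simp add: avg_hom_def pull_def)
next
  fix h f assume h: "h \<in> carrier G"
  show "avg_hom Q x y (pull \<rho> h f) = pull \<sigma> h (avg_hom Q x y f)"
  proof
    fix z
    have "avg_hom Q x y (pull \<rho> h f) z = (\<Sum>g\<in>carrier G. f (\<rho> h (\<rho> (inv g) x)) * Q y (\<sigma> g z))"
      by (simp add: avg_hom_def pull_def)
    also have "\<dots> = (\<Sum>g\<in>carrier G. f (\<rho> (inv g) x) * Q y (\<sigma> g (\<sigma> h z)))"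
    proof (rule sum.reindex_bij_witness[of _ "\<lambda>g. h \<otimes> g" "\<lambda>g. inv h \<otimes> g"])
      fix g assume g: "g \<in> carrier G"
      show "f (\<rho> (inv (inv h \<otimes> g)) x) * Q y (\<sigma> (inv h \<otimes> g) (\<sigma> h z))
          = f (\<rho> h (\<rho> (inv g) x)) * Q y (\<sigma> g z)"
        using g h by (simp add: inv_mult_group act_mult other.act_mult)
    qed (use h in \<open>auto simp: m_assoc[symmetric]\<close>)
    finally show "avg_hom Q x y (pull \<rho> h f) z = pull \<sigma> h (avg_hom Q x y f) z"
      by (simp add: avg_hom_def pull_def)
  qed
qed (auto simp: avg_hom_def fun_eq_iff cscale_def algebra_simps sum.distrib sum_distrib_left)

text \<open>
  Summing matrix entries of the averaged rank one operators recovers the inner product of the two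
  characters; this turns statements on homomorphisms into orthogonality relations.
\<close>

lemma sum_avg_hom:
  "(\<Sum>x\<in>X. \<Sum>y\<in>Y. avg_hom Q x y (P x) y) = (\<Sum>g\<in>carrier G. char_on X \<rho> P (inv g) * char_on Y \<sigma> Q g)"
proof -
  have "(\<Sum>x\<in>X. \<Sum>y\<in>Y. avg_hom Q x y (P x) y)
      = (\<Sum>g\<in>carrier G. \<Sum>x\<in>X. \<Sum>y\<in>Y. P x (\<rho> (inv g) x) * Q y (\<sigma> g y))"
    unfolding avg_hom_def by (subst (2) sum.swap, subst sum.swap) (rule refl)
  then show ?thesis by (simp add: char_on_def sum_product)
qed

lemma char_orthogonal:
  assumes W: "subrep G (pull \<sigma>) W" "projector Y W Q" and P: "projector X V P"
    and zero: "\<And>\<phi> f. is_hom G \<rho> V \<sigma> W \<phi> \<Longrightarrow> f \<in> V \<Longrightarrow> \<phi> f = 0"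
  shows "(\<Sum>g\<in>carrier G. char_on X \<rho> P (inv g) * char_on Y \<sigma> Q g) = 0"
  unfolding sum_avg_hom[symmetric]
  using zero[OF is_hom_avg[OF W] projector_mem[OF P]] by (simp add: zero_fun_def)

end

context fin_action
begin

text \<open>
  Each averaged operator is a scalar multiple of the inclusion of \<open>V\<close> into \<open>W\<close>. Its trace determines
  the scalar, and the sum of the resulting matrix entries is \<open>|G|\<close> times the trace of \<open>P \<circ> P\<close> divided by the trace
  \<open>d\<close> of \<open>P\<close>.
\<close>

lemma char_unit_norm:
  assumes V: "subrep G (pull \<rho>) V" "projector X V P" "hermitian X P" "V \<subseteq> supported X" "V \<noteq> {0}"
    and W: "subrep G (pull \<rho>) W" "projector X W Q" "hermitian X Q" and VW: "V \<subseteq> W"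
    and scalar: "\<And>\<phi>. is_hom G \<rho> V \<rho> W \<phi> \<Longrightarrow> \<exists>c. \<forall>f\<in>V. \<phi> f = cscale c f"
  shows "(\<Sum>g\<in>carrier G. char_on X \<rho> P (inv g) * char_on X \<rho> Q g) = of_nat (card (carrier G))"
proof -
  interpret two_actions G \<rho> X \<rho> X by unfold_locales
  define d where "d = (\<Sum>x\<in>X. P x x)"
  have d: "d \<noteq> 0"
    using hermitian_projector_trace_zero[OF fin_X V(4,2,3)] V(5) cfun.subspace_0[OF subspace_pull[OF V(1)]]
    by (auto simp: d_def)
  have avg: "avg_hom Q x y (P x) y = of_nat (card (carrier G)) / d * (P x y * P y x)"
    if xy: "x \<in> X" "y \<in> X" for x y
  proof -
    obtain c where c: "\<And>f. f \<in> V \<Longrightarrow> avg_hom Q x y f = cscale c f"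
      using scalar[OF is_hom_avg[OF W(1,2) xy(2)]] by blast
    have "c * d = (\<Sum>z\<in>X. avg_hom Q x y (P z) z)"
      using c projector_mem[OF V(2)] by (simp add: d_def cscale_def sum_distrib_left)
    also have "\<dots> = (\<Sum>g\<in>carrier G. \<Sum>z\<in>X. P z (\<rho> (inv g) x) * Q y (\<rho> g z))"
      unfolding avg_hom_def by (rule sum.swap)
    also have "\<dots> = (\<Sum>g\<in>carrier G. P y x)"
    proof (rule sum.cong[OF refl])
      fix g assume g: "g \<in> carrier G"
      have "(\<Sum>z\<in>X. P z (\<rho> (inv g) x) * Q y (\<rho> g z)) = (\<Sum>z\<in>X. P (\<rho> g z) x * Q y (\<rho> g z))"
        using hermitian_projector_equivariant[OF V(1-3) g] closed g xy
        by (intro sum.cong refl) (metis act_inv(1) inv_closed)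
      also have "\<dots> = (\<Sum>z\<in>X. P z x * Q y z)"
        by (rule sum_act[OF g, of "\<lambda>z. P z x * Q y z"])
      also have "\<dots> = cnj (\<Sum>z\<in>X. P x z * Q z y)"
        unfolding cnj_sum using V(3) W(3) xy by (intro sum.cong refl) (simp add: hermitianD)
      also have "(\<Sum>z\<in>X. P x z * Q z y) = P x y"
        using VW projector_mem[OF V(2)] xy by (intro projector_fix[OF W(2)]) auto
      also have "cnj (P x y) = P y x" using V(3) xy by (simp add: hermitianD)
      finally show "(\<Sum>z\<in>X. P z (\<rho> (inv g) x) * Q y (\<rho> g z)) = P y x" .
    qed
    finally have "c = of_nat (card (carrier G)) / d * P y x" using d by (simp add: field_simps)
    then show ?thesis using c[OF projector_mem[OF V(2) xy(1)]] by (simp add: cscale_def)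
  qed
  have "(\<Sum>g\<in>carrier G. char_on X \<rho> P (inv g) * char_on X \<rho> Q g)
      = (\<Sum>x\<in>X. \<Sum>y\<in>X. of_nat (card (carrier G)) / d * (P x y * P y x))"
    unfolding sum_avg_hom[symmetric] using avg by simp
  also have "\<dots> = of_nat (card (carrier G)) / d * (\<Sum>x\<in>X. \<Sum>y\<in>X. P x y * P y x)"
    by (simp add: sum_distrib_left)
  also have "(\<Sum>x\<in>X. \<Sum>y\<in>X. P x y * P y x) = d"
    unfolding d_def using projector_fix[OF V(2) projector_mem[OF V(2)]] by simp
  finally show ?thesis using d by simp
qed

end

section \<open>Multiplicities as inner products of characters\<close>

lemma rep_iso_refl: "rep_iso G r V r V"
  unfolding rep_iso_def by (rule exI[of _ id]) (auto simp: bij_betw_def)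

lemma (in fin_action) char_on_unique:
  assumes "subrep G (pull \<rho>) V" "projector X V P" "projector X V Q" "g \<in> carrier G"
  shows "char_on X \<rho> P g = char_on X \<rho> Q g"
proof -
  interpret two_actions G \<rho> X \<rho> X by unfold_locales
  show ?thesis by (rule char_on_rep_iso[OF assms(1,2,1,3) rep_iso_refl assms(4)])
qed

text \<open>
  The coordinate maps of the direct sum, composed with the projection onto \<open>W\<close>, are projectors onto
  the summands, and they add up to the projector onto \<open>W\<close>. They need not be Hermitian, which is why
  characters are defined by arbitrary projectors.
\<close>

lemma (in fin_action) char_on_decomp:
  assumes sW: "cfun.subspace W" and P: "projector X W P"
    and dec: "irrep_decomp G (pull \<rho>) W k U"
    and Q: "\<And>i. i < k \<Longrightarrow> projector X (U i) (Q i)" and g: "g \<in> carrier G"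
  shows "char_on X \<rho> P g = (\<Sum>i<k. char_on X \<rho> (Q i) g)"
proof -
  have rU: "subrep G (pull \<rho>) (U i)" if "i < k" for i
    using dec that by (simp add: irrep_decomp_def irrep_def)
  note sU = subspace_pull[OF rU]
  define S where "S = (\<lambda>u :: nat \<Rightarrow> 'b \<Rightarrow> complex. \<Sum>i<k. u i)"
  have bij: "bij_betw S (PiE {..<k} U) W" using dec by (simp add: irrep_decomp_def S_def)
  have SW: "S u \<in> W" if "u \<in> PiE {..<k} U" for u
    using bij that by (simp add: bij_betw_apply)
  define c where "c = inv_into (PiE {..<k} U) S"
  have c: "c w \<in> PiE {..<k} U" "S (c w) = w" if "w \<in> W" for w
    using bij that by (auto simp: c_def bij_betw_def inv_into_into f_inv_into_f)
  have cU: "c w i \<in> U i" if "w \<in> W" "i < k" for w i using c(1)[OF that(1)] that(2) by auto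
  have ceq: "c w = u" if "u \<in> PiE {..<k} U" "S u = w" for u w
    using inv_into_f_f[OF bij_betw_imp_inj_on[OF bij] that(1)] that(2) by (simp add: c_def)
  have add: "c (v + w) i = c v i + c w i" if vw: "v \<in> W" "w \<in> W" and i: "i < k" for v w i
  proof -
    have "c (v + w) = (\<lambda>i\<in>{..<k}. c v i + c w i)"
    proof (rule ceq)
      show "(\<lambda>i\<in>{..<k}. c v i + c w i) \<in> PiE {..<k} U"
        using vw cU by (auto intro!: cfun.subspace_add sU)
      have "S (\<lambda>i\<in>{..<k}. c v i + c w i) = S (c v) + S (c w)"
        unfolding S_def sum.distrib[symmetric] by (rule sum.cong) auto
      then show "S (\<lambda>i\<in>{..<k}. c v i + c w i) = v + w" using c(2) vw by simp
    qed
    then show ?thesis using i by simp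
  qed
  have scale: "c (cscale a w) i = cscale a (c w i)" if w: "w \<in> W" and i: "i < k" for a w i
  proof -
    have "c (cscale a w) = (\<lambda>i\<in>{..<k}. cscale a (c w i))"
    proof (rule ceq)
      show "(\<lambda>i\<in>{..<k}. cscale a (c w i)) \<in> PiE {..<k} U"
        using w cU by (auto intro!: cfun.subspace_scale sU)
      have "S (\<lambda>i\<in>{..<k}. cscale a (c w i)) = cscale a (S (c w))"
        unfolding S_def cfun.scale_sum_right by (rule sum.cong) auto
      then show "S (\<lambda>i\<in>{..<k}. cscale a (c w i)) = cscale a w" using c(2) w by simp
    qed
    then show ?thesis using i by simp
  qed
  have UW: "U j \<subseteq> W" and own: "f \<in> U j \<Longrightarrow> c f j = f" if j: "j < k" for j f
  proof -
    have *: "(\<lambda>i\<in>{..<k}. if i = j then f else 0) \<in> PiE {..<k} U" if "f \<in> U j" for f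
      using that cfun.subspace_0[OF sU] by auto
    have **: "S (\<lambda>i\<in>{..<k}. if i = j then f else 0) = f" for f
      using j by (simp add: S_def)
    show "U j \<subseteq> W"
    proof
      fix f assume "f \<in> U j"
      from SW[OF *[OF this]] show "f \<in> W" unfolding ** .
    qed
    show "c f j = f" if "f \<in> U j"
      using ceq[OF *[OF that] **] j by simp
  qed
  define E where "E i x = c (P x) i" for i x
  have E: "projector X (U i) (E i)" if i: "i < k" for i
    unfolding projector_def
  proof (intro conjI ballI allI)
    fix x assume "x \<in> X" then show "E i x \<in> U i"
      unfolding E_def using i by (intro cU projector_mem[OF P])
  next
    fix f y assume f: "f \<in> U i"
    then have fW: "f \<in> W" using UW[OF i] by blast
    have "f = c f i" using own[OF i f] by simp
    also have "c f i = c (\<lambda>y. \<Sum>x\<in>X. f x * P x y) i"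
      using projector_fix[OF P fW] by simp
    also have "\<dots> = (\<lambda>y. \<Sum>x\<in>X. f x * c (P x) i y)"
      by (rule linear_lincomb[of W "\<lambda>w. c w i"])
         (use i add scale sW projector_mem[OF P] in auto)
    finally show "f y = (\<Sum>x\<in>X. f x * E i x y)" unfolding E_def by (rule fun_cong)
  qed
  have "char_on X \<rho> P g = (\<Sum>x\<in>X. \<Sum>i<k. E i x (\<rho> g x))"
    unfolding char_on_def
  proof (rule sum.cong[OF refl])
    fix x assume "x \<in> X"
    then have "P x = S (c (P x))" using c(2) projector_mem[OF P] by simp
    then have "P x = (\<Sum>i<k. E i x)" by (simp add: S_def E_def)
    then show "P x (\<rho> g x) = (\<Sum>i<k. E i x (\<rho> g x))" by (metis fun_sum_apply)
  qed
  also have "\<dots> = (\<Sum>i<k. char_on X \<rho> (E i) g)"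
    unfolding char_on_def by (rule sum.swap)
  also have "\<dots> = (\<Sum>i<k. char_on X \<rho> (Q i) g)"
    using char_on_unique[OF rU E Q g] by simp
  finally show ?thesis .
qed

lemma irrep_decomp_Suc:
  fixes U :: "('b \<Rightarrow> complex) set"
  assumes U: "irrep G r U" "subrep G r W'" and W: "U \<subseteq> W" "W' \<subseteq> W" "cfun.subspace W" and int: "U \<inter> W' = {0}"
    and sum: "\<And>w. w \<in> W \<Longrightarrow> \<exists>u\<in>U. \<exists>v\<in>W'. w = u + v"
    and dec: "irrep_decomp G r W' k F"
  shows "irrep_decomp G r W (Suc k) (F(k := U))"
proof -
  let ?F = "F(k := U)"
  define S where "S = (\<lambda>u :: nat \<Rightarrow> 'b \<Rightarrow> complex. \<Sum>i<k. u i)"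
  have bij: "bij_betw S (PiE {..<k} F) W'" using dec by (simp add: irrep_decomp_def S_def)
  have sU: "cfun.subspace U" and sW': "cfun.subspace W'" using U by (auto simp: irrep_def subrep_def)
  have res: "restrict u {..<k} \<in> PiE {..<k} F" "S (restrict u {..<k}) = S u" "u k \<in> U"
    "S u \<in> W'" if u: "u \<in> PiE {..<Suc k} ?F" for u
  proof -
    show 1: "restrict u {..<k} \<in> PiE {..<k} F"
    proof (rule restrict_PiE_iff[THEN iffD2], intro ballI)
      fix i assume "i \<in> {..<k}"
      then show "u i \<in> F i" using PiE_mem[OF u, of i] by auto
    qed
    show 2: "S (restrict u {..<k}) = S u" by (simp add: S_def)
    show "u k \<in> U" using PiE_mem[OF u, of k] by simp
    show "S u \<in> W'" using bij_betw_apply[OF bij 1] unfolding 2 .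
  qed
  have "bij_betw (\<lambda>u. S u + u k) (PiE {..<Suc k} ?F) W"
    unfolding bij_betw_def
  proof
    show "inj_on (\<lambda>u. S u + u k) (PiE {..<Suc k} ?F)"
    proof (rule inj_onI)
      fix u v assume u: "u \<in> PiE {..<Suc k} ?F" and v: "v \<in> PiE {..<Suc k} ?F" and eq: "S u + u k = S v + v k"
      have "u k - v k = S v - S u" using eq by (simp add: algebra_simps)
      moreover have "u k - v k \<in> U" using res(3) u v by (intro cfun.subspace_diff[OF sU])
      moreover have "S v - S u \<in> W'" using res(4) u v by (intro cfun.subspace_diff[OF sW'])
      ultimately have "u k - v k \<in> U \<inter> W'" by simp
      then have uk: "u k = v k" using int by simp
      then have "S (restrict u {..<k}) = S (restrict v {..<k})" using eq res(2) u v by simp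
      then have "restrict u {..<k} = restrict v {..<k}"
        using res(1)[OF u] res(1)[OF v] by (rule inj_onD[OF bij_betw_imp_inj_on[OF bij]])
      then have "u i = v i" if "i < k" for i using that by (metis lessThan_iff restrict_apply')
      then show "u = v"
        using uk u v by (intro PiE_ext[of u "{..<Suc k}" ?F v]) (auto simp: less_Suc_eq)
    qed
    show "(\<lambda>u. S u + u k) ` PiE {..<Suc k} ?F = W"
    proof
      show "(\<lambda>u. S u + u k) ` PiE {..<Suc k} ?F \<subseteq> W"
        using res(3,4) W by (auto intro!: cfun.subspace_add[OF W(3)])
      show "W \<subseteq> (\<lambda>u. S u + u k) ` PiE {..<Suc k} ?F"
      proof
        fix w assume "w \<in> W"
        then obtain x v where x: "x \<in> U" "v \<in> W'" "w = x + v" using sum by blast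
        then obtain u where u: "u \<in> PiE {..<k} F" "S u = v" using bij by (auto simp: bij_betw_def)
        have "u(k := x) \<in> PiE {..<Suc k} ?F"
          unfolding lessThan_Suc using u(1) x(1) by (intro PiE_fun_upd[of x ?F]) (auto simp: PiE_def Pi_def)
        moreover have "S (u(k := x)) = v" using u(2) by (simp add: S_def)
        ultimately show "w \<in> (\<lambda>u. S u + u k) ` PiE {..<Suc k} ?F"
          using x(3) by (intro image_eqI[of _ _ "u(k := x)"]) (simp_all add: add.commute)
      qed
    qed
  qed
  moreover have "\<forall>i<Suc k. irrep G r (?F i)"
    using U dec by (simp add: irrep_decomp_def less_Suc_eq)
  ultimately show ?thesis by (simp add: irrep_decomp_def S_def)
qed

context fin_action
begin

definition has_dim :: "('b \<Rightarrow> complex) set \<Rightarrow> nat \<Rightarrow> bool" where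
  "has_dim V d \<longleftrightarrow> (\<exists>P. projector X V P \<and> hermitian X P \<and> (\<Sum>x\<in>X. P x x) = of_nat d)"

lemma has_dim_exists:
  assumes "subrep G (pull \<rho>) V" "V \<subseteq> supported X"
  shows "\<exists>d. has_dim V d"
  using hermitian_projector_exists[OF fin_X subspace_pull[OF assms(1)] assms(2)]
  unfolding has_dim_def by metis

lemma has_dim_0:
  assumes "has_dim V 0" "subrep G (pull \<rho>) V" "V \<subseteq> supported X"
  shows "V = {0}"
  using assms hermitian_projector_trace_zero[OF fin_X assms(3)] cfun.subspace_0[OF subspace_pull[OF assms(2)]]
  unfolding has_dim_def by fastforce

text \<open>
  The orthogonal complement of \<open>U\<close> in \<open>W\<close> is invariant because the Hermitian projector is equivariant;
  the difference of the two projectors projects onto it, so the dimensions subtract.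
\<close>

lemma complement_exists:
  assumes U: "subrep G (pull \<rho>) U" "has_dim U d" and W: "subrep G (pull \<rho>) W" "has_dim W e"
    and UW: "U \<subseteq> W" "W \<subseteq> supported X"
  obtains W' where "subrep G (pull \<rho>) W'" "W' \<subseteq> W" "U \<inter> W' = {0}"
    "\<And>w. w \<in> W \<Longrightarrow> \<exists>u\<in>U. \<exists>v\<in>W'. w = u + v" "has_dim W' (e - d)" "d \<le> e"
proof -
  obtain P where P: "projector X U P" "hermitian X P" "(\<Sum>x\<in>X. P x x) = of_nat d"
    using U(2) by (auto simp: has_dim_def)
  obtain Q where Q: "projector X W Q" "hermitian X Q" "(\<Sum>x\<in>X. Q x x) = of_nat e"
    using W(2) by (auto simp: has_dim_def)
  note sU = subspace_pull[OF U(1)] and sW = subspace_pull[OF W(1)]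
  have P0: "P x y = 0" if "x \<in> X" "y \<notin> X" for x y
    using projector_mem[OF P(1) that(1)] UW that(2) by (auto simp: supported_def)
  define W' where "W' = {w \<in> W. \<forall>y. (\<Sum>x\<in>X. w x * P x y) = 0}"
  have sub: "subrep G (pull \<rho>) W'"
    unfolding subrep_def
  proof (intro conjI ballI)
    show "cfun.subspace W'"
    proof (rule cfun.subspaceI)
      show "0 \<in> W'" using cfun.subspace_0[OF sW] by (simp add: W'_def)
    next
      fix v w assume "v \<in> W'" "w \<in> W'"
      then show "v + w \<in> W'"
        using cfun.subspace_add[OF sW, of v w] by (simp add: W'_def algebra_simps sum.distrib)
    next
      fix c w assume "w \<in> W'"
      then show "cscale c w \<in> W'"
        using cfun.subspace_scale[OF sW, of w c]
        by (simp add: W'_def cscale_def mult.assoc sum_distrib_left[symmetric])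
    qed
  next
    fix g w assume g: "g \<in> carrier G" and w: "w \<in> W'"
    have "(\<Sum>x\<in>X. pull \<rho> g w x * P x y) = 0" for y
    proof (cases "y \<in> X")
      case True
      have "(\<Sum>x\<in>X. pull \<rho> g w x * P x y) = (\<Sum>x\<in>X. w (\<rho> g x) * P (\<rho> g x) (\<rho> g y))"
        using hermitian_projector_equivariant[OF U(1) P(1,2) g] True by (simp add: pull_def)
      also have "\<dots> = (\<Sum>x\<in>X. w x * P x (\<rho> g y))" by (rule sum_act[OF g, of "\<lambda>x. w x * P x (\<rho> g y)"])
      finally show ?thesis using w by (simp add: W'_def)
    qed (simp add: P0)
    then show "pull \<rho> g w \<in> W'" using w subrep_pull[OF W(1) g] by (simp add: W'_def)
  qed
  have dim: "projector X W' (\<lambda>x. Q x - P x)"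
    unfolding projector_def
  proof (intro conjI ballI allI)
    fix x assume x: "x \<in> X"
    have "(\<Sum>z\<in>X. (Q x - P x) z * P z y) = 0" for y
    proof (cases "y \<in> X")
      case True
      have "(\<Sum>z\<in>X. Q x z * P z y) = cnj (\<Sum>z\<in>X. P y z * Q z x)"
        unfolding cnj_sum using P(2) Q(2) x True
        by (intro sum.cong refl) (simp add: hermitianD mult.commute)
      also have "(\<Sum>z\<in>X. P y z * Q z x) = P y x"
        using True projector_mem[OF P(1)] UW by (intro projector_fix[OF Q(1)]) auto
      also have "cnj (P y x) = P x y" using P(2) x True by (simp add: hermitianD)
      finally show ?thesis
        using projector_fix[OF P(1) projector_mem[OF P(1) x]]
        by (simp add: left_diff_distrib sum_subtractf)
    qed (simp add: P0)
    moreover have "Q x - P x \<in> W"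
      using projector_mem[OF Q(1) x] projector_mem[OF P(1) x] UW by (intro cfun.subspace_diff[OF sW]) auto
    ultimately show "Q x - P x \<in> W'" by (simp add: W'_def)
  next
    fix f y assume f: "f \<in> W'"
    then have "(\<Sum>x\<in>X. f x * Q x y) = f y" by (intro projector_fix[OF Q(1)]) (simp add: W'_def)
    then show "f y = (\<Sum>x\<in>X. f x * (Q x - P x) y)"
      using f by (simp add: W'_def right_diff_distrib sum_subtractf)
  qed
  have herm: "hermitian X (\<lambda>x. Q x - P x)"
    unfolding hermitian_def using P(2) Q(2) by (simp add: hermitianD)
  have sub': "W' \<subseteq> supported X" using UW by (auto simp: W'_def)
  obtain d' where "has_dim W' d'" using has_dim_exists[OF sub sub'] by blast
  then obtain R where R: "projector X W' R" "(\<Sum>x\<in>X. R x x) = of_nat d'" by (auto simp: has_dim_def)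
  have "char_on X \<rho> R \<one> = char_on X \<rho> (\<lambda>x. Q x - P x) \<one>"
    by (rule char_on_unique[OF sub R(1) dim]) simp
  then have "(\<Sum>x\<in>X. R x x) = (\<Sum>x\<in>X. Q x x) - (\<Sum>x\<in>X. P x x)"
    by (simp add: char_on_def act_one sum_subtractf)
  then have "complex_of_nat (d' + d) = of_nat e" using P(3) Q(3) R(2) by simp
  then have de: "d' + d = e" by (simp only: of_nat_eq_iff)
  have "has_dim W' (e - d)" using \<open>has_dim W' d'\<close> de by auto
  moreover have "U \<inter> W' = {0}"
  proof
    show "{0} \<subseteq> U \<inter> W'" using cfun.subspace_0[OF sU] cfun.subspace_0[OF subspace_pull[OF sub]] by simp
    show "U \<inter> W' \<subseteq> {0}"
    proof
      fix f assume f: "f \<in> U \<inter> W'"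
      have "f y = 0" for y
        using projector_fix[OF P(1), of f y] f by (simp add: W'_def)
      then show "f \<in> {0}" by (simp add: fun_eq_iff)
    qed
  qed
  moreover have "\<exists>u\<in>U. \<exists>v\<in>W'. w = u + v" if w: "w \<in> W" for w
  proof -
    let ?u = "\<lambda>y. \<Sum>x\<in>X. w x * P x y"
    have u: "?u \<in> U" by (intro subspace_lincomb sU projector_mem[OF P(1)])
    have "(\<Sum>x\<in>X. (w - ?u) x * P x y) = 0" for y
      using projector_fix[OF P(1) u, of y] by (simp add: left_diff_distrib sum_subtractf)
    then have "w - ?u \<in> W'"
      using cfun.subspace_diff[OF sW w, of ?u] u UW by (auto simp: W'_def)
    moreover have "w = ?u + (w - ?u)" by simp
    ultimately show ?thesis using u by blast
  qed
  moreover have "W' \<subseteq> W" by (auto simp: W'_def)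
  ultimately show ?thesis using that sub de by simp
qed

text \<open>
  A nonzero invariant subspace of least dimension is irreducible.
\<close>

lemma irrep_exists:
  assumes W: "subrep G (pull \<rho>) W" "W \<subseteq> supported X" "W \<noteq> {0}"
  obtains U where "irrep G (pull \<rho>) U" "U \<subseteq> W"
proof -
  define good where "good d \<longleftrightarrow> (\<exists>U. subrep G (pull \<rho>) U \<and> U \<subseteq> W \<and> U \<noteq> {0} \<and> has_dim U d)" for d
  have "\<exists>d. good d" using has_dim_exists[OF W(1,2)] W by (auto simp: good_def)
  then obtain d where d: "good d" "\<And>e. e < d \<Longrightarrow> \<not> good e" by (metis exists_least_iff)
  then obtain U where U: "subrep G (pull \<rho>) U" "U \<subseteq> W" "U \<noteq> {0}" "has_dim U d" by (auto simp: good_def)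
  have "U' = {0} \<or> U' = U" if U': "subrep G (pull \<rho>) U'" "U' \<subseteq> U" for U'
  proof (rule disjCI)
    assume ne: "U' \<noteq> U"
    have sup: "U \<subseteq> supported X" using U W by auto
    obtain d' where d': "has_dim U' d'" using has_dim_exists[OF U'(1)] U' sup by auto
    obtain V where V: "subrep G (pull \<rho>) V" "V \<subseteq> U" "\<And>w. w \<in> U \<Longrightarrow> \<exists>u\<in>U'. \<exists>v\<in>V. w = u + v"
        "has_dim V (d - d')" "d' \<le> d"
      using complement_exists[OF U'(1) d' U(1,4) U'(2) sup] by metis
    show "U' = {0}"
    proof (rule ccontr)
      assume "U' \<noteq> {0}"
      then have "good d'" unfolding good_def using U' U(2) d' by (meson order_trans)
      then have "d' = d" using d(2) V(5) by (metis le_neq_implies_less)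
      then have "V = {0}" using has_dim_0[of V] V sup by auto
      then have "U \<subseteq> U'" using V(3) by fastforce
      then show False using ne U'(2) by auto
    qed
  qed
  then have "irrep G (pull \<rho>) U" using U by (simp add: irrep_def)
  then show ?thesis using U(2) that by blast
qed

lemma irrep_decomp_exists:
  assumes "subrep G (pull \<rho>) W" "W \<subseteq> supported X"
  shows "\<exists>k U. irrep_decomp G (pull \<rho>) W k U"
proof -
  obtain d where "has_dim W d" using has_dim_exists[OF assms] by blast
  then show ?thesis using assms
  proof (induction d arbitrary: W rule: less_induct)
    case (less d)
    show ?case
    proof (cases "W = {0}")
      case True
      then have "irrep_decomp G (pull \<rho>) W 0 (\<lambda>_. {})" by (simp add: irrep_decomp_def bij_betw_def)
      then show ?thesis by blast
    next
      case False
      obtain U where U: "irrep G (pull \<rho>) U" "U \<subseteq> W" using irrep_exists[OF less.prems(2,3) False] .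
      then have rU: "subrep G (pull \<rho>) U" "U \<noteq> {0}" "U \<subseteq> supported X" using less.prems by (auto simp: irrep_def)
      obtain e where e: "has_dim U e" using has_dim_exists[OF rU(1,3)] by blast
      have "e \<noteq> 0" using has_dim_0[OF _ rU(1,3)] e rU(2) by (intro notI) simp
      obtain W' where W': "subrep G (pull \<rho>) W'" "W' \<subseteq> W" "U \<inter> W' = {0}"
        "\<And>w. w \<in> W \<Longrightarrow> \<exists>u\<in>U. \<exists>v\<in>W'. w = u + v" "has_dim W' (d - e)" "e \<le> d"
        using complement_exists[OF rU(1) e less.prems(2,1) U(2) less.prems(3)] by metis
      have "\<exists>k F. irrep_decomp G (pull \<rho>) W' k F"
        using \<open>e \<noteq> 0\<close> W' less.prems by (intro less.IH[of "d - e"]) auto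
      then obtain k F where "irrep_decomp G (pull \<rho>) W' k F" by blast
      from irrep_decomp_Suc[OF U(1) W'(1) U(2) W'(2) subspace_pull[OF less.prems(2)] W'(3,4) this]
      show ?thesis by blast
    qed
  qed
qed

end

context two_actions
begin

lemma schur:
  assumes V: "irrep G (pull \<rho>) V" and W: "irrep G (pull \<sigma>) W"
    and hom: "is_hom G \<rho> V \<sigma> W \<phi>" and f: "f \<in> V" "\<phi> f \<noteq> 0"
  shows "rep_iso G (pull \<rho>) V (pull \<sigma>) W"
proof -
  have rV: "subrep G (pull \<rho>) V" and rW: "subrep G (pull \<sigma>) W" using V W by (auto simp: irrep_def)
  note sV = subspace_pull[OF rV] and sW = subspace_pull[OF rW]
  note \<phi>W = is_homD(1)[OF hom] and add = is_homD(2)[OF hom] and scale = is_homD(3)[OF hom] and eqv = is_homD(4)[OF hom]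
  have zero: "\<phi> 0 = 0"
    using scale[OF cfun.subspace_0[OF sV], of 0] by (simp add: cscale_def zero_fun_def)
  define K where "K = {x \<in> V. \<phi> x = 0}"
  have "subrep G (pull \<rho>) K"
    unfolding subrep_def
  proof (intro conjI ballI cfun.subspaceI)
    show "0 \<in> K" using zero cfun.subspace_0[OF sV] by (simp add: K_def)
    show "x + y \<in> K" if "x \<in> K" "y \<in> K" for x y
      using that add[of x y] cfun.subspace_add[OF sV, of x y] unfolding K_def by simp
    show "cscale c x \<in> K" if "x \<in> K" for c x
      using that scale[of x c] cfun.subspace_scale[OF sV, of x c] unfolding K_def by simp
    show "pull \<rho> g x \<in> K" if "g \<in> carrier G" "x \<in> K" for g x
      using that eqv[of g x] subrep_pull[OF rV, of g x] unfolding K_def by (simp add: pull_def zero_fun_def)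
  qed
  moreover have "K \<subseteq> V" "K \<noteq> V" using f by (auto simp: K_def)
  ultimately have K0: "K = {0}" using V by (auto simp: irrep_def)
  have "subrep G (pull \<sigma>) (\<phi> ` V)"
    unfolding subrep_def
  proof (intro conjI ballI cfun.subspaceI)
    show "0 \<in> \<phi> ` V" using zero cfun.subspace_0[OF sV] by (metis imageI)
    show "x + y \<in> \<phi> ` V" if xy: "x \<in> \<phi> ` V" "y \<in> \<phi> ` V" for x y
    proof -
      obtain a b where "a \<in> V" "b \<in> V" "x = \<phi> a" "y = \<phi> b" using xy by blast
      then show ?thesis using add[of a b] cfun.subspace_add[OF sV, of a b] by (metis imageI)
    qed
    show "cscale c x \<in> \<phi> ` V" if x: "x \<in> \<phi> ` V" for c x
    proof -
      obtain a where "a \<in> V" "x = \<phi> a" using x by blast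
      then show ?thesis using scale[of a c] cfun.subspace_scale[OF sV, of a c] by (metis imageI)
    qed
    show "pull \<sigma> g x \<in> \<phi> ` V" if gx: "g \<in> carrier G" "x \<in> \<phi> ` V" for g x
    proof -
      obtain a where "a \<in> V" "x = \<phi> a" using gx by blast
      then show ?thesis using eqv[of g a] subrep_pull[OF rV, of g a] gx(1) by (metis imageI)
    qed
  qed
  moreover have "\<phi> ` V \<subseteq> W" "\<phi> ` V \<noteq> {0}" using \<phi>W f by auto
  ultimately have img: "\<phi> ` V = W" using W unfolding irrep_def by blast
  have "inj_on \<phi> V"
  proof (rule inj_onI)
    fix x y assume xy: "x \<in> V" "y \<in> V" "\<phi> x = \<phi> y"
    have "\<phi> (x + cscale (-1) y) = \<phi> x + cscale (-1) (\<phi> y)"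
      using xy add[of x "cscale (-1) y"] scale[of y "-1"] cfun.subspace_scale[OF sV, of y "-1"] by simp
    also have "\<dots> = 0" using xy by (simp add: cscale_def fun_eq_iff)
    finally have "x + cscale (-1) y \<in> K"
      using xy cfun.subspace_diff[OF sV xy(1,2)] by (simp add: K_def)
    then have "x + cscale (-1) y = 0" using K0 by simp
    then show "x = y" by (simp add: cscale_def fun_eq_iff)
  qed
  then have "bij_betw \<phi> V W" using img by (simp add: bij_betw_def)
  then show ?thesis using hom unfolding rep_iso_def is_hom_def by blast
qed

text \<open>
  In any decomposition of \<open>W\<close>, a summand isomorphic to \<open>V\<close> contributes the norm of the character of
  \<open>V\<close>, and by Schur's lemma any other summand contributes 0. The count is therefore the same for all
  decompositions, so the definite description in \<open>irrep_mult\<close> denotes it.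
\<close>

theorem irrep_mult_eq:
  assumes V: "irrep G (pull \<rho>) V" "V \<subseteq> supported X" "projector X V P" "hermitian X P"
    and scalar: "\<And>\<phi>. is_hom G \<rho> V \<rho> V \<phi> \<Longrightarrow> \<exists>c. \<forall>f\<in>V. \<phi> f = cscale c f"
    and W: "subrep G (pull \<sigma>) W" "W \<subseteq> supported Y" "projector Y W Q"
  shows "of_nat (irrep_mult G (pull \<rho>) V (pull \<sigma>) W) * of_nat (card (carrier G))
    = (\<Sum>g\<in>carrier G. char_on X \<rho> P (inv g) * char_on Y \<sigma> Q g)"
proof -
  have rV: "subrep G (pull \<rho>) V" "V \<noteq> {0}" using V by (auto simp: irrep_def)
  have count: "of_nat (card {i. i < k \<and> rep_iso G (pull \<rho>) V (pull \<sigma>) (U i)}) * of_nat (card (carrier G))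
      = (\<Sum>g\<in>carrier G. char_on X \<rho> P (inv g) * char_on Y \<sigma> Q g)"
    if dec: "irrep_decomp G (pull \<sigma>) W k U" for k U
  proof -
    have iU: "irrep G (pull \<sigma>) (U i)" "subrep G (pull \<sigma>) (U i)" if "i < k" for i
      using dec that by (auto simp: irrep_decomp_def irrep_def)
    have UW: "U i \<subseteq> W" if i: "i < k" for i
    proof
      fix f assume f: "f \<in> U i"
      let ?u = "\<lambda>j\<in>{..<k}. if j = i then f else 0"
      have "?u \<in> PiE {..<k} U" using f cfun.subspace_0[OF subspace_pull[OF iU(2)]] by auto
      moreover have "(\<Sum>j<k. ?u j) = f" using i by simp
      ultimately show "f \<in> W"
        using dec bij_betw_apply[of "\<lambda>u. \<Sum>i<k. u i" "PiE {..<k} U" W ?u] by (simp add: irrep_decomp_def)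
    qed
    have "\<exists>R. projector Y (U i) R" if i: "i < k" for i
      using hermitian_projector_exists[OF other.fin_X subspace_pull[OF iU(2)[OF i]]] UW[OF i] W(2)
      by (metis subset_trans)
    then obtain R where R: "\<And>i. i < k \<Longrightarrow> projector Y (U i) (R i)" by metis
    have "(\<Sum>g\<in>carrier G. char_on X \<rho> P (inv g) * char_on Y \<sigma> Q g)
       = (\<Sum>g\<in>carrier G. \<Sum>i<k. char_on X \<rho> P (inv g) * char_on Y \<sigma> (R i) g)"
      using other.char_on_decomp[OF subspace_pull[OF W(1)] W(3) dec R] by (simp add: sum_distrib_left)
    also have "\<dots> = (\<Sum>i<k. \<Sum>g\<in>carrier G. char_on X \<rho> P (inv g) * char_on Y \<sigma> (R i) g)"
      by (rule sum.swap)
    also have "\<dots> = (\<Sum>i<k. if rep_iso G (pull \<rho>) V (pull \<sigma>) (U i) then of_nat (card (carrier G)) else 0)"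
    proof (rule sum.cong[OF refl])
      fix i assume "i \<in> {..<k}"
      then have i: "i < k" by simp
      show "(\<Sum>g\<in>carrier G. char_on X \<rho> P (inv g) * char_on Y \<sigma> (R i) g)
          = (if rep_iso G (pull \<rho>) V (pull \<sigma>) (U i) then of_nat (card (carrier G)) else 0)"
      proof (cases "rep_iso G (pull \<rho>) V (pull \<sigma>) (U i)")
        case True
        have "(\<Sum>g\<in>carrier G. char_on X \<rho> P (inv g) * char_on Y \<sigma> (R i) g)
            = (\<Sum>g\<in>carrier G. char_on X \<rho> P (inv g) * char_on X \<rho> P g)"
          using char_on_rep_iso[OF rV(1) V(3) iU(2)[OF i] R[OF i] True] by simp
        also have "\<dots> = of_nat (card (carrier G))"
          by (rule char_unit_norm[OF rV(1) V(3,4,2) rV(2) rV(1) V(3,4) order_refl scalar])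
        finally show ?thesis using True by simp
      next
        case False
        then show ?thesis
          using char_orthogonal[OF iU(2)[OF i] R[OF i] V(3)] schur[OF V(1) iU(1)[OF i]] by auto
      qed
    qed
    also have "\<dots> = of_nat (card {i. i < k \<and> rep_iso G (pull \<rho>) V (pull \<sigma>) (U i)}) * of_nat (card (carrier G))"
      by (simp add: sum.If_cases Int_def)
    finally show ?thesis by simp
  qed
  have cG: "of_nat (card (carrier G)) \<noteq> (0 :: complex)" using fin_G by (auto simp: card_eq_0_iff)
  obtain k U where kU: "irrep_decomp G (pull \<sigma>) W k U" using other.irrep_decomp_exists[OF W(1,2)] by blast
  let ?m = "card {i. i < k \<and> rep_iso G (pull \<rho>) V (pull \<sigma>) (U i)}"
  have "irrep_mult G (pull \<rho>) V (pull \<sigma>) W = ?m"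
    unfolding irrep_mult_def
  proof (rule the_equality)
    fix m assume "\<exists>k U. irrep_decomp G (pull \<sigma>) W k U \<and> m = card {i. i < k \<and> rep_iso G (pull \<rho>) V (pull \<sigma>) (U i)}"
    then obtain k' U' where "irrep_decomp G (pull \<sigma>) W k' U'"
      and m: "m = card {i. i < k' \<and> rep_iso G (pull \<rho>) V (pull \<sigma>) (U' i)}" by blast
    from count[OF this(1)] count[OF kU] have "complex_of_nat m * of_nat (card (carrier G)) = of_nat ?m * of_nat (card (carrier G))"
      unfolding m by (rule trans[OF _ sym])
    then show "m = ?m" using cG by simp
  qed (use kU in blast)
  then show ?thesis using count[OF kU] by simp
qed

end

section \<open>Permutation characters of the symmetric group\<close>

lemma card_eq_sum_fibres:
  assumes "finite N" "finite J" "\<And>k. k \<in> N \<Longrightarrow> h k \<in> J"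
  shows "card N = (\<Sum>j\<in>J. card {k\<in>N. h k = j})"
proof -
  have "h ` N \<subseteq> J" using assms(3) by blast
  then show ?thesis using sum.group[OF assms(1,2), of h "\<lambda>_. 1 :: nat"] by simp
qed

lemma finite_bounded_functions:
  fixes F :: "('a \<Rightarrow> nat) set"
  assumes A: "finite A" and F: "\<And>f x. f \<in> F \<Longrightarrow> f x \<noteq> 0 \<Longrightarrow> x \<in> A \<and> f x \<le> B"
  shows "finite F"
proof (rule finite_subset)
  show "F \<subseteq> {f. \<forall>x. (x \<in> A \<longrightarrow> f x \<in> {..B}) \<and> (x \<notin> A \<longrightarrow> f x = 0)}"
  proof (rule subsetI, rule CollectI, rule allI)
    fix f x assume "f \<in> F"
    then show "(x \<in> A \<longrightarrow> f x \<in> {..B}) \<and> (x \<notin> A \<longrightarrow> f x = 0)" using F[of f x] by (cases "f x = 0") auto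
  qed
  show "finite {f. \<forall>x. (x \<in> A \<longrightarrow> f x \<in> {..B}) \<and> (x \<notin> A \<longrightarrow> f x = 0)}"
    by (rule finite_set_of_finite_funs[OF A]) simp
qed

text \<open>
  Words of length \<open>n\<close> in which each letter \<open>i\<close> occurs \<open>Z i\<close> times. The value \<open>d\<close> outside \<open>{1..n}\<close> is a
  parameter since tabloids, which are \<open>fst\<close> of extensional functions, take the value \<open>fst undefined\<close>
  there.
\<close>

definition fillings :: "'i \<Rightarrow> nat \<Rightarrow> ('i \<Rightarrow> nat) \<Rightarrow> (nat \<Rightarrow> 'i) set" where
  "fillings d n Z = {t. (\<forall>k. k \<notin> {1..n} \<longrightarrow> t k = d) \<and> (\<forall>i. card {k\<in>{1..n}. t k = i} = Z i)}"

definition fixed_fillings :: "'i \<Rightarrow> nat \<Rightarrow> ('i \<Rightarrow> nat) \<Rightarrow> (nat \<Rightarrow> nat) \<Rightarrow> (nat \<Rightarrow> 'i) set" where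
  "fixed_fillings d n Z g = {t\<in>fillings d n Z. t \<circ> g = t}"

definition perm_char :: "nat \<Rightarrow> ('i \<Rightarrow> nat) \<Rightarrow> (nat \<Rightarrow> nat) \<Rightarrow> nat" where
  "perm_char n Z g = card (fixed_fillings undefined n Z g)"

lemma fillings_image:
  assumes "t \<in> fillings d n Z"
  shows "t ` {1..n} = {i. Z i \<noteq> 0}"
proof -
  have "Z i \<noteq> 0 \<longleftrightarrow> i \<in> t ` {1..n}" for i
  proof -
    have "Z i = card {k\<in>{1..n}. t k = i}" using assms by (simp add: fillings_def)
    then show ?thesis by (auto simp: card_eq_0_iff)
  qed
  then show ?thesis by auto
qed

lemma fillings_sum:
  assumes "t \<in> fillings d n Z"
  shows "finite {i. Z i \<noteq> 0}" "(\<Sum>i | Z i \<noteq> 0. Z i) = n"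
proof -
  show fin: "finite {i. Z i \<noteq> 0}" unfolding fillings_image[OF assms, symmetric] by simp
  have "n = (\<Sum>i | Z i \<noteq> 0. card {k\<in>{1..n}. t k = i})"
  proof -
    have "card {1..n} = (\<Sum>i | Z i \<noteq> 0. card {k\<in>{1..n}. t k = i})"
      by (rule card_eq_sum_fibres[OF finite_atLeastAtMost fin]) (use fillings_image[OF assms] in blast)
    then show ?thesis by simp
  qed
  then show "(\<Sum>i | Z i \<noteq> 0. Z i) = n" using assms by (simp add: fillings_def)
qed

lemma finite_fillings: "finite (fillings d n Z)"
proof (cases "fillings d n Z = {}")
  case False
  then obtain t where "t \<in> fillings d n Z" by blast
  then have fin: "finite {i. Z i \<noteq> 0}" by (rule fillings_sum(1))
  have "fillings d n Z \<subseteq> {f. \<forall>x. (x \<in> {1..n} \<longrightarrow> f x \<in> {i. Z i \<noteq> 0}) \<and> (x \<notin> {1..n} \<longrightarrow> f x = d)}"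
  proof (intro subsetI CollectI allI conjI impI)
    fix t x assume t: "t \<in> fillings d n Z"
    show "Z (t x) \<noteq> 0" if "x \<in> {1..n}" using fillings_image[OF t] that by blast
    show "t x = d" if "x \<notin> {1..n}" using t that by (auto simp: fillings_def)
  qed
  then show ?thesis by (rule finite_subset) (rule finite_set_of_finite_funs, use fin in auto)
qed simp

lemma finite_fixed_fillings: "finite (fixed_fillings d n Z g)"
  unfolding fixed_fillings_def using finite_fillings[of d n Z] by auto

lemma fillings_comp:
  assumes g: "g permutes {1..n}" and t: "t \<in> fillings d n Z"
  shows "t \<circ> g \<in> fillings d n Z"
proof -
  have "card {k\<in>{1..n}. t (g k) = i} = card {k\<in>{1..n}. t k = i}" for i
  proof (rule bij_betw_same_card[of g])
    have "inj_on g {k\<in>{1..n}. t (g k) = i}" using permutes_inj_on[OF g] .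
    moreover have "g ` {k\<in>{1..n}. t (g k) = i} = {k\<in>{1..n}. t k = i}"
    proof
      show "g ` {k\<in>{1..n}. t (g k) = i} \<subseteq> {k\<in>{1..n}. t k = i}"
        using permutes_in_image[OF g] by auto
      show "{k\<in>{1..n}. t k = i} \<subseteq> g ` {k\<in>{1..n}. t (g k) = i}"
      proof
        fix k assume k: "k \<in> {k\<in>{1..n}. t k = i}"
        then have "inv' g k \<in> {1..n}" using permutes_in_image[OF permutes_inv[OF g], of k] by auto
        then show "k \<in> g ` {k\<in>{1..n}. t (g k) = i}"
          using k permutes_inverses[OF g] by (intro image_eqI[of _ _ "inv' g k"]) auto
      qed
    qed
    ultimately show "bij_betw g {k\<in>{1..n}. t (g k) = i} {k\<in>{1..n}. t k = i}" by (simp add: bij_betw_def)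
  qed
  moreover have "g k = k" if "k \<notin> {1..n}" for k using permutes_not_in[OF g that] .
  ultimately show ?thesis using t unfolding fillings_def by (auto simp del: atLeastAtMost_iff)
qed

lemma fillings_transitive:
  assumes s: "s \<in> fillings d n Z" and t: "t \<in> fillings d n Z"
  obtains g where "g permutes {1..n}" "t = s \<circ> g"
proof -
  have "image_mset t (mset_set {1..n}) = image_mset s (mset_set {1..n})"
  proof (rule multiset_eqI)
    fix i
    have "card {x\<in>{1..n}. t x = i} = card {x\<in>{1..n}. s x = i}" using s t by (simp add: fillings_def)
    then show "count (image_mset t (mset_set {1..n})) i = count (image_mset s (mset_set {1..n})) i"
      by (simp add: count_image_mset_eq_card_vimage)
  qed
  then obtain g where g: "g permutes {1..n}" "\<forall>x\<in>{1..n}. t x = s (g x)"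
    using image_mset_eq_implies_permutes[of "{1..n}" t s] by auto
  have "t x = s (g x)" for x
  proof (cases "x \<in> {1..n}")
    case False
    then show ?thesis using s t permutes_not_in[OF g(1) False] by (simp add: fillings_def)
  qed (use g in auto)
  then have "t = s \<circ> g" by (simp add: fun_eq_iff)
  then show ?thesis using that g(1) by blast
qed

lemma card_fst_bij_diagram:
  assumes "bij_betw h {1..n} {(i, j). j < Z i}"
  shows "card {k\<in>{1..n}. fst (h k) = i} = Z i"
proof -
  have "bij_betw h {k\<in>{1..n}. fst (h k) = i} ((\<lambda>j. (i, j)) ` {..<Z i})"
  proof -
    have inj: "inj_on h {1..n}" and im: "h ` {1..n} = {(i, j). j < Z i}" using assms by (auto simp: bij_betw_def)
    have "h ` {k\<in>{1..n}. fst (h k) = i} = {p \<in> h ` {1..n}. fst p = i}" by auto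
    also have "\<dots> = (\<lambda>j. (i, j)) ` {..<Z i}" unfolding im by auto
    finally show ?thesis using inj_on_subset[OF inj, of "{k\<in>{1..n}. fst (h k) = i}"] unfolding bij_betw_def by blast
  qed
  from bij_betw_same_card[OF this] show ?thesis by (simp add: card_image inj_on_def)
qed

lemma fillings_nonempty:
  assumes "finite {i. Z i \<noteq> 0}" "(\<Sum>i | Z i \<noteq> 0. Z i) = n"
  shows "fillings d n Z \<noteq> {}"
proof -
  have eq: "{(i, j). j < Z i} = Sigma {i. Z i \<noteq> 0} (\<lambda>i. {..<Z i})" by auto
  have "card {(i, j). j < Z i} = n" unfolding eq using assms by (simp add: card_SigmaI)
  moreover have "finite {(i, j). j < Z i}" unfolding eq using assms by auto
  ultimately obtain h where h: "bij_betw h {1..n} {(i, j). j < Z i}"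
    using finite_same_card_bij[of "{1..n}" "{(i, j). j < Z i}"] by auto
  have "card {k \<in> {1..n}. (if k \<in> {1..n} then fst (h k) else d) = i} = Z i" for i
  proof -
    have "{k \<in> {1..n}. (if k \<in> {1..n} then fst (h k) else d) = i} = {k\<in>{1..n}. fst (h k) = i}" by auto
    then show ?thesis using card_fst_bij_diagram[OF h, of i] by simp
  qed
  then have "(\<lambda>k. if k \<in> {1..n} then fst (h k) else d) \<in> fillings d n Z"
    unfolding fillings_def by auto
  then show ?thesis by blast
qed

lemma fixed_fillings_inside: "t \<in> fixed_fillings d n Z g \<Longrightarrow> k \<in> {1..n} \<Longrightarrow> Z (t k) \<noteq> 0"
  using fillings_image[of t d n Z] by (auto simp: fixed_fillings_def)

lemma fixed_fillings_outside: "t \<in> fixed_fillings d n Z g \<Longrightarrow> k \<notin> {1..n} \<Longrightarrow> t k = d"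
  by (simp add: fixed_fillings_def fillings_def)

text \<open>
  Permutation characters depend only on the multiset of nonzero multiplicities, not on the letters.
  This is used to change the index type, to permute parts, and to change the default value.
\<close>

lemma relabel_fixed_fillings:
  assumes g: "g permutes {1..n}" and t: "t \<in> fixed_fillings d n Z g"
    and h: "inj_on h {i. Z i \<noteq> 0}" "\<And>i. Z i \<noteq> 0 \<Longrightarrow> Z' (h i) = Z i" "\<And>j. Z' j \<noteq> 0 \<Longrightarrow> j \<in> h ` {i. Z i \<noteq> 0}"
  shows "(\<lambda>k. if k \<in> {1..n} then h (t k) else d') \<in> fixed_fillings d' n Z' g" (is "?t \<in> _")
proof -
  have tf: "t \<in> fillings d n Z" and tg: "t (g k) = t k" for k
    using t by (auto simp: fixed_fillings_def fun_eq_iff)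
  have supp: "Z (t k) \<noteq> 0" if "k \<in> {1..n}" for k using fillings_image[OF tf] that by blast
  have "card {k\<in>{1..n}. ?t k = j} = Z' j" for j
  proof (cases "Z' j = 0")
    case True
    have "{k\<in>{1..n}. ?t k = j} = {}"
    proof (rule ccontr)
      assume "{k\<in>{1..n}. ?t k = j} \<noteq> {}"
      then obtain k where k: "k \<in> {1..n}" "h (t k) = j" by auto
      then show False using h(2)[OF supp[OF k(1)]] supp[OF k(1)] True by simp
    qed
    then show ?thesis unfolding True by (simp only: card.empty)
  next
    case False
    then obtain i where i: "Z i \<noteq> 0" "j = h i" using h(3) by blast
    have "{k\<in>{1..n}. ?t k = j} = {k\<in>{1..n}. t k = i}"
      using i supp inj_onD[OF h(1)] by auto
    then show ?thesis using tf i h(2) by (simp add: fillings_def)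
  qed
  moreover have "?t \<circ> g = ?t"
    using tg permutes_in_image[OF g] by (auto simp: fun_eq_iff simp del: atLeastAtMost_iff)
  ultimately show ?thesis unfolding fixed_fillings_def fillings_def by auto
qed

lemma card_fixed_fillings_relabel:
  assumes g: "g permutes {1..n}"
    and h: "inj_on h {i. Z i \<noteq> 0}" "\<And>i. Z i \<noteq> 0 \<Longrightarrow> Z' (h i) = Z i" "\<And>j. Z' j \<noteq> 0 \<Longrightarrow> j \<in> h ` {i. Z i \<noteq> 0}"
  shows "card (fixed_fillings d n Z g) = card (fixed_fillings d' n Z' g)"
proof -
  define h' where "h' = inv_into {i. Z i \<noteq> 0} h"
  have h'h: "h' (h i) = i" if "Z i \<noteq> 0" for i using that h(1) by (simp add: h'_def)
  have hh': "h (h' j) = j" if "Z' j \<noteq> 0" for j using h(3)[OF that] by (simp add: h'_def f_inv_into_f)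
  have h'Z: "Z (h' j) = Z' j" if j: "Z' j \<noteq> 0" for j
  proof -
    obtain i where "Z i \<noteq> 0" "j = h i" using h(3)[OF j] by blast
    then show ?thesis using h(2) h'h by simp
  qed
  have 1: "inj_on h' {j. Z' j \<noteq> 0}" by (rule inj_on_inverseI[of _ h]) (use hh' in auto)
  have 2: "i \<in> h' ` {j. Z' j \<noteq> 0}" if "Z i \<noteq> 0" for i
    using that h'h h(2) by (intro image_eqI[of _ _ "h i"]) auto
  show ?thesis
  proof (rule bij_betw_same_card, rule bij_betw_byWitness)
    show "(\<lambda>t k. if k \<in> {1..n} then h (t k) else d') ` fixed_fillings d n Z g \<subseteq> fixed_fillings d' n Z' g"
      using relabel_fixed_fillings[OF g _ h] by blast
    show "(\<lambda>t k. if k \<in> {1..n} then h' (t k) else d) ` fixed_fillings d' n Z' g \<subseteq> fixed_fillings d n Z g"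
      using relabel_fixed_fillings[OF g _ 1 h'Z 2] by blast
    show "\<forall>t\<in>fixed_fillings d n Z g. (\<lambda>k. if k \<in> {1..n} then h' (if k \<in> {1..n} then h (t k) else d') else d) = t"
    proof (intro ballI ext)
      fix t k assume t: "t \<in> fixed_fillings d n Z g"
      show "(if k \<in> {1..n} then h' (if k \<in> {1..n} then h (t k) else d') else d) = t k"
        using fixed_fillings_inside[OF t, of k] fixed_fillings_outside[OF t, of k] h'h by simp
    qed
    show "\<forall>t\<in>fixed_fillings d' n Z' g. (\<lambda>k. if k \<in> {1..n} then h (if k \<in> {1..n} then h' (t k) else d) else d') = t"
    proof (intro ballI ext)
      fix t k assume t: "t \<in> fixed_fillings d' n Z' g"
      show "(if k \<in> {1..n} then h (if k \<in> {1..n} then h' (t k) else d) else d') = t k"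
        using fixed_fillings_inside[OF t, of k] fixed_fillings_outside[OF t, of k] hh' by simp
    qed
  qed
qed

lemma perm_char_relabel:
  assumes "g permutes {1..n}"
    and "inj_on h {i. Z i \<noteq> 0}" "\<And>i. Z i \<noteq> 0 \<Longrightarrow> Z' (h i) = Z i" "\<And>j. Z' j \<noteq> 0 \<Longrightarrow> j \<in> h ` {i. Z i \<noteq> 0}"
  shows "perm_char n Z g = perm_char n Z' g"
  unfolding perm_char_def by (rule card_fixed_fillings_relabel[OF assms])

lemma perm_char_default: "g permutes {1..n} \<Longrightarrow> perm_char n Z g = card (fixed_fillings d n Z g)"
  unfolding perm_char_def by (rule card_fixed_fillings_relabel[where h = "\<lambda>x. x"]) auto

lemma perm_char_inv:
  assumes "g permutes {1..n}"
  shows "perm_char n Z (inv' g) = perm_char n Z g"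
proof -
  have "t \<circ> inv' g = t \<longleftrightarrow> t \<circ> g = t" for t :: "nat \<Rightarrow> 'a"
    using permutes_inv_o[OF assms] by (metis comp_assoc comp_id)
  then show ?thesis by (simp add: perm_char_def fixed_fillings_def)
qed

text \<open>
  The symmetric group is transitive on the fillings, so by orbit counting the average number of
  fixed fillings is 1.
\<close>

lemma sum_perm_char:
  "(\<Sum>g | g permutes {1..n}. perm_char n Z g) = (if fillings undefined n Z = {} then 0 else fact n)"
proof -
  let ?F = "fillings undefined n Z" and ?G = "{g. g permutes {1..n}}"
  have finG: "finite ?G" by (simp add: finite_permutations)
  have cG: "card ?G = fact n" using card_permutations[of "{1..n}" n] by simp
  have stab: "card ?F * card {g\<in>?G. t \<circ> g = t} = fact n" if t: "t \<in> ?F" for t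
  proof -
    have "card {g\<in>?G. t \<circ> g = s} = card {g\<in>?G. t \<circ> g = t}" if s: "s \<in> ?F" for s
    proof -
      obtain h where h: "h permutes {1..n}" "s = t \<circ> h" using fillings_transitive[OF t s] .
      have "bij_betw (\<lambda>g. g \<circ> h) {g\<in>?G. t \<circ> g = t} {g\<in>?G. t \<circ> g = s}"
      proof (rule bij_betw_byWitness[where f' = "\<lambda>g. g \<circ> inv' h"])
        show "\<forall>g\<in>{g\<in>?G. t \<circ> g = t}. g \<circ> h \<circ> inv' h = g"
          using permutes_inv_o[OF h(1)] by (simp add: comp_assoc)
        show "\<forall>g\<in>{g\<in>?G. t \<circ> g = s}. g \<circ> inv' h \<circ> h = g"
          using permutes_inv_o[OF h(1)] by (simp add: comp_assoc)
        show "(\<lambda>g. g \<circ> h) ` {g\<in>?G. t \<circ> g = t} \<subseteq> {g\<in>?G. t \<circ> g = s}"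
        proof (rule image_subsetI)
          fix g assume "g \<in> {g\<in>?G. t \<circ> g = t}"
          then show "g \<circ> h \<in> {g\<in>?G. t \<circ> g = s}"
            using permutes_compose[OF h(1)] h(2) by (simp add: comp_assoc[symmetric])
        qed
        show "(\<lambda>g. g \<circ> inv' h) ` {g\<in>?G. t \<circ> g = s} \<subseteq> {g\<in>?G. t \<circ> g = t}"
        proof (rule image_subsetI)
          fix g assume "g \<in> {g\<in>?G. t \<circ> g = s}"
          then have g: "g permutes {1..n}" "t \<circ> g = t \<circ> h" using h(2) by auto
          have "t \<circ> (g \<circ> inv' h) = t \<circ> h \<circ> inv' h" unfolding g(2)[symmetric] by (simp add: comp_assoc)
          also have "\<dots> = t" using permutes_inv_o[OF h(1)] by (simp add: comp_assoc)
          finally show "g \<circ> inv' h \<in> {g\<in>?G. t \<circ> g = t}"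
            using permutes_compose[OF permutes_inv[OF h(1)] g(1)] by simp
        qed
      qed
      then show ?thesis by (rule bij_betw_same_card[symmetric])
    qed
    then have "card ?F * card {g\<in>?G. t \<circ> g = t} = (\<Sum>s\<in>?F. card {g\<in>?G. t \<circ> g = s})" by simp
    also have "\<dots> = card ?G"
      by (rule card_eq_sum_fibres[OF finG finite_fillings, symmetric]) (use fillings_comp[OF _ t] in auto)
    finally show ?thesis unfolding cG .
  qed
  have "(\<Sum>g\<in>?G. perm_char n Z g) = (\<Sum>g\<in>?G. \<Sum>t\<in>?F. of_bool (t \<circ> g = t))"
    using finite_fillings[of undefined n Z] by (simp add: perm_char_def fixed_fillings_def Int_def)
  also have "\<dots> = (\<Sum>t\<in>?F. \<Sum>g\<in>?G. of_bool (t \<circ> g = t))" by (rule sum.swap)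
  also have "\<dots> = (\<Sum>t\<in>?F. card {g\<in>?G. t \<circ> g = t})"
    using finG by (simp add: Int_def)
  finally have eq: "(\<Sum>g\<in>?G. perm_char n Z g) = (\<Sum>t\<in>?F. card {g\<in>?G. t \<circ> g = t})" .
  show ?thesis
  proof (cases "?F = {}")
    case False
    have "card ?F * (\<Sum>t\<in>?F. card {g\<in>?G. t \<circ> g = t}) = (\<Sum>t\<in>?F. fact n)"
      unfolding sum_distrib_left by (intro sum.cong refl stab)
    also have "\<dots> = card ?F * fact n" by simp
    finally have "card ?F * (\<Sum>t\<in>?F. card {g\<in>?G. t \<circ> g = t}) = card ?F * fact n" .
    moreover have "card ?F \<noteq> 0" using False finite_fillings[of undefined n Z] by (simp add: card_eq_0_iff)
    ultimately show ?thesis using eq False by simp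
  next
    case True
    have "(\<Sum>g\<in>?G. perm_char n Z g) = 0" unfolding eq by (simp only: True sum.empty)
    then show ?thesis using True by simp
  qed
qed

definition margins :: "'i set \<Rightarrow> 'j set \<Rightarrow> ('i \<Rightarrow> nat) \<Rightarrow> ('j \<Rightarrow> nat) \<Rightarrow> ('i \<times> 'j \<Rightarrow> nat) set" where
  "margins I J b v = {Z. (\<forall>p. p \<notin> I \<times> J \<longrightarrow> Z p = 0) \<and>
     (\<forall>i\<in>I. (\<Sum>j\<in>J. Z (i, j)) = b i) \<and> (\<forall>j\<in>J. (\<Sum>i\<in>I. Z (i, j)) = v j)}"

lemma margins_supp:
  assumes "Z \<in> margins I J b v" "Z p \<noteq> 0"
  shows "p \<in> I \<times> J"
proof -
  have "\<forall>p. p \<notin> I \<times> J \<longrightarrow> Z p = 0" using assms(1) unfolding margins_def by (elim CollectE conjE)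
  then show ?thesis using assms(2) by metis
qed

lemma finite_margins:
  assumes "finite I" "finite J"
  shows "finite (margins I J b v)"
proof (rule finite_bounded_functions[of "I \<times> J" _ "Max (b ` I)"])
  fix Z p assume Z: "Z \<in> margins I J b v" and nz: "Z p \<noteq> 0"
  then obtain i j where ij: "p = (i, j)" "i \<in> I" "j \<in> J" using margins_supp by blast
  have "Z (i, j) \<le> (\<Sum>j\<in>J. Z (i, j))" using assms ij by (intro member_le_sum) auto
  also have "\<dots> = b i" using Z ij by (simp add: margins_def)
  also have "\<dots> \<le> Max (b ` I)" using assms ij by simp
  finally show "p \<in> I \<times> J \<and> Z p \<le> Max (b ` I)" using ij by simp
qed (use assms in simp)

text \<open>
  A pair of fillings fixed by \<open>g\<close> is one filling by pairs of letters fixed by \<open>g\<close>; its multiplicities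
  form a matrix whose margins are the multiplicities of the two fillings.
\<close>

lemma perm_char_mult:
  assumes g: "g permutes {1..n}" and fin: "finite I" "finite J"
    and supp: "\<And>i. i \<notin> I \<Longrightarrow> b i = 0" "\<And>j. j \<notin> J \<Longrightarrow> v j = 0"
  shows "perm_char n b g * perm_char n v g = (\<Sum>Z\<in>margins I J b v. perm_char n Z g)"
proof -
  let ?d = "undefined :: 'a" and ?e = "undefined :: 'b"
  let ?N = "{1..n}"
  have split1: "card {k\<in>?N. s k = i} = (\<Sum>j\<in>J. card {k\<in>?N. (s k, t k) = (i, j)})"
    if "\<And>k. k \<in> ?N \<Longrightarrow> t k \<in> J" for s :: "nat \<Rightarrow> 'a" and t :: "nat \<Rightarrow> 'b" and i
  proof -
    have "card {k\<in>?N. s k = i} = (\<Sum>j\<in>J. card {k\<in>{k\<in>?N. s k = i}. t k = j})"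
      by (rule card_eq_sum_fibres) (use fin that in auto)
    then show ?thesis by (simp add: conj_assoc)
  qed
  have split2: "card {k\<in>?N. t k = j} = (\<Sum>i\<in>I. card {k\<in>?N. (s k, t k) = (i, j)})"
    if "\<And>k. k \<in> ?N \<Longrightarrow> s k \<in> I" for s :: "nat \<Rightarrow> 'a" and t :: "nat \<Rightarrow> 'b" and j
  proof -
    have "card {k\<in>?N. t k = j} = (\<Sum>i\<in>I. card {k\<in>{k\<in>?N. t k = j}. s k = i})"
      by (rule card_eq_sum_fibres) (use fin that in auto)
    then show ?thesis by (simp add: conj_ac)
  qed
  define m where "m = (\<lambda>(s :: nat \<Rightarrow> 'a, t :: nat \<Rightarrow> 'b) k. (s k, t k))"
  have "(\<Union>Z\<in>margins I J b v. fixed_fillings (?d, ?e) n Z g)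
      = m ` (fixed_fillings ?d n b g \<times> fixed_fillings ?e n v g)"
  proof (intro equalityI subsetI)
    fix p assume "p \<in> (\<Union>Z\<in>margins I J b v. fixed_fillings (?d, ?e) n Z g)"
    then obtain Z where Z: "Z \<in> margins I J b v" and p: "p \<in> fillings (?d, ?e) n Z" and pg: "p \<circ> g = p"
      by (auto simp: fixed_fillings_def)
    have inIJ: "p k \<in> I \<times> J" if "k \<in> ?N" for k
    proof -
      have "Z (p k) \<noteq> 0" using fillings_image[OF p] that by blast
      moreover have "Z (p k) = 0" if "p k \<notin> I \<times> J" using Z that by (cases "p k") (auto simp: margins_def)
      ultimately show ?thesis by metis
    qed
    define s where "s = fst \<circ> p" define t where "t = snd \<circ> p"
    have st: "p = m (s, t)" by (simp add: m_def s_def t_def)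
    have sI: "s k \<in> I" "t k \<in> J" if "k \<in> ?N" for k using inIJ[OF that] by (auto simp: s_def t_def mem_Times_iff)
    have cZ: "card {k\<in>?N. (s k, t k) = q} = Z q" for q
      using p by (cases q) (simp add: fillings_def s_def t_def)
    have "card {k\<in>?N. s k = i} = b i" for i
    proof (cases "i \<in> I")
      case True
      have "card {k\<in>?N. s k = i} = (\<Sum>j\<in>J. Z (i, j))" unfolding cZ[symmetric] by (rule split1) (rule sI)
      then show ?thesis using Z True by (simp add: margins_def)
    next
      case False
      then have "{k\<in>?N. s k = i} = {}" using sI by auto
      then show ?thesis using supp(1)[OF False] by (simp only: card.empty)
    qed
    moreover have "card {k\<in>?N. t k = j} = v j" for j
    proof (cases "j \<in> J")
      case True
      have "card {k\<in>?N. t k = j} = (\<Sum>i\<in>I. Z (i, j))" unfolding cZ[symmetric] by (rule split2) (rule sI)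
      then show ?thesis using Z True by (simp add: margins_def)
    next
      case False
      then have "{k\<in>?N. t k = j} = {}" using sI by auto
      then show ?thesis using supp(2)[OF False] by (simp only: card.empty)
    qed
    moreover have "s \<circ> g = s" "t \<circ> g = t" unfolding s_def t_def comp_assoc pg by (rule refl)+
    ultimately have "(s, t) \<in> fixed_fillings ?d n b g \<times> fixed_fillings ?e n v g"
      using p by (auto simp: fixed_fillings_def fillings_def s_def t_def)
    then show "p \<in> m ` (fixed_fillings ?d n b g \<times> fixed_fillings ?e n v g)" using st by (rule rev_image_eqI)
  next
    fix p assume "p \<in> m ` (fixed_fillings ?d n b g \<times> fixed_fillings ?e n v g)"
    then obtain s t where st: "p = m (s, t)" and s: "s \<in> fillings ?d n b" "s \<circ> g = s"
      and t: "t \<in> fillings ?e n v" "t \<circ> g = t" by (auto simp: fixed_fillings_def)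
    have sI: "s k \<in> I" "t k \<in> J" if "k \<in> ?N" for k
    proof -
      have "b (s k) \<noteq> 0" "v (t k) \<noteq> 0" using fillings_image[OF s(1)] fillings_image[OF t(1)] that by blast+
      then show "s k \<in> I" "t k \<in> J" using supp(1)[of "s k"] supp(2)[of "t k"] by auto
    qed
    define Z where "Z q = card {k\<in>?N. (s k, t k) = q}" for q
    have "Z \<in> margins I J b v"
      unfolding margins_def
    proof (intro CollectI conjI allI ballI impI)
      fix q assume "q \<notin> I \<times> J"
      then have "{k\<in>?N. (s k, t k) = q} = {}" using sI by auto
      then show "Z q = 0" unfolding Z_def by (simp only: card.empty)
    next
      fix i
      have "(\<Sum>j\<in>J. Z (i, j)) = card {k\<in>?N. s k = i}"
        unfolding Z_def by (rule split1[symmetric]) (rule sI(2))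
      then show "(\<Sum>j\<in>J. Z (i, j)) = b i" using s(1) by (simp add: fillings_def)
    next
      fix j
      have "(\<Sum>i\<in>I. Z (i, j)) = card {k\<in>?N. t k = j}"
        unfolding Z_def by (rule split2[symmetric]) (rule sI(1))
      then show "(\<Sum>i\<in>I. Z (i, j)) = v j" using t(1) by (simp add: fillings_def)
    qed
    moreover have "p \<in> fillings (?d, ?e) n Z"
      using s(1) t(1) by (simp add: fillings_def st m_def Z_def)
    moreover have "p \<circ> g = p" using s(2) t(2) by (simp add: st m_def fun_eq_iff)
    ultimately show "p \<in> (\<Union>Z\<in>margins I J b v. fixed_fillings (?d, ?e) n Z g)"
      by (auto simp: fixed_fillings_def)
  qed
  moreover have "inj_on m (fixed_fillings ?d n b g \<times> fixed_fillings ?e n v g)"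
    by (auto simp: inj_on_def m_def fun_eq_iff)
  ultimately have "card (\<Union>Z\<in>margins I J b v. fixed_fillings (?d, ?e) n Z g) = perm_char n b g * perm_char n v g"
    by (simp add: card_image card_cartesian_product perm_char_def)
  moreover have "card (\<Union>Z\<in>margins I J b v. fixed_fillings (?d, ?e) n Z g)
     = (\<Sum>Z\<in>margins I J b v. card (fixed_fillings (?d, ?e) n Z g))"
  proof (rule card_UN_disjoint)
    show "finite (margins I J b v)" by (rule finite_margins[OF fin])
    show "\<forall>Z\<in>margins I J b v. finite (fixed_fillings (?d, ?e) n Z g)" by (simp add: finite_fixed_fillings)
    show "\<forall>Z\<in>margins I J b v. \<forall>Z'\<in>margins I J b v. Z \<noteq> Z' \<longrightarrow>
       fixed_fillings (?d, ?e) n Z g \<inter> fixed_fillings (?d, ?e) n Z' g = {}"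
    proof (intro ballI impI)
      fix Z Z' :: "'a \<times> 'b \<Rightarrow> nat" assume "Z \<noteq> Z'"
      then show "fixed_fillings (?d, ?e) n Z g \<inter> fixed_fillings (?d, ?e) n Z' g = {}"
        by (auto simp: fixed_fillings_def fillings_def fun_eq_iff)
    qed
  qed
  ultimately show ?thesis by (simp add: perm_char_default[OF g, of _ "(?d, ?e)"])
qed

section \<open>Jacobi-Trudi determinants of permutation characters\<close>

definition compositions :: "nat \<Rightarrow> nat \<Rightarrow> (nat \<Rightarrow> nat) set" where
  "compositions l v = {c. (\<forall>i. l \<le> i \<longrightarrow> c i = 0) \<and> (\<Sum>i<l. c i) = v}"

lemma finite_compositions: "finite (compositions l v)"
proof (rule finite_bounded_functions[of "{..<l}" _ v])
  fix c x assume c: "c \<in> compositions l v" "c x \<noteq> 0"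
  then have x: "x < l" by (auto simp: compositions_def not_less[symmetric])
  then have "c x \<le> (\<Sum>i<l. c i)" by (intro member_le_sum) auto
  then show "x \<in> {..<l} \<and> c x \<le> v" using c x by (simp add: compositions_def)
qed simp

text \<open>
  The number of nonnegative integer matrices with row sums \<open>b\<close> (on \<open>i < l\<close>) and column sums \<open>vs\<close>,
  computed by splitting off the first column. Integer row sums make the count defined for all rows
  occurring in a determinant; it is 0 if a row sum is negative.
\<close>

fun count_matrices :: "nat \<Rightarrow> (nat \<Rightarrow> int) \<Rightarrow> nat list \<Rightarrow> int" where
  "count_matrices l b [] = of_bool (\<forall>i<l. b i = 0)"
| "count_matrices l b (v # vs) = (\<Sum>c\<in>compositions l v. count_matrices l (\<lambda>i. b i - int (c i)) vs)"

lemma count_matrices_cong: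
  "(\<And>i. i < l \<Longrightarrow> b i = b' i) \<Longrightarrow> count_matrices l b vs = count_matrices l b' vs"
proof (induction vs arbitrary: b b')
  case (Cons v vs)
  have "count_matrices l (\<lambda>i. b i - int (c i)) vs = count_matrices l (\<lambda>i. b' i - int (c i)) vs" for c
    by (rule Cons.IH) (simp add: Cons.prems)
  then show ?case by simp
qed simp

lemma count_matrices_neg:
  assumes "i < l" "b i < 0"
  shows "count_matrices l b vs = 0"
  using assms
proof (induction vs arbitrary: b)
  case (Cons v vs)
  have "count_matrices l (\<lambda>i. b i - int (c i)) vs = 0" for c
    by (rule Cons.IH) (use Cons.prems in auto)
  then show ?case by simp
qed auto

definition list_fun :: "nat list \<Rightarrow> nat \<Rightarrow> nat" where
  "list_fun vs j = (if j < length vs then vs ! j else 0)"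

text \<open>
  The matrices counted by \<open>count_matrices\<close>.
\<close>

definition int_margins :: "nat \<Rightarrow> (nat \<Rightarrow> int) \<Rightarrow> nat list \<Rightarrow> (nat \<times> nat \<Rightarrow> nat) set" where
  "int_margins l b vs = {Z. (\<forall>i j. i \<ge> l \<or> j \<ge> length vs \<longrightarrow> Z (i, j) = 0) \<and>
     (\<forall>i<l. int (\<Sum>j<length vs. Z (i, j)) = b i) \<and> (\<forall>j<length vs. (\<Sum>i<l. Z (i, j)) = vs ! j)}"

lemma int_margins_eq:
  assumes "\<And>i. i < l \<Longrightarrow> b i \<ge> 0"
  shows "int_margins l b vs = margins {..<l} {..<length vs} (\<lambda>i. if i < l then nat (b i) else 0) (list_fun vs)"
proof -
  have "int (\<Sum>j<length vs. Z (i, j)) = b i \<longleftrightarrow> (\<Sum>j<length vs. Z (i, j)) = nat (b i)" if "i < l" for Z i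
    using assms[OF that] by linarith
  then show ?thesis
    by (auto simp: int_margins_def margins_def list_fun_def not_less)
qed

lemma finite_int_margins: "finite (int_margins l b vs)"
proof (cases "\<forall>i<l. b i \<ge> 0")
  case True
  then have "int_margins l b vs = margins {..<l} {..<length vs} (\<lambda>i. if i < l then nat (b i) else 0) (list_fun vs)"
    by (intro int_margins_eq) simp
  then show ?thesis by (simp add: finite_margins)
next
  case False
  then obtain i where i: "i < l" "b i < 0" by (auto simp: not_le)
  have "Z \<notin> int_margins l b vs" for Z
  proof
    assume "Z \<in> int_margins l b vs"
    then have "int (\<Sum>j<length vs. Z (i, j)) = b i" using i(1) by (simp add: int_margins_def)
    then show False using i(2) by linarith
  qed
  then have "int_margins l b vs = {}" by blast
  then show ?thesis by simp
qed

lemma card_int_margins: "int (card (int_margins l b vs)) = count_matrices l b vs"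
proof (induction vs arbitrary: b)
  case Nil
  have "int_margins l b [] = (if \<forall>i<l. b i = 0 then {\<lambda>_. 0} else {})"
    by (auto simp: int_margins_def)
  then show ?case by simp
next
  case (Cons v vs)
  let ?S = "SIGMA c:compositions l v. int_margins l (\<lambda>i. b i - int (c i)) vs"
  let ?f = "\<lambda>(c :: nat \<Rightarrow> nat, Z :: nat \<times> nat \<Rightarrow> nat) (i, j). case j of 0 \<Rightarrow> c i | Suc j' \<Rightarrow> Z (i, j')"
  let ?h = "\<lambda>Z :: nat \<times> nat \<Rightarrow> nat. (\<lambda>i. Z (i, 0), \<lambda>(i, j). Z (i, Suc j))"
  have "bij_betw ?f ?S (int_margins l b (v # vs))"
  proof (rule bij_betw_byWitness[where f' = ?h])
    show "\<forall>x\<in>?S. ?h (?f x) = x" by auto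
    show "\<forall>Z\<in>int_margins l b (v # vs). ?f (?h Z) = Z"
      by (auto simp: fun_eq_iff split: nat.split)
    show "?f ` ?S \<subseteq> int_margins l b (v # vs)"
    proof (rule image_subsetI)
      fix x assume "x \<in> ?S"
      then obtain c Z where x: "x = (c, Z)" and c: "c \<in> compositions l v"
        and Z: "Z \<in> int_margins l (\<lambda>i. b i - int (c i)) vs" by auto
      show "?f x \<in> int_margins l b (v # vs)"
        unfolding int_margins_def x
      proof (intro CollectI conjI allI impI)
        fix i j assume "i \<ge> l \<or> j \<ge> length (v # vs)"
        then show "?f (c, Z) (i, j) = 0"
          using c Z by (cases j) (auto simp: compositions_def int_margins_def)
      next
        fix i assume "i < l"
        then have "int (\<Sum>j<length vs. Z (i, j)) = b i - int (c i)" using Z by (auto simp: int_margins_def)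
        then show "int (\<Sum>j<length (v # vs). ?f (c, Z) (i, j)) = b i"
          by (simp add: sum.lessThan_Suc_shift del: sum.lessThan_Suc)
      next
        fix j assume "j < length (v # vs)"
        then show "(\<Sum>i<l. ?f (c, Z) (i, j)) = (v # vs) ! j"
          using c Z by (cases j) (auto simp: compositions_def int_margins_def)
      qed
    qed
    show "?h ` int_margins l b (v # vs) \<subseteq> ?S"
    proof (rule image_subsetI)
      fix Z assume Z: "Z \<in> int_margins l b (v # vs)"
      have cs: "(\<Sum>i<l. Z (i, j)) = (v # vs) ! j" if "j < Suc (length vs)" for j
        using Z that by (simp add: int_margins_def)
      have "(\<lambda>i. Z (i, 0)) \<in> compositions l v"
        using Z cs[of 0] by (simp add: compositions_def int_margins_def)
      moreover have "(\<lambda>(i, j). Z (i, Suc j)) \<in> int_margins l (\<lambda>i. b i - int (Z (i, 0))) vs"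
        unfolding int_margins_def
      proof (intro CollectI conjI allI impI)
        fix i j assume "i \<ge> l \<or> j \<ge> length vs"
        then show "(case (i, j) of (i, j) \<Rightarrow> Z (i, Suc j)) = 0" using Z by (auto simp: int_margins_def)
      next
        fix i assume "i < l"
        then have "int (\<Sum>j<Suc (length vs). Z (i, j)) = b i" using Z by (auto simp: int_margins_def)
        then show "int (\<Sum>j<length vs. case (i, j) of (i, j) \<Rightarrow> Z (i, Suc j)) = b i - int (Z (i, 0))"
          by (simp add: sum.lessThan_Suc_shift del: sum.lessThan_Suc)
      next
        fix j assume "j < length vs"
        then show "(\<Sum>i<l. case (i, j) of (i, j) \<Rightarrow> Z (i, Suc j)) = vs ! j" using cs[of "Suc j"] by simp
      qed
      ultimately show "?h Z \<in> ?S" by simp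
    qed
  qed
  then have "card (int_margins l b (v # vs)) = card ?S" by (rule bij_betw_same_card[symmetric])
  also have "\<dots> = (\<Sum>c\<in>compositions l v. card (int_margins l (\<lambda>i. b i - int (c i)) vs))"
    by (rule card_SigmaI) (auto simp: finite_compositions finite_int_margins)
  finally show ?case by (simp add: Cons.IH)
qed

text \<open>
  The permutation character on words with \<open>b i\<close> letters \<open>i\<close>, set to 0 when some \<open>b i\<close> is negative, in
  the same way as the complete symmetric functions of negative degree are 0.
\<close>

definition row_char :: "nat \<Rightarrow> nat \<Rightarrow> (nat \<Rightarrow> int) \<Rightarrow> (nat \<Rightarrow> nat) \<Rightarrow> int" where
  "row_char n l b g = (if \<forall>i<l. 0 \<le> b i then int (perm_char n (\<lambda>i. if i < l then nat (b i) else 0) g) else 0)"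

text \<open>
  The Jacobi-Trudi determinant in which the product \<open>h\<^sub>b\<^sub>1 h\<^sub>b\<^sub>2 \<dots>\<close> is read as a permutation character.
  The argument \<open>a\<close> is \<open>\<lambda>\<^sub>i - i\<close> rather than \<open>\<lambda>\<^sub>i\<close>, so that permuting rows means permuting \<open>a\<close>.
\<close>

definition jacobi_trudi :: "nat \<Rightarrow> nat \<Rightarrow> (nat \<Rightarrow> int) \<Rightarrow> (nat \<Rightarrow> nat) \<Rightarrow> int" where
  "jacobi_trudi n l a g = (\<Sum>\<sigma> | \<sigma> permutes {..<l}. sign \<sigma> * row_char n l (\<lambda>i. a i + int (\<sigma> i)) g)"

text \<open>
  The same alternating sum for matrix counts: up to the factor \<open>n!\<close>, the inner product of a
  Jacobi-Trudi determinant with a permutation character.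
\<close>

definition jt_matrices :: "nat \<Rightarrow> (nat \<Rightarrow> int) \<Rightarrow> nat list \<Rightarrow> int" where
  "jt_matrices l a vs = (\<Sum>\<sigma> | \<sigma> permutes {..<l}. sign \<sigma> * count_matrices l (\<lambda>i. a i + int (\<sigma> i)) vs)"

lemma sum_row_char_perm_char:
  assumes "sum_list vs = n"
  shows "(\<Sum>g | g permutes {1..n}. row_char n l b g * int (perm_char n (list_fun vs) g))
    = fact n * count_matrices l b vs"
proof (cases "\<forall>i<l. 0 \<le> b i")
  case True
  let ?b = "\<lambda>i. if i < l then nat (b i) else 0"
  let ?M = "margins {..<l} {..<length vs} ?b (list_fun vs)"
  have M: "?M = int_margins l b vs" using True by (subst int_margins_eq) auto
  have ne: "fillings undefined n Z \<noteq> {}" if Z: "Z \<in> ?M" for Z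
  proof -
    have sub: "{p. Z p \<noteq> 0} \<subseteq> {..<l} \<times> {..<length vs}" using margins_supp[OF Z] by blast
    have "(\<Sum>p | Z p \<noteq> 0. Z p) = (\<Sum>p\<in>{..<l} \<times> {..<length vs}. Z p)"
      by (rule sum.mono_neutral_left) (use sub in auto)
    also have "\<dots> = (\<Sum>i<l. \<Sum>j<length vs. Z (i, j))" by (simp add: sum.cartesian_product)
    also have "\<dots> = (\<Sum>j<length vs. \<Sum>i<l. Z (i, j))" by (rule sum.swap)
    also have "\<dots> = (\<Sum>j<length vs. vs ! j)" using Z by (simp add: margins_def list_fun_def)
    also have "\<dots> = n" using assms by (simp add: sum_list_sum_nth lessThan_atLeast0)
    finally show ?thesis using sub by (intro fillings_nonempty) (auto intro: finite_subset)
  qed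
  have "(\<Sum>g | g permutes {1..n}. row_char n l b g * int (perm_char n (list_fun vs) g))
      = (\<Sum>g | g permutes {1..n}. int (\<Sum>Z\<in>?M. perm_char n Z g))"
  proof (rule sum.cong[OF refl])
    fix g assume "g \<in> {g. g permutes {1..n}}"
    then have g: "g permutes {1..n}" by simp
    have "perm_char n ?b g * perm_char n (list_fun vs) g = (\<Sum>Z\<in>?M. perm_char n Z g)"
      by (rule perm_char_mult[OF g]) (auto simp: list_fun_def)
    then show "row_char n l b g * int (perm_char n (list_fun vs) g) = int (\<Sum>Z\<in>?M. perm_char n Z g)"
      unfolding row_char_def if_P[OF True] of_nat_mult[symmetric] by (rule arg_cong)
  qed
  also have "\<dots> = int (\<Sum>Z\<in>?M. \<Sum>g | g permutes {1..n}. perm_char n Z g)"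
    unfolding of_nat_sum[symmetric] by (subst sum.swap) (rule refl)
  also have "(\<Sum>Z\<in>?M. \<Sum>g | g permutes {1..n}. perm_char n Z g) = (\<Sum>Z\<in>?M. fact n)"
    unfolding sum_perm_char using ne by (intro sum.cong) auto
  also have "int \<dots> = fact n * count_matrices l b vs"
    unfolding M card_int_margins[symmetric] by simp
  finally show ?thesis .
next
  case False
  then show ?thesis unfolding row_char_def if_not_P[OF False] by (auto simp: count_matrices_neg)
qed

lemma sum_jacobi_trudi_perm_char:
  assumes "sum_list vs = n"
  shows "(\<Sum>g | g permutes {1..n}. jacobi_trudi n l a g * int (perm_char n (list_fun vs) g))
    = fact n * jt_matrices l a vs"
proof -
  have "(\<Sum>g | g permutes {1..n}. jacobi_trudi n l a g * int (perm_char n (list_fun vs) g))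
    = (\<Sum>\<sigma> | \<sigma> permutes {..<l}. sign \<sigma> * (\<Sum>g | g permutes {1..n}.
        row_char n l (\<lambda>i. a i + int (\<sigma> i)) g * int (perm_char n (list_fun vs) g)))"
    unfolding jacobi_trudi_def sum_distrib_left sum_distrib_right mult.assoc by (rule sum.swap)
  also have "\<dots> = fact n * jt_matrices l a vs"
    unfolding sum_row_char_perm_char[OF assms] jt_matrices_def by (simp add: sum_distrib_left algebra_simps)
  finally show ?thesis .
qed

lemma count_matrices_permute:
  assumes "\<tau> permutes {..<l}"
  shows "count_matrices l (\<lambda>i. b (\<tau> i)) vs = count_matrices l b vs"
proof (induction vs arbitrary: b)
  case Nil
  have "(\<forall>i<l. b (\<tau> i) = 0) \<longleftrightarrow> (\<forall>i<l. b i = 0)"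
    using permutes_image[OF assms] by (metis (no_types, lifting) image_iff lessThan_iff)
  then show ?case by simp
next
  case (Cons v vs)
  have inv: "inv' \<tau> permutes {..<l}" by (rule permutes_inv[OF assms])
  have mem: "c \<circ> \<tau>' \<in> compositions l v" if c: "c \<in> compositions l v" and \<tau>': "\<tau>' permutes {..<l}" for c \<tau>'
  proof -
    have "(\<Sum>i<l. c (\<tau>' i)) = (\<Sum>i<l. c i)" using sum.permute[OF \<tau>', of c] by (simp add: comp_def)
    moreover have "c (\<tau>' i) = 0" if "l \<le> i" for i
      using permutes_not_in[OF \<tau>', of i] that c by (simp add: compositions_def)
    ultimately show ?thesis using c by (simp add: compositions_def)
  qed
  have "count_matrices l (\<lambda>i. b (\<tau> i)) (v # vs)
    = (\<Sum>c\<in>compositions l v. count_matrices l (\<lambda>i. b (\<tau> i) - int (c i)) vs)" by simp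
  also have "\<dots> = (\<Sum>c\<in>compositions l v. count_matrices l (\<lambda>i. b i - int (c i)) vs)"
  proof (rule sum.reindex_bij_witness[of _ "\<lambda>c. c \<circ> \<tau>" "\<lambda>c. c \<circ> inv' \<tau>"])
    fix c assume c: "c \<in> compositions l v"
    show "c \<circ> inv' \<tau> \<circ> \<tau> = c" "c \<circ> \<tau> \<circ> inv' \<tau> = c"
      using permutes_inv_o[OF assms] by (simp_all add: comp_assoc)
    show "c \<circ> \<tau> \<in> compositions l v" "c \<circ> inv' \<tau> \<in> compositions l v"
      using mem c assms inv by blast+
    show "count_matrices l (\<lambda>i. b i - int ((c \<circ> inv' \<tau>) i)) vs = count_matrices l (\<lambda>i. b (\<tau> i) - int (c i)) vs"
      using Cons.IH[of "\<lambda>i. b i - int ((c \<circ> inv' \<tau>) i)"] permutes_inverses[OF assms] by simp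
  qed
  finally show ?case by simp
qed

lemma row_char_permute:
  assumes "\<tau> permutes {..<l}" and g: "g permutes {1..n}"
  shows "row_char n l (\<lambda>i. b (\<tau> i)) g = row_char n l b g"
proof -
  have iff: "(\<forall>i<l. 0 \<le> b (\<tau> i)) \<longleftrightarrow> (\<forall>i<l. 0 \<le> b i)"
    using permutes_image[OF assms(1)] by (metis (no_types, lifting) image_iff lessThan_iff)
  have lt: "\<tau> i < l \<longleftrightarrow> i < l" for i using permutes_in_image[OF assms(1), of i] by simp
  have eq: "perm_char n (\<lambda>i. if i < l then nat (b (\<tau> i)) else 0) g = perm_char n (\<lambda>i. if i < l then nat (b i) else 0) g"
  proof (rule perm_char_relabel[OF g, where h = \<tau>])
    show "inj_on \<tau> {i. (if i < l then nat (b (\<tau> i)) else 0) \<noteq> 0}" by (rule permutes_inj_on[OF assms(1)])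
    show "j \<in> \<tau> ` {i. (if i < l then nat (b (\<tau> i)) else 0) \<noteq> 0}" if "(if j < l then nat (b j) else 0) \<noteq> 0" for j
      using that lt[of "inv' \<tau> j"] permutes_inverses[OF assms(1)]
      by (intro image_eqI[of _ _ "inv' \<tau> j"]) auto
  qed (use lt in auto)
  show ?thesis unfolding row_char_def iff eq ..
qed

text \<open>
  Reindexing \<open>\<sigma>\<close> by \<open>\<sigma> \<circ> \<tau>\<close>: a determinant changes by the sign of a permutation of its rows.
\<close>

lemma alternating_sum_permute:
  fixes F :: "(nat \<Rightarrow> int) \<Rightarrow> int"
  assumes \<tau>: "\<tau> permutes {..<l}" and F: "\<And>b. F (\<lambda>i. b (\<tau> i)) = F b"
  shows "(\<Sum>\<sigma> | \<sigma> permutes {..<l}. sign \<sigma> * F (\<lambda>i. a (\<tau> i) + int (\<sigma> i)))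
    = sign \<tau> * (\<Sum>\<sigma> | \<sigma> permutes {..<l}. sign \<sigma> * F (\<lambda>i. a i + int (\<sigma> i)))"
proof -
  have "(\<Sum>\<sigma> | \<sigma> permutes {..<l}. sign \<sigma> * F (\<lambda>i. a (\<tau> i) + int (\<sigma> i)))
    = (\<Sum>\<sigma> | \<sigma> permutes {..<l}. sign (\<sigma> \<circ> \<tau>) * F (\<lambda>i. a (\<tau> i) + int ((\<sigma> \<circ> \<tau>) i)))"
    by (rule sum_permutations_compose_right[OF \<tau>])
  also have "\<dots> = (\<Sum>\<sigma> | \<sigma> permutes {..<l}. sign \<tau> * (sign \<sigma> * F (\<lambda>i. a i + int (\<sigma> i))))"
  proof (rule sum.cong[OF refl])
    fix \<sigma> assume "\<sigma> \<in> {\<sigma>. \<sigma> permutes {..<l}}"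
    then have "sign (\<sigma> \<circ> \<tau>) = sign \<sigma> * sign \<tau>"
      using \<tau> by (intro sign_compose) (auto intro: permutes_imp_permutation[rotated])
    then show "sign (\<sigma> \<circ> \<tau>) * F (\<lambda>i. a (\<tau> i) + int ((\<sigma> \<circ> \<tau>) i)) = sign \<tau> * (sign \<sigma> * F (\<lambda>i. a i + int (\<sigma> i)))"
      using F[of "\<lambda>i. a i + int (\<sigma> i)"] by simp
  qed
  finally show ?thesis by (simp add: sum_distrib_left)
qed

lemma jacobi_trudi_permute:
  assumes "\<tau> permutes {..<l}" "g permutes {1..n}"
  shows "jacobi_trudi n l (\<lambda>i. a (\<tau> i)) g = sign \<tau> * jacobi_trudi n l a g"
  unfolding jacobi_trudi_def
  by (rule alternating_sum_permute[OF assms(1), of "\<lambda>b. row_char n l b g"]) (rule row_char_permute[OF assms])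

lemma jt_matrices_permute:
  assumes "\<tau> permutes {..<l}"
  shows "jt_matrices l (\<lambda>i. a (\<tau> i)) vs = sign \<tau> * jt_matrices l a vs"
  unfolding jt_matrices_def
  by (rule alternating_sum_permute[OF assms(1), of "\<lambda>b. count_matrices l b vs"]) (rule count_matrices_permute[OF assms])

lemma jt_matrices_cong:
  assumes "\<And>i. i < l \<Longrightarrow> a i = a' i"
  shows "jt_matrices l a vs = jt_matrices l a' vs"
  unfolding jt_matrices_def
  by (intro sum.cong refl arg_cong2[where f = "(*)"] count_matrices_cong) (simp add: assms)

lemma jacobi_trudi_cong:
  assumes "\<And>i. i < l \<Longrightarrow> a i = a' i"
  shows "jacobi_trudi n l a g = jacobi_trudi n l a' g"
proof -
  have "row_char n l (\<lambda>i. a i + int (\<sigma> i)) g = row_char n l (\<lambda>i. a' i + int (\<sigma> i)) g" for \<sigma>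
    unfolding row_char_def by (simp add: assms cong: if_cong)
  then show ?thesis by (simp add: jacobi_trudi_def)
qed

lemma jacobi_trudi_inv: "g permutes {1..n} \<Longrightarrow> jacobi_trudi n L a (inv' g) = jacobi_trudi n L a g"
  unfolding jacobi_trudi_def row_char_def by (simp only: perm_char_inv)

lemma jacobi_trudi_neg:
  assumes "i < l" "a i + int l \<le> 0"
  shows "jacobi_trudi n l a g = 0"
  unfolding jacobi_trudi_def
proof (rule sum.neutral, intro ballI)
  fix \<sigma> assume "\<sigma> \<in> {\<sigma>. \<sigma> permutes {..<l}}"
  then have "\<sigma> i < l" using permutes_in_image[of \<sigma> "{..<l}" i] assms(1) by simp
  then have "\<not> 0 \<le> a i + int (\<sigma> i)" using assms(2) by linarith
  then have "\<not> (\<forall>i<l. 0 \<le> a i + int (\<sigma> i))" using assms(1) by blast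
  then show "sign \<sigma> * row_char n l (\<lambda>i. a i + int (\<sigma> i)) g = 0" unfolding row_char_def by (simp only: if_False mult_zero_right)
qed

lemma jt_matrices_neg:
  assumes "i < l" "a i + int l \<le> 0"
  shows "jt_matrices l a vs = 0"
  unfolding jt_matrices_def
proof (rule sum.neutral, intro ballI)
  fix \<sigma> assume "\<sigma> \<in> {\<sigma>. \<sigma> permutes {..<l}}"
  then have "\<sigma> i < l" using permutes_in_image[of \<sigma> "{..<l}" i] assms(1) by simp
  then have "a i + int (\<sigma> i) < 0" using assms(2) by linarith
  then show "sign \<sigma> * count_matrices l (\<lambda>i. a i + int (\<sigma> i)) vs = 0"
    using count_matrices_neg[OF assms(1), of "\<lambda>i. a i + int (\<sigma> i)"] by simp
qed

lemma jt_matrices_Cons: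
  "jt_matrices l a (v # vs) = (\<Sum>c\<in>compositions l v. jt_matrices l (\<lambda>i. a i - int (c i)) vs)"
  unfolding jt_matrices_def count_matrices.simps sum_distrib_left
  by (subst sum.swap) (simp add: algebra_simps)

text \<open>
  Pieri's rule. Call \<open>c\<close> bad at \<open>i\<close> if \<open>a i - c i \<le> a (i + 1)\<close>. Exchanging the two entries of \<open>a - c\<close> at
  the first bad place again gives a composition that is bad first at the same place, because both
  entries are at most \<open>a (i + 1)\<close>; the determinant changes sign, so all bad terms cancel in pairs.
\<close>

lemma pieri_cancel:
  assumes dec: "\<And>i. Suc i < l \<Longrightarrow> a (Suc i) < a i"
  shows "jt_matrices l a (v # vs) =
    (\<Sum>c | c \<in> compositions l v \<and> (\<forall>i. Suc i < l \<longrightarrow> a (Suc i) < a i - int (c i)). jt_matrices l (\<lambda>i. a i - int (c i)) vs)"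
proof -
  define bad where "bad c i \<longleftrightarrow> Suc i < l \<and> a i - int (c i) \<le> a (Suc i)" for c i
  define B where "B = {c \<in> compositions l v. \<exists>i. bad c i}"
  define first where "first c = (LEAST i. bad c i)" for c
  define J where "J c = jt_matrices l (\<lambda>i. a i - int (c i)) vs" for c
  have first: "bad c (first c)" "i < first c \<Longrightarrow> \<not> bad c i" if "c \<in> B" for c i
    using that LeastI_ex[of "bad c"] not_less_Least[of i "bad c"] by (auto simp: B_def first_def)
  \<comment> \<open>The new \<open>c\<close> is \<open>a\<close> minus the exchanged entries of \<open>a - c\<close> at \<open>i\<close> and \<open>i + 1\<close>.\<close>
  define F where "F c = (let i = first c in c(i := nat (a i - a (Suc i) + int (c (Suc i))),
      Suc i := nat (int (c i) - a i + a (Suc i))))" for c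
  have F: "F c \<in> B \<and> first (F c) = first c \<and> F (F c) = c \<and> J (F c) = - J c" if c: "c \<in> B" for c
  proof -
    define i where "i = first c"
    have i: "Suc i < l" "a i - int (c i) \<le> a (Suc i)" using first(1)[OF c] by (auto simp: bad_def i_def)
    have di: "a (Suc i) < a i" using dec i by simp
    have Fi: "int (F c i) = a i - a (Suc i) + int (c (Suc i))" "int (F c (Suc i)) = int (c i) - a i + a (Suc i)"
      using i di by (simp_all add: F_def i_def[symmetric] Let_def)
    have Fo: "F c j = c j" if "j \<noteq> i" "j \<noteq> Suc i" for j using that by (simp add: F_def i_def[symmetric] Let_def)
    have "(\<Sum>j<l. int (F c j)) = (\<Sum>j<l. int (c j))"
    proof -
      have sub: "{..<l} = insert i (insert (Suc i) ({..<l} - {i, Suc i}))" using i by auto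
      have "(\<Sum>j\<in>{..<l} - {i, Suc i}. int (F c j)) = (\<Sum>j\<in>{..<l} - {i, Suc i}. int (c j))"
        by (rule sum.cong) (auto simp: Fo)
      then show ?thesis by (subst (1 2) sub) (simp add: Fi)
    qed
    then have "(\<Sum>j<l. F c j) = (\<Sum>j<l. c j)" by (metis of_nat_eq_iff of_nat_sum)
    moreover have "F c j = 0" if "l \<le> j" for j
      using Fo[of j] that i c by (auto simp: B_def compositions_def)
    ultimately have comp: "F c \<in> compositions l v" using c by (simp add: B_def compositions_def)
    have badi: "bad (F c) i" using i by (simp add: bad_def Fi)
    have notbad: "\<not> bad (F c) j" if "j < i" for j
    proof -
      have "\<not> bad c j" using first(2)[OF c] that by (simp add: i_def)
      then show ?thesis using Fo[of j] that by (simp add: bad_def)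
    qed
    have FB: "F c \<in> B" using comp badi by (auto simp: B_def)
    have ff: "first (F c) = i" unfolding first_def
      by (rule Least_equality) (use badi notbad in \<open>auto simp: not_less[symmetric]\<close>)
    have "F (F c) j = c j" for j
    proof -
      have "F (F c) = (F c)(i := nat (a i - a (Suc i) + int (F c (Suc i))), Suc i := nat (int (F c i) - a i + a (Suc i)))"
        unfolding F_def[of "F c"] Let_def ff by (rule refl)
      then show ?thesis using Fo[of j] by (auto simp: Fi)
    qed
    then have FF: "F (F c) = c" by (simp add: fun_eq_iff)
    let ?\<tau> = "Transposition.transpose i (Suc i)"
    have \<tau>: "?\<tau> permutes {..<l}" using i by (intro permutes_swap_id) auto
    have "J (F c) = jt_matrices l (\<lambda>j. (\<lambda>j. a j - int (c j)) (?\<tau> j)) vs"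
      unfolding J_def
    proof (rule jt_matrices_cong)
      fix j show "a j - int (F c j) = a (?\<tau> j) - int (c (?\<tau> j))"
        by (cases "j = i \<or> j = Suc i") (auto simp: Fi Fo transpose_def)
    qed
    also have "\<dots> = - J c" unfolding jt_matrices_permute[OF \<tau>, of "\<lambda>j. a j - int (c j)"] J_def
      by (simp add: sign_swap_id)
    finally show ?thesis using FB ff FF by (simp add: i_def)
  qed
  have finB: "finite B" using finite_compositions[of l v] by (auto simp: B_def)
  have "sum J B = (\<Sum>c\<in>B. J (F c))"
    by (rule sum.reindex_bij_witness[of _ F F]) (use F in auto)
  also have "\<dots> = - sum J B" using F by (simp add: sum_negf)
  finally have B0: "sum J B = 0" by simp
  have "jt_matrices l a (v # vs) = sum J (compositions l v)" unfolding jt_matrices_Cons J_def ..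
  also have "compositions l v = B \<union> {c \<in> compositions l v. \<forall>i. Suc i < l \<longrightarrow> a (Suc i) < a i - int (c i)}"
    by (auto simp: B_def bad_def not_le)
  also have "sum J \<dots> = sum J B + sum J {c \<in> compositions l v. \<forall>i. Suc i < l \<longrightarrow> a (Suc i) < a i - int (c i)}"
    by (rule sum.union_disjoint) (use finB finite_compositions[of l v] in \<open>auto simp: B_def bad_def not_le[symmetric]\<close>)
  finally show ?thesis unfolding B0 unfolding J_def by simp
qed

text \<open>
  The strictly decreasing sequence of beta numbers of a partition.
\<close>

definition beta_seq :: "(nat \<Rightarrow> nat) \<Rightarrow> nat \<Rightarrow> int" where
  "beta_seq p i = int (p i) - int i"

text \<open>
  The good \<open>c\<close> with nonzero contribution satisfy \<open>c i \<le> p i - p (i + 1)\<close>, and these bounds add up to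
  \<open>p 0\<close>. A column sum \<open>v \<ge> p 0\<close> is thus possible only with equality everywhere, which deletes the
  first part of \<open>p\<close>.
\<close>

lemma pieri_top:
  assumes p: "antimono p" "\<And>i. l \<le> i \<Longrightarrow> p i = 0" and l: "0 < l" and v: "p 0 \<le> v"
  shows "jt_matrices l (beta_seq p) (v # vs) =
    (if v = p 0 then jt_matrices l (beta_seq (cut_first p)) vs else 0)"
proof -
  have pS: "p (Suc i) \<le> p i" for i using p(1) by (simp add: antimono_def)
  let ?a = "beta_seq p"
  let ?C = "{c. c \<in> compositions l v \<and> (\<forall>i. Suc i < l \<longrightarrow> ?a (Suc i) < ?a i - int (c i))}"
  let ?J = "\<lambda>c. jt_matrices l (\<lambda>i. ?a i - int (c i)) vs"
  define c0 where "c0 i = p i - p (Suc i)" for i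
  have tele: "(\<Sum>i<m. c0 i) + p m = p 0" for m
  proof (induction m)
    case (Suc m)
    then show ?case using pS[of m] by (simp add: c0_def)
  qed simp
  have c0: "(\<Sum>i<l. c0 i) = p 0" "\<And>i. l \<le> i \<Longrightarrow> c0 i = 0" using tele[of l] p(2) by (simp_all add: c0_def)
  have only: "v = p 0 \<and> c = c0" if c: "c \<in> ?C" and nz: "?J c \<noteq> 0" for c
  proof -
    have le: "c i \<le> c0 i" if "i < l" for i
    proof (cases "Suc i < l")
      case True
      then have "?a (Suc i) < ?a i - int (c i)" using c by simp
      then show ?thesis by (simp add: beta_seq_def c0_def)
    next
      case False
      then have l_eq: "l = Suc i" using that by simp
      have "\<not> ?a i - int (c i) + int l \<le> 0" using jt_matrices_neg[OF that, of "\<lambda>i. ?a i - int (c i)"] nz by blast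
      then show ?thesis using p(2)[of "Suc i"] by (simp add: beta_seq_def c0_def l_eq)
    qed
    have "(\<Sum>i<l. c i) = v" using c by (simp add: compositions_def)
    moreover have "(\<Sum>i<l. c i) \<le> (\<Sum>i<l. c0 i)" by (rule sum_mono) (use le in auto)
    ultimately have v0: "v = p 0" and eq: "(\<Sum>i<l. c i) = (\<Sum>i<l. c0 i)" using c0(1) v by auto
    have "c i = c0 i" for i
    proof (cases "i < l")
      case True
      show ?thesis by (rule sum_mono_inv[OF eq]) (use le True in auto)
    next
      case False
      then show ?thesis using c c0(2) by (simp add: compositions_def)
    qed
    then show ?thesis using v0 by auto
  qed
  have "jt_matrices l ?a (v # vs) = sum ?J ?C"
  proof (rule pieri_cancel)
    show "?a (Suc i) < ?a i" for i using pS[of i] by (simp add: beta_seq_def)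
  qed
  also have "\<dots> = (if v = p 0 then jt_matrices l (beta_seq (cut_first p)) vs else 0)"
  proof (cases "v = p 0")
    case True
    have c0C: "c0 \<in> ?C"
      using c0 True pS by (auto simp: compositions_def beta_seq_def c0_def)
    have "sum ?J ?C = sum ?J {c0}"
      by (rule sum.mono_neutral_right) (use finite_compositions[of l v] c0C only in auto)
    also have "\<dots> = jt_matrices l (beta_seq (cut_first p)) vs"
      using pS by (simp, intro jt_matrices_cong) (simp add: beta_seq_def c0_def cut_first_def)
    finally show ?thesis using True by simp
  next
    case False
    have "sum ?J ?C = 0" by (rule sum.neutral) (use only False in blast)
    then show ?thesis using False by simp
  qed
  finally show ?thesis .
qed

section \<open>Orthonormality of the determinants\<close>

lemma psize_eq_sum:
  assumes "\<And>i. l \<le> i \<Longrightarrow> p i = 0"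
  shows "psize p = (\<Sum>i<l. p i)"
proof -
  have "i < l" if "p i \<noteq> 0" for i using assms[of i] that by (cases "l \<le> i") auto
  then show ?thesis unfolding psize_def by (intro sum.mono_neutral_left) auto
qed

lemma sum_lessThan_card_le:
  fixes A :: "nat set"
  assumes "finite A" "card A = j"
  shows "(\<Sum>i<j. i) \<le> \<Sum>A"
  using assms
proof (induction j arbitrary: A)
  case (Suc j)
  have ne: "A \<noteq> {}" using Suc.prems by auto
  define x where "x = Max A"
  have x: "x \<in> A" using Suc.prems(1) ne by (simp add: x_def)
  have "A \<subseteq> {..x}" using Suc.prems by (auto simp: x_def)
  then have "card A \<le> card {..x}" by (intro card_mono) auto
  then have "j \<le> x" using Suc.prems by simp
  moreover have "(\<Sum>i<j. i) \<le> \<Sum>(A - {x})" using Suc.prems x by (intro Suc.IH) auto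
  moreover have "\<Sum>A = x + \<Sum>(A - {x})" using Suc.prems(1) x by (simp add: sum.remove)
  ultimately show ?case by simp
qed simp

lemma sum_permutes_ge:
  fixes \<sigma> :: "nat \<Rightarrow> nat"
  assumes "\<sigma> permutes {..<l}"
  shows "(\<Sum>i<j. i) \<le> (\<Sum>i<j. \<sigma> i)"
proof -
  have "inj_on \<sigma> {..<j}" by (rule permutes_inj_on[OF assms])
  then have "card (\<sigma> ` {..<j}) = j" "\<Sum>(\<sigma> ` {..<j}) = (\<Sum>i<j. \<sigma> i)"
    by (simp_all add: card_image sum.reindex)
  then show ?thesis using sum_lessThan_card_le[of "\<sigma> ` {..<j}" j] by simp
qed

lemma permutes_eq_id:
  fixes \<sigma> :: "nat \<Rightarrow> nat"
  assumes "\<sigma> permutes {..<l}" "\<And>j. j \<le> l \<Longrightarrow> (\<Sum>i<j. \<sigma> i) = (\<Sum>i<j. i)"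
  shows "\<sigma> = id"
proof
  fix i show "\<sigma> i = id i"
  proof (cases "i < l")
    case True
    then show ?thesis using assms(2)[of "Suc i"] assms(2)[of i] by simp
  qed (use permutes_not_in[OF assms(1)] in simp)
qed

lemma sum_displacement_nonneg:
  fixes \<sigma> :: "nat \<Rightarrow> nat"
  assumes "\<sigma> permutes {..<l}"
  shows "0 \<le> (\<Sum>i<j. int (\<sigma> i) - int i)"
  using sum_permutes_ge[OF assms, of j] by (simp add: sum_subtractf flip: of_nat_sum)

lemma sum_displacement_zero:
  fixes \<sigma> :: "nat \<Rightarrow> nat"
  assumes "\<sigma> permutes {..<l}"
  shows "(\<Sum>i<l. int (\<sigma> i) - int i) = 0"
  using sum.permute[OF assms, of int] by (simp add: sum_subtractf comp_def)

text \<open>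
  Repeated use of \<open>pieri_top\<close>: as long as the partial sums of \<open>vs\<close> and \<open>p\<close> agree, whole parts are
  deleted, and at the first strict excess the determinant vanishes.
\<close>

lemma jt_matrices_lower:
  assumes "antimono p" "\<And>i. l \<le> i \<Longrightarrow> p i = 0" "0 < l" "k \<le> length vs"
    "\<And>j. j \<le> k \<Longrightarrow> (\<Sum>i<j. p i) \<le> (\<Sum>i<j. vs ! i)" "(\<Sum>i<k. p i) < (\<Sum>i<k. vs ! i)"
  shows "jt_matrices l (beta_seq p) vs = 0"
  using assms
proof (induction vs arbitrary: p k)
  case (Cons v vs)
  obtain k' where k: "k = Suc k'" using Cons.prems(6) by (cases k) auto
  have "p 0 \<le> v" using Cons.prems(5)[of 1] k by simp
  have top: "jt_matrices l (beta_seq p) (v # vs) =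
    (if v = p 0 then jt_matrices l (beta_seq (cut_first p)) vs else 0)"
    by (rule pieri_top) (use Cons.prems \<open>p 0 \<le> v\<close> in auto)
  show ?case
  proof (cases "v = p 0")
    case True
    have "jt_matrices l (beta_seq (cut_first p)) vs = 0"
    proof (rule Cons.IH[of _ k'])
      show "antimono (cut_first p)" using Cons.prems(1) by (simp add: antimono_def cut_first_def)
      show "cut_first p i = 0" if "l \<le> i" for i using Cons.prems(2)[of "Suc i"] that by (simp add: cut_first_def)
      show "(\<Sum>i<j. cut_first p i) \<le> (\<Sum>i<j. vs ! i)" if "j \<le> k'" for j
        using Cons.prems(5)[of "Suc j"] that k True
        by (simp add: sum.lessThan_Suc_shift cut_first_def del: sum.lessThan_Suc)
      show "(\<Sum>i<k'. cut_first p i) < (\<Sum>i<k'. vs ! i)"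
        using Cons.prems(6) k True by (simp add: sum.lessThan_Suc_shift cut_first_def del: sum.lessThan_Suc)
    qed (use Cons.prems k in auto)
    then show ?thesis using top by simp
  qed (use top in simp)
qed simp

lemma jt_matrices_diag:
  assumes "antimono p" "\<And>i. l \<le> i \<Longrightarrow> p i = 0" "0 < l" "\<And>i. m \<le> i \<Longrightarrow> p i = 0"
  shows "jt_matrices l (beta_seq p) (map p [0..<m]) = 1"
  using assms
proof (induction m arbitrary: p)
  case 0
  have only: "(\<forall>i<l. beta_seq p i + int (\<sigma> i) = 0) \<longleftrightarrow> \<sigma> = id" if "\<sigma> permutes {..<l}" for \<sigma>
  proof
    assume *: "\<forall>i<l. beta_seq p i + int (\<sigma> i) = 0"
    show "\<sigma> = id"
    proof
      fix i show "\<sigma> i = id i"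
        using * 0 permutes_not_in[OF that, of i] by (cases "i < l") (auto simp: beta_seq_def)
    qed
  qed (use 0 in \<open>simp add: beta_seq_def\<close>)
  have "jt_matrices l (beta_seq p) [] = (\<Sum>\<sigma> | \<sigma> permutes {..<l}. if \<sigma> = id then 1 else 0)"
    unfolding jt_matrices_def by (intro sum.cong refl) (use only in auto)
  also have "\<dots> = 1" by (simp add: finite_permutations permutes_id)
  finally show ?case by simp
next
  case (Suc m)
  have "map p [0..<Suc m] = p 0 # map (cut_first p) [0..<m]"
    unfolding upt_rec[of 0 "Suc m"] by (simp add: map_Suc_upt[symmetric] cut_first_def comp_def del: upt_Suc)
  then have "jt_matrices l (beta_seq p) (map p [0..<Suc m])
      = jt_matrices l (beta_seq (cut_first p)) (map (cut_first p) [0..<m])"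
    using pieri_top[of p l "p 0"] Suc.prems by simp
  also have "\<dots> = 1"
  proof (rule Suc.IH)
    show "antimono (cut_first p)" using Suc.prems(1) by (simp add: antimono_def cut_first_def)
  qed (use Suc.prems in \<open>auto simp: cut_first_def\<close>)
  finally show ?case .
qed

text \<open>
  The row lengths \<open>q i - i + \<tau> i\<close> have partial sums at least those of \<open>q\<close>, with equality throughout
  only for \<open>\<tau> = id\<close>. In the order on \<open>p\<close> and \<open>q\<close> assumed here \<open>jt_matrices_lower\<close> therefore kills
  all other terms.
\<close>

lemma jt_row_char_inner:
  assumes p: "is_partition p" "\<And>i. l \<le> i \<Longrightarrow> p i = 0" and q: "is_partition q" "\<And>i. l \<le> i \<Longrightarrow> q i = 0"
    and n: "psize p = n" "psize q = n" and l: "0 < l" and \<tau>: "\<tau> permutes {..<l}"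
    and order: "p = q \<or> (\<exists>k<l. (\<forall>i<k. p i = q i) \<and> p k < q k)"
  shows "(\<Sum>g | g permutes {1..n}. jacobi_trudi n l (beta_seq p) g * row_char n l (\<lambda>i. beta_seq q i + int (\<tau> i)) g)
    = (if p = q \<and> \<tau> = id then fact n else 0)"
proof -
  define b where "b i = beta_seq q i + int (\<tau> i)" for i
  have bsum: "(\<Sum>i<j. b i) = int (\<Sum>i<j. q i) + (\<Sum>i<j. int (\<tau> i) - int i)" for j
    by (simp add: b_def beta_seq_def algebra_simps sum.distrib sum_subtractf)
  show ?thesis
  proof (cases "\<forall>i<l. 0 \<le> b i")
    case False
    have "\<not> (p = q \<and> \<tau> = id)"
    proof
      assume "p = q \<and> \<tau> = id"
      then have "\<forall>i<l. 0 \<le> b i" by (simp add: b_def beta_seq_def)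
      then show False using False by blast
    qed
    then show ?thesis unfolding row_char_def b_def[symmetric] if_not_P[OF False] by simp
  next
    case True
    define vs where "vs = map (\<lambda>i. nat (b i)) [0..<l]"
    have vsi: "int (vs ! i) = b i" if "i < l" for i using True that by (simp add: vs_def)
    have vs_sum: "int (\<Sum>i<j. vs ! i) = (\<Sum>i<j. b i)" if "j \<le> l" for j
      unfolding of_nat_sum by (rule sum.cong) (use vsi that in auto)
    have lf: "list_fun vs = (\<lambda>i. if i < l then nat (b i) else 0)"
      by (auto simp: list_fun_def vs_def)
    have "int (sum_list vs) = int (\<Sum>i<l. vs ! i)"
      by (simp add: sum_list_sum_nth vs_def lessThan_atLeast0)
    also have "\<dots> = int n"
      unfolding vs_sum[OF order_refl] bsum sum_displacement_zero[OF \<tau>]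
      using psize_eq_sum[of l q] q n by simp
    finally have sl: "sum_list vs = n" by simp
    have "(\<Sum>g | g permutes {1..n}. jacobi_trudi n l (beta_seq p) g * row_char n l b g)
       = fact n * jt_matrices l (beta_seq p) vs"
      unfolding sum_jacobi_trudi_perm_char[OF sl, symmetric] row_char_def if_P[OF True] lf by (rule refl)
    moreover have "jt_matrices l (beta_seq p) vs = (if p = q \<and> \<tau> = id then 1 else 0)"
    proof (cases "p = q \<and> \<tau> = id")
      case T: True
      have "vs = map p [0..<l]" using T by (simp add: vs_def b_def beta_seq_def)
      then show ?thesis using T jt_matrices_diag[of p l l] p l by (simp add: is_partition_def)
    next
      case ne: False
      have ge: "(\<Sum>i<j. q i) \<le> (\<Sum>i<j. vs ! i)" if "j \<le> l" for j
        using vs_sum[OF that] bsum[of j] sum_displacement_nonneg[OF \<tau>, of j] by linarith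
      have "\<exists>k\<le>l. (\<forall>j\<le>k. (\<Sum>i<j. p i) \<le> (\<Sum>i<j. vs ! i)) \<and> (\<Sum>i<k. p i) < (\<Sum>i<k. vs ! i)"
      proof (cases "p = q")
        case True
        then have "\<tau> \<noteq> id" using ne by simp
        then obtain k where k: "k \<le> l" "(\<Sum>i<k. \<tau> i) \<noteq> (\<Sum>i<k. i)" using permutes_eq_id[OF \<tau>] by blast
        then have "(\<Sum>i<k. i) < (\<Sum>i<k. \<tau> i)" using sum_permutes_ge[OF \<tau>, of k] by simp
        then have "0 < (\<Sum>i<k. int (\<tau> i) - int i)" by (simp add: sum_subtractf flip: of_nat_sum)
        then have "(\<Sum>i<k. p i) < (\<Sum>i<k. vs ! i)" unfolding True using vs_sum[OF k(1)] bsum[of k] by linarith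
        then show ?thesis using ge k(1) True by auto
      next
        case False
        then obtain k where k: "k < l" "\<And>i. i < k \<Longrightarrow> p i = q i" "p k < q k" using order by blast
        have eq: "(\<Sum>i<j. p i) = (\<Sum>i<j. q i)" if "j \<le> k" for j
          by (rule sum.cong) (use k that in auto)
        have lt: "(\<Sum>i<Suc k. p i) < (\<Sum>i<Suc k. q i)" using eq[of k] k(3) by simp
        have "(\<Sum>i<j. p i) \<le> (\<Sum>i<j. vs ! i)" if "j \<le> Suc k" for j
        proof (cases "j = Suc k")
          case True
          then show ?thesis using lt ge[of "Suc k"] k(1) by simp
        next
          case False
          then show ?thesis using eq[of j] ge[of j] k(1) that by simp
        qed
        moreover have "(\<Sum>i<Suc k. p i) < (\<Sum>i<Suc k. vs ! i)" using lt ge[of "Suc k"] k(1) by simp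
        ultimately show ?thesis using k(1) by (intro exI[of _ "Suc k"]) auto
      qed
      then obtain k where "k \<le> l" "\<And>j. j \<le> k \<Longrightarrow> (\<Sum>i<j. p i) \<le> (\<Sum>i<j. vs ! i)" "(\<Sum>i<k. p i) < (\<Sum>i<k. vs ! i)"
        by blast
      then have "jt_matrices l (beta_seq p) vs = 0"
        using p l by (intro jt_matrices_lower[of p l k]) (auto simp: is_partition_def vs_def)
      then show ?thesis using ne by simp
    qed
    ultimately show ?thesis unfolding b_def[symmetric] by simp
  qed
qed

text \<open>
  The inner product is symmetric, so the two partitions may be compared at the first place where they
  differ.
\<close>

theorem jacobi_trudi_orthonormal:
  assumes p: "is_partition p" "\<And>i. l \<le> i \<Longrightarrow> p i = 0" and q: "is_partition q" "\<And>i. l \<le> i \<Longrightarrow> q i = 0"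
    and n: "psize p = n" "psize q = n" and l: "0 < l"
  shows "(\<Sum>g | g permutes {1..n}. jacobi_trudi n l (beta_seq p) g * jacobi_trudi n l (beta_seq q) g)
    = (if p = q then fact n else 0)"
proof -
  have *: "(\<Sum>g | g permutes {1..n}. jacobi_trudi n l (beta_seq p) g * jacobi_trudi n l (beta_seq q) g)
      = (if p = q then fact n else 0)"
    if p: "is_partition p" "\<And>i. l \<le> i \<Longrightarrow> p i = 0" and q: "is_partition q" "\<And>i. l \<le> i \<Longrightarrow> q i = 0"
    and n: "psize p = n" "psize q = n" and order: "p = q \<or> (\<exists>k<l. (\<forall>i<k. p i = q i) \<and> p k < q k)" for p q
  proof -
    have "(\<Sum>g | g permutes {1..n}. jacobi_trudi n l (beta_seq p) g * jacobi_trudi n l (beta_seq q) g)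
      = (\<Sum>\<tau> | \<tau> permutes {..<l}. sign \<tau> * (\<Sum>g | g permutes {1..n}.
         jacobi_trudi n l (beta_seq p) g * row_char n l (\<lambda>i. beta_seq q i + int (\<tau> i)) g))"
      unfolding jacobi_trudi_def[of n l "beta_seq q"] sum_distrib_left
      by (subst sum.swap) (simp add: algebra_simps)
    also have "\<dots> = (\<Sum>\<tau> | \<tau> permutes {..<l}. if \<tau> = id then (if p = q then fact n else 0) else 0)"
    proof (rule sum.cong[OF refl])
      fix \<tau> assume "\<tau> \<in> {\<tau>. \<tau> permutes {..<l}}"
      then have \<tau>: "\<tau> permutes {..<l}" by simp
      show "sign \<tau> * (\<Sum>g | g permutes {1..n}.
         jacobi_trudi n l (beta_seq p) g * row_char n l (\<lambda>i. beta_seq q i + int (\<tau> i)) g)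
         = (if \<tau> = id then (if p = q then fact n else 0) else 0)"
        by (subst jt_row_char_inner[OF p q n l \<tau> order]) (cases "\<tau> = id", auto)
    qed
    also have "\<dots> = (if p = q then fact n else 0)" by (simp add: finite_permutations permutes_id)
    finally show ?thesis .
  qed
  show ?thesis
  proof (cases "p = q")
    case True
    then show ?thesis using * p q n by blast
  next
    case False
    then obtain k0 where k0: "p k0 \<noteq> q k0" by auto
    define k where "k = (LEAST k. p k \<noteq> q k)"
    have k: "p k \<noteq> q k" unfolding k_def by (rule LeastI[of _ k0]) (rule k0)
    have below: "p i = q i" if "i < k" for i using not_less_Least[of i "\<lambda>k. p k \<noteq> q k"] that by (auto simp: k_def)
    have "k < l" using k p(2)[of k] q(2)[of k] by (cases "l \<le> k") auto
    from k consider "p k < q k" | "q k < p k" by linarith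
    then show ?thesis
    proof cases
      case 1
      then show ?thesis using *[OF p q n] below \<open>k < l\<close> by blast
    next
      case 2
      then have "(\<Sum>g | g permutes {1..n}. jacobi_trudi n l (beta_seq q) g * jacobi_trudi n l (beta_seq p) g)
        = (if q = p then fact n else 0)"
        using *[OF q p n(2,1)] below \<open>k < l\<close> by metis
      then show ?thesis using False by (simp add: mult.commute)
    qed
  qed
qed

section \<open>Specht modules\<close>

definition tabloids :: "nat \<Rightarrow> (nat \<Rightarrow> nat) \<Rightarrow> (nat \<Rightarrow> nat) set" where
  "tabloids n v = fillings (fst (undefined :: nat \<times> nat)) n v"

lemma of_int_sign_sq [simp]: "of_int (sign q) * of_int (sign q) = (1 :: complex)"
  by (metis of_int_1 of_int_mult sign_idempotent)

text \<open>
  Place permutation of words, the right action underlying \<open>act\<close>.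
\<close>

abbreviation place :: "(nat \<Rightarrow> nat) \<Rightarrow> (nat \<Rightarrow> 'i) \<Rightarrow> nat \<Rightarrow> 'i" where
  "place g t \<equiv> t \<circ> g"

lemma act_eq_pull: "act = pull place"
  by (simp add: fun_eq_iff act_def pull_def)

lemma finite_sym_group: "finite (carrier (sym_group n))"
  by (simp add: sym_group_def finite_permutations)

lemma card_sym_group: "card (carrier (sym_group n)) = fact n"
  using card_permutations[of "{1..n}" n] by (simp add: sym_group_def)

lemma inv_sym_group: "g \<in> carrier (sym_group n) \<Longrightarrow> m_inv (sym_group n) g = inv' g"
  by (rule group.inv_equality[OF sym_group_is_group])
     (auto simp: sym_group_def permutes_inv permutes_inv_o)

lemma fin_action_fillings: "fin_action (sym_group n) place (fillings d n v)"
proof -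
  interpret group "sym_group n" by (rule sym_group_is_group)
  show ?thesis
    by unfold_locales
       (auto simp: finite_sym_group finite_fillings sym_group_mult sym_group_one sym_group_carrier
         intro: fillings_comp simp del: One_nat_def)
qed

lemma subrep_supported: "fin_action G \<rho> X \<Longrightarrow> subrep G (pull \<rho>) (supported X)"
  unfolding subrep_def
proof (intro conjI ballI subspace_supported)
  fix g f assume act: "fin_action G \<rho> X" and g: "g \<in> carrier G" and f: "f \<in> supported X"
  interpret fin_action G \<rho> X by (rule act)
  have "x \<in> X" if "\<rho> g x \<in> X" for x
    using closed[of "m_inv G g" "\<rho> g x"] that g by simp
  then show "pull \<rho> g f \<in> supported X" using f by (auto simp: supported_def pull_def)
qed

definition point_mass :: "'b \<Rightarrow> 'b \<Rightarrow> complex" where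
  "point_mass x y = of_bool (y = x)"

lemma projector_point_mass: "finite X \<Longrightarrow> projector X (supported X) point_mass"
proof -
  assume X: "finite X"
  have "(\<Sum>x\<in>X. f x * point_mass x y) = f y" if f: "f \<in> supported X" for f y
  proof -
    have "(\<Sum>x\<in>X. f x * point_mass x y) = (\<Sum>x\<in>X. if x = y then f y else 0)"
      by (rule sum.cong) (auto simp: point_mass_def)
    then show ?thesis using X f by (auto simp: supported_def)
  qed
  then show ?thesis by (auto simp: projector_def supported_def point_mass_def)
qed

lemma hermitian_point_mass: "hermitian X point_mass"
  by (auto simp: hermitian_def point_mass_def)

lemma char_on_point_mass:
  assumes "g permutes {1..n}"
  shows "char_on (fillings d n v) place point_mass g = of_nat (perm_char n v g)"
proof -
  have "char_on (fillings d n v) place point_mass g = (\<Sum>t\<in>fillings d n v. of_bool (t \<circ> g = t))"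
    by (simp add: char_on_def point_mass_def)
  also have "\<dots> = of_nat (card (fixed_fillings d n v g))"
    using finite_fillings[of d n v] by (simp add: fixed_fillings_def Int_def)
  finally show ?thesis by (simp only: perm_char_default[OF assms, of v d])
qed

text \<open>
  The signed column sum of a tableau, as an operator on all functions of words.
\<close>

definition antisymmetrizer :: "nat \<Rightarrow> (nat \<Rightarrow> nat \<times> nat) \<Rightarrow> ((nat \<Rightarrow> nat) \<Rightarrow> complex) \<Rightarrow> (nat \<Rightarrow> nat) \<Rightarrow> complex" where
  "antisymmetrizer n T f = (\<lambda>s. \<Sum>q\<in>column_stabilizer n T. of_int (sign q) * f (s \<circ> q))"

lemma polytabloid_eq: "polytabloid n T = antisymmetrizer n T (point_mass (fst \<circ> T))"
  by (rule ext) (simp add: polytabloid_def antisymmetrizer_def fun_sum_apply cscale_def act_def point_mass_def)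

locale tableau =
  fixes l :: "nat \<Rightarrow> nat" and n :: nat and T :: "nat \<Rightarrow> nat \<times> nat"
  assumes part: "is_partition l" and n: "n = psize l" and T: "T \<in> tableaux l"
begin

abbreviation "C \<equiv> column_stabilizer n T"
abbreviation "\<kappa> \<equiv> antisymmetrizer n T"
abbreviation "e \<equiv> polytabloid n T"

lemma T_bij: "bij_betw T {1..n} {(i, j). j < l i}"
  using T by (simp add: tableaux_def young_diagram_def n)

lemma T_inj: "k \<in> {1..n} \<Longrightarrow> m \<in> {1..n} \<Longrightarrow> T k = T m \<Longrightarrow> k = m"
  using T_bij by (auto simp: bij_betw_def dest: inj_onD)

lemma T_cell: "k \<in> {1..n} \<Longrightarrow> snd (T k) < l (fst (T k))"
  using bij_betw_apply[OF T_bij, of k] by (simp add: case_prod_beta)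

lemma T_outside: "k \<notin> {1..n} \<Longrightarrow> T k = undefined"
  using T by (auto simp: tableaux_def extensional_def n)

lemma l_antimono: "i \<le> j \<Longrightarrow> l j \<le> l i"
  using part by (simp add: is_partition_def antimono_def)

lemma row_tabloid: "fst \<circ> T \<in> tabloids n l"
  unfolding tabloids_def fillings_def using card_fst_bij_diagram[OF T_bij] T_outside by auto

lemma C_permutes: "q \<in> C \<Longrightarrow> q permutes {1..n}"
  by (simp add: column_stabilizer_def sym_group_carrier)

lemma C_column: "q \<in> C \<Longrightarrow> k \<in> {1..n} \<Longrightarrow> snd (T (q k)) = snd (T k)"
  by (simp add: column_stabilizer_def)

lemma C_I: "q permutes {1..n} \<Longrightarrow> (\<And>k. k \<in> {1..n} \<Longrightarrow> snd (T (q k)) = snd (T k)) \<Longrightarrow> q \<in> C"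
  by (simp add: column_stabilizer_def sym_group_carrier)

lemma C_finite: "finite C"
  using finite_subset[of C "carrier (sym_group n)"] finite_sym_group by (auto simp: column_stabilizer_def)

lemma C_id: "id \<in> C"
  by (rule C_I) (auto intro: permutes_id)

lemma C_comp: "q \<in> C \<Longrightarrow> r \<in> C \<Longrightarrow> q \<circ> r \<in> C"
proof (rule C_I)
  assume q: "q \<in> C" and r: "r \<in> C"
  show "q \<circ> r permutes {1..n}" using C_permutes q r by (blast intro: permutes_compose)
  fix k assume k: "k \<in> {1..n}"
  then have "r k \<in> {1..n}" using permutes_in_image[OF C_permutes[OF r]] by blast
  then show "snd (T ((q \<circ> r) k)) = snd (T k)" using C_column[OF q] C_column[OF r k] by simp
qed

lemma C_inv: "q \<in> C \<Longrightarrow> inv' q \<in> C"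
proof (rule C_I)
  assume q: "q \<in> C"
  show "inv' q permutes {1..n}" by (rule permutes_inv[OF C_permutes[OF q]])
  fix k assume k: "k \<in> {1..n}"
  have "inv' q k \<in> {1..n}" using permutes_in_image[OF permutes_inv[OF C_permutes[OF q]]] k by blast
  then show "snd (T (inv' q k)) = snd (T k)"
    using C_column[OF q, of "inv' q k"] permutes_inverses[OF C_permutes[OF q]] by simp
qed

lemma C_sign: "q \<in> C \<Longrightarrow> r \<in> C \<Longrightarrow> sign (q \<circ> r) = sign q * sign r"
  using C_permutes by (intro sign_compose) (auto intro: permutes_imp_permutation[rotated])

lemma C_inv_o: "q \<in> C \<Longrightarrow> inv' q \<circ> q = id" "q \<in> C \<Longrightarrow> q \<circ> inv' q = id"
  using permutes_inv_o[OF C_permutes] by auto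

lemma antisymmetrizer_translate:
  assumes r: "r \<in> C"
  shows "\<kappa> f (s \<circ> r) = of_int (sign r) * \<kappa> f s"
proof -
  have "\<kappa> f s = (\<Sum>q\<in>C. of_int (sign (r \<circ> q)) * f (s \<circ> (r \<circ> q)))"
    unfolding antisymmetrizer_def
  proof (rule sum.reindex_bij_witness[of _ "\<lambda>q. r \<circ> q" "\<lambda>q. inv' r \<circ> q"])
    fix q assume q: "q \<in> C"
    show "r \<circ> (inv' r \<circ> q) = q" "inv' r \<circ> (r \<circ> q) = q"
      using C_inv_o[OF r] by (simp_all add: comp_assoc[symmetric])
    then show "of_int (sign (r \<circ> (inv' r \<circ> q))) * f (s \<circ> (r \<circ> (inv' r \<circ> q))) = of_int (sign q) * f (s \<circ> q)" by simp
  qed (use C_comp C_inv r in auto)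
  also have "\<dots> = of_int (sign r) * \<kappa> f (s \<circ> r)"
    unfolding antisymmetrizer_def sum_distrib_left
    by (rule sum.cong) (simp_all add: C_sign[OF r] comp_assoc)
  finally have "of_int (sign r) * \<kappa> f s = of_int (sign r * sign r) * \<kappa> f (s \<circ> r)" by simp
  then show ?thesis by simp
qed

text \<open>
  The transposition of two entries in the same row of \<open>s\<close> and the same column of \<open>T\<close> fixes \<open>s\<close> and
  changes the sign.
\<close>

lemma antisymmetrizer_eq_0:
  assumes "k \<in> {1..n}" "m \<in> {1..n}" "k \<noteq> m" "snd (T k) = snd (T m)" "s k = s m"
  shows "\<kappa> f s = 0"
proof -
  let ?r = "Transposition.transpose k m"
  have r: "?r \<in> C"
    by (rule C_I) (use assms in \<open>auto intro: permutes_swap_id simp: transpose_def\<close>)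
  have "s \<circ> ?r = s" using assms(5) by (auto simp: fun_eq_iff transpose_def)
  then have "\<kappa> f s = of_int (sign ?r) * \<kappa> f s" using antisymmetrizer_translate[OF r, of f s] by simp
  then show ?thesis using assms(3) by (simp add: sign_swap_id)
qed

lemma column_fixing: "q \<in> C \<Longrightarrow> fst \<circ> T \<circ> q = fst \<circ> T \<Longrightarrow> q = id"
proof
  fix k assume q: "q \<in> C" and eq: "fst \<circ> T \<circ> q = fst \<circ> T"
  show "q k = id k"
  proof (cases "k \<in> {1..n}")
    case True
    have "T (q k) = T k" using C_column[OF q True] fun_cong[OF eq, of k] by (simp add: prod_eq_iff)
    then show ?thesis using T_inj permutes_in_image[OF C_permutes[OF q], of k] True by simp
  next
    case False
    then show ?thesis using permutes_not_in[OF C_permutes[OF q]] by simp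
  qed
qed

lemma polytabloid_leading: "e (fst \<circ> T) = 1"
proof -
  have "e (fst \<circ> T) = (\<Sum>q\<in>C. if q = id then 1 else 0)"
    unfolding polytabloid_eq antisymmetrizer_def
    by (rule sum.cong) (auto simp: point_mass_def dest: column_fixing)
  then show ?thesis using C_finite C_id by simp
qed

text \<open>
  James's combinatorial lemma. In each column of \<open>T\<close> the rows \<open>s k\<close> are distinct, so at most as many of
  them as of the rows of \<open>T\<close> itself lie above any given level. Dominance makes the totals over all
  columns compare the other way, hence there is equality in every column: its entries have under
  \<open>s\<close> the same rows as under \<open>T\<close>, permuted within the column.
\<close>

lemma admissible_tabloid:
  assumes s: "s \<in> tabloids n v" and dom: "\<And>k. (\<Sum>i<k. l i) \<le> (\<Sum>i<k. v i)"
    and adm: "\<And>k m. k \<in> {1..n} \<Longrightarrow> m \<in> {1..n} \<Longrightarrow> k \<noteq> m \<Longrightarrow> snd (T k) = snd (T m) \<Longrightarrow> s k \<noteq> s m"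
  obtains q where "q \<in> C" "s = fst \<circ> T \<circ> q" "v = l"
proof -
  let ?N = "{1..n}"
  have count_rows: "card {k\<in>?N. r k < m} = (\<Sum>i<m. w i)" if r: "r \<in> tabloids n w" for r w m
  proof -
    have "card {k\<in>?N. r k < m} = (\<Sum>i<m. card {k\<in>{k\<in>?N. r k < m}. r k = i})"
      by (rule card_eq_sum_fibres) auto
    also have "\<dots> = (\<Sum>i<m. card {k\<in>?N. r k = i})"
      by (intro sum.cong refl arg_cong[of _ _ card]) auto
    finally show ?thesis using r by (simp add: tabloids_def fillings_def)
  qed
  define A where "A r m j = {k\<in>?N. r k < m \<and> snd (T k) = j}" for r :: "nat \<Rightarrow> nat" and m j
  define J where "J = (\<lambda>k. snd (T k)) ` ?N"
  have split: "card {k\<in>?N. r k < m} = (\<Sum>j\<in>J. card (A r m j))" for r m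
  proof -
    have "card {k\<in>?N. r k < m} = (\<Sum>j\<in>J. card {k\<in>{k\<in>?N. r k < m}. snd (T k) = j})"
      by (rule card_eq_sum_fibres) (auto simp: J_def)
    then show ?thesis by (simp add: A_def conj_assoc)
  qed
  have own: "card (A (fst \<circ> T) m j) = card {i. i < m \<and> j < l i}" for m j
  proof -
    have "inj_on (fst \<circ> T) (A (fst \<circ> T) m j)"
      using T_inj by (auto simp: inj_on_def A_def prod_eq_iff simp del: atLeastAtMost_iff)
    moreover have "(fst \<circ> T) ` A (fst \<circ> T) m j = {i. i < m \<and> j < l i}"
    proof (intro equalityI subsetI)
      fix i assume "i \<in> (fst \<circ> T) ` A (fst \<circ> T) m j"
      then show "i \<in> {i. i < m \<and> j < l i}" using T_cell by (auto simp: A_def simp del: atLeastAtMost_iff)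
    next
      fix i assume i: "i \<in> {i. i < m \<and> j < l i}"
      then have "(i, j) \<in> T ` ?N" using T_bij by (simp add: bij_betw_def)
      then obtain k where k: "k \<in> ?N" "T k = (i, j)" by force
      then show "i \<in> (fst \<circ> T) ` A (fst \<circ> T) m j"
        using i by (intro image_eqI[of _ _ k]) (auto simp: A_def)
    qed
    ultimately show ?thesis by (metis card_image)
  qed
  have le: "card (A s m j) \<le> card (A (fst \<circ> T) m j)" for m j
  proof (cases "\<forall>i<m. j < l i")
    case True
    have "inj_on s (A s m j)" by (rule inj_onI) (use adm in \<open>auto simp: A_def\<close>)
    then have "card (A s m j) = card (s ` A s m j)" by (simp add: card_image)
    also have "\<dots> \<le> card {..<m}" by (rule card_mono) (auto simp: A_def)
    also have "{..<m} = {i. i < m \<and> j < l i}" using True by auto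
    finally show ?thesis by (simp add: own)
  next
    case False
    then obtain i where i: "i < m" "l i \<le> j" by (auto simp: not_less)
    have "A s m j \<subseteq> A (fst \<circ> T) m j"
    proof
      fix k assume k: "k \<in> A s m j"
      have "fst (T k) < i"
      proof (rule ccontr)
        assume "\<not> fst (T k) < i"
        then have "l (fst (T k)) \<le> l i" by (intro l_antimono) simp
        then show False using T_cell[of k] k i by (auto simp: A_def)
      qed
      then show "k \<in> A (fst \<circ> T) m j" using k i by (auto simp: A_def)
    qed
    then show ?thesis by (rule card_mono[rotated]) (simp add: A_def)
  qed
  have eq: "card (A s m j) = card (A (fst \<circ> T) m j)" if j: "j \<in> J" for m j
  proof -
    have "(\<Sum>j\<in>J. card (A (fst \<circ> T) m j)) \<le> (\<Sum>j\<in>J. card (A s m j))"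
      unfolding split[symmetric] count_rows[OF s] count_rows[OF row_tabloid] by (rule dom)
    moreover have "(\<Sum>j\<in>J. card (A s m j)) \<le> (\<Sum>j\<in>J. card (A (fst \<circ> T) m j))"
      by (rule sum_mono) (rule le)
    ultimately have "(\<Sum>j\<in>J. card (A s m j)) = (\<Sum>j\<in>J. card (A (fst \<circ> T) m j))" by simp
    then show ?thesis by (rule sum_mono_inv) (use j le in \<open>auto simp: J_def\<close>)
  qed
  have cell: "snd (T k) < l (s k)" if k: "k \<in> ?N" for k
  proof (rule ccontr)
    define j where "j = snd (T k)"
    assume "\<not> snd (T k) < l (s k)"
    then have lk: "l (s k) \<le> j" by (simp add: j_def)
    have jJ: "j \<in> J" using k by (auto simp: J_def j_def)
    have "A (fst \<circ> T) (s k) j = A (fst \<circ> T) (Suc (s k)) j"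
    proof -
      have "fst (T k') \<noteq> s k" if "k' \<in> ?N" "snd (T k') = j" for k'
        using T_cell[OF that(1)] that(2) lk by auto
      then show ?thesis by (auto simp: A_def less_Suc_eq simp del: atLeastAtMost_iff)
    qed
    then have "card (A s (s k) j) = card (A s (Suc (s k)) j)" using eq[OF jJ] by simp
    moreover have "A s (s k) j \<subset> A s (Suc (s k)) j" using k by (auto simp: A_def j_def)
    then have "card (A s (s k) j) < card (A s (Suc (s k)) j)"
      by (rule psubset_card_mono[rotated]) (simp add: A_def)
    ultimately show False by simp
  qed
  define q where "q k = (if k \<in> ?N then inv_into ?N T (s k, snd (T k)) else k)" for k
  have q: "q k \<in> ?N" "T (q k) = (s k, snd (T k))" if k: "k \<in> ?N" for k
  proof -
    have "(s k, snd (T k)) \<in> T ` ?N" using T_bij cell[OF k] by (simp add: bij_betw_def)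
    then show "q k \<in> ?N" "T (q k) = (s k, snd (T k))"
      using k by (auto simp: q_def inv_into_into f_inv_into_f simp del: atLeastAtMost_iff)
  qed
  have "q permutes ?N"
  proof (rule inj_imp_permutes)
    show "inj_on q ?N"
    proof (rule inj_onI)
      fix k m assume "k \<in> ?N" "m \<in> ?N" "q k = q m"
      then show "k = m" using q(2)[of k] q(2)[of m] adm[of k m] by auto
    qed
  qed (use q(1) in \<open>auto simp: q_def\<close>)
  then have "q \<in> C" using q(2) by (intro C_I) auto
  moreover have sq: "s = fst \<circ> T \<circ> q"
  proof
    fix k show "s k = (fst \<circ> T \<circ> q) k"
    proof (cases "k \<in> ?N")
      case True then show ?thesis using q(2) by simp
    next
      case False
      then show ?thesis using s T_outside[OF False] by (auto simp: tabloids_def fillings_def q_def)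
    qed
  qed
  moreover have "v = l"
  proof
    fix i
    have "s \<in> tabloids n l" unfolding sq
      using fillings_comp[OF \<open>q permutes ?N\<close>] row_tabloid by (simp add: tabloids_def)
    then show "v i = l i" using s by (simp add: tabloids_def fillings_def)
  qed
  ultimately show ?thesis using that by blast
qed

lemma antisymmetrizer_supported:
  assumes "f \<in> supported (tabloids n v)"
  shows "\<kappa> f \<in> supported (tabloids n v)"
proof -
  have "f (s \<circ> q) = 0" if s: "s \<notin> tabloids n v" and q: "q \<in> C" for s q
  proof -
    have "s \<circ> q \<notin> tabloids n v"
    proof
      assume "s \<circ> q \<in> tabloids n v"
      then have "s \<circ> q \<circ> inv' q \<in> tabloids n v"
        unfolding tabloids_def by (rule fillings_comp[OF C_permutes[OF C_inv[OF q]]])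
      then show False using s C_inv_o[OF q] by (simp add: comp_assoc)
    qed
    then show ?thesis using assms by (simp add: supported_def)
  qed
  then show ?thesis by (simp add: supported_def antisymmetrizer_def)
qed

text \<open>
  The antisymmetrized function is supported on tabloids as in \<open>admissible_tabloid\<close>. On these it is
  determined, up to the sign of a column permutation, by its value at the tabloid of \<open>T\<close>, and so is the
  polytabloid, whose value there is 1.
\<close>

lemma antisymmetrizer_multiple:
  assumes f: "f \<in> supported (tabloids n v)" and dom: "\<And>k. (\<Sum>i<k. l i) \<le> (\<Sum>i<k. v i)"
  shows "\<exists>c. (v \<noteq> l \<longrightarrow> c = 0) \<and> \<kappa> f = cscale c e"
proof -
  have adm: "\<exists>q\<in>C. s = fst \<circ> T \<circ> q \<and> v = l" if "\<kappa> f s \<noteq> 0" for s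
  proof -
    have s: "s \<in> tabloids n v" using antisymmetrizer_supported[OF f] that by (auto simp: supported_def)
    show ?thesis by (rule admissible_tabloid[OF s dom]) (use that antisymmetrizer_eq_0 in blast)+
  qed
  show ?thesis
  proof (cases "v = l")
    case True
    have "\<kappa> f s = \<kappa> f (fst \<circ> T) * e s" for s
    proof (cases "\<exists>q\<in>C. s = fst \<circ> T \<circ> q")
      case True
      then obtain q where q: "q \<in> C" "s = fst \<circ> T \<circ> q" by blast
      have "e s = of_int (sign q) * e (fst \<circ> T)"
        unfolding q(2) polytabloid_eq by (rule antisymmetrizer_translate[OF q(1)])
      then show ?thesis using antisymmetrizer_translate[OF q(1), of f "fst \<circ> T"] q(2) polytabloid_leading by simp
    next
      case False
      have "e s = 0"
        unfolding polytabloid_eq antisymmetrizer_def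
      proof (rule sum.neutral, intro ballI)
        fix q assume q: "q \<in> C"
        have "s \<circ> q \<noteq> fst \<circ> T"
        proof
          assume "s \<circ> q = fst \<circ> T"
          then have "s = fst \<circ> T \<circ> inv' q" using C_inv_o[OF q] by (metis comp_assoc comp_id)
          then show False using False C_inv[OF q] by blast
        qed
        then show "of_int (sign q) * point_mass (fst \<circ> T) (s \<circ> q) = 0" by (simp add: point_mass_def)
      qed
      then show ?thesis using adm[of s] False by auto
    qed
    then have "\<kappa> f = cscale (\<kappa> f (fst \<circ> T)) e" unfolding cscale_def by (rule ext)
    then show ?thesis using True by blast
  next
    case False
    then have "\<kappa> f s = 0" for s using adm[of s] by blast
    then have "\<kappa> f = cscale 0 e" by (simp add: cscale_def fun_eq_iff)
    then show ?thesis by blast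
  qed
qed

lemma antisymmetrizer_polytabloid: "\<kappa> e = cscale (of_nat (card C)) e"
proof
  fix s
  have "\<kappa> e s = (\<Sum>q\<in>C. of_int (sign q * sign q) * e s)"
    unfolding antisymmetrizer_def[of n T e]
    by (rule sum.cong) (simp_all add: polytabloid_eq antisymmetrizer_translate)
  then show "\<kappa> e s = cscale (of_nat (card C)) e s" by (simp add: cscale_def)
qed

lemma card_C: "of_nat (card C) \<noteq> (0 :: complex)"
  using C_finite C_id by (auto simp: card_eq_0_iff)

lemma antisymmetrizer_lincomb:
  "\<kappa> f = (\<lambda>s. \<Sum>q\<in>C. of_int (sign q) * pull place q f s)"
  by (simp add: antisymmetrizer_def pull_def)

lemma C_carrier: "q \<in> C \<Longrightarrow> q \<in> carrier (sym_group n)"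
  by (simp add: column_stabilizer_def)

lemma antisymmetrizer_mem:
  assumes "subrep (sym_group n) (pull place) U" "f \<in> U"
  shows "\<kappa> f \<in> U"
  unfolding antisymmetrizer_lincomb
  by (intro subspace_lincomb subspace_pull[OF assms(1)] subrep_pull[OF assms(1)] C_carrier assms(2))

lemma hom_antisymmetrizer:
  assumes U: "subrep (sym_group n) (pull place) U" and f: "f \<in> U"
    and hom: "is_hom (sym_group n) place U place W \<phi>"
  shows "\<phi> (\<kappa> f) = \<kappa> (\<phi> f)"
proof -
  have "\<phi> (\<kappa> f) = (\<lambda>s. \<Sum>q\<in>C. of_int (sign q) * \<phi> (pull place q f) s)"
    unfolding antisymmetrizer_lincomb
    by (rule is_hom_lincomb[OF hom subspace_pull[OF U]]) (intro subrep_pull[OF U] C_carrier f)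
  also have "\<dots> = \<kappa> (\<phi> f)"
    unfolding antisymmetrizer_lincomb using is_homD(4)[OF hom C_carrier f] by simp
  finally show ?thesis .
qed

text \<open>
  The antisymmetrizer is self-adjoint, and the polytabloid is its value at an indicator function.
\<close>

lemma inner_polytabloid:
  assumes u: "u \<in> supported (tabloids n l)"
  shows "(\<Sum>s\<in>tabloids n l. u s * e s) = \<kappa> u (fst \<circ> T)"
proof -
  have "(\<Sum>s\<in>tabloids n l. u s * e s) = (\<Sum>q\<in>C. \<Sum>s\<in>tabloids n l. of_int (sign q) * (u s * of_bool (s \<circ> q = fst \<circ> T)))"
    unfolding polytabloid_eq antisymmetrizer_def sum_distrib_left point_mass_def
    by (subst sum.swap) (simp add: algebra_simps)
  also have "\<dots> = (\<Sum>q\<in>C. of_int (sign q) * u (fst \<circ> T \<circ> inv' q))"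
  proof (rule sum.cong[OF refl])
    fix q assume q: "q \<in> C"
    have iff: "s \<circ> q = fst \<circ> T \<longleftrightarrow> s = fst \<circ> T \<circ> inv' q" for s
      using C_inv_o[OF q] by (metis comp_assoc comp_id)
    have mem: "fst \<circ> T \<circ> inv' q \<in> tabloids n l"
      using fillings_comp[OF C_permutes[OF C_inv[OF q]]] row_tabloid by (simp add: tabloids_def)
    have "(\<Sum>s\<in>tabloids n l. of_int (sign q) * (u s * of_bool (s \<circ> q = fst \<circ> T)))
       = (\<Sum>s\<in>tabloids n l. if s = fst \<circ> T \<circ> inv' q then of_int (sign q) * u s else 0)"
      unfolding iff by (rule sum.cong) auto
    also have "\<dots> = of_int (sign q) * u (fst \<circ> T \<circ> inv' q)"
      using mem finite_fillings[of _ n l] by (simp add: tabloids_def)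
    finally show "(\<Sum>s\<in>tabloids n l. of_int (sign q) * (u s * of_bool (s \<circ> q = fst \<circ> T)))
       = of_int (sign q) * u (fst \<circ> T \<circ> inv' q)" .
  qed
  also have "\<dots> = \<kappa> u (fst \<circ> T)"
    unfolding antisymmetrizer_def
  proof (rule sum.reindex_bij_witness[of _ inv' inv'])
    fix q assume q: "q \<in> C"
    show "inv' (inv' q) = q" by (rule permutes_inv_inv[OF C_permutes[OF q]])
    then show "inv' (inv' q) = q" .
    show "inv' q \<in> C" by (rule C_inv[OF q])
    then show "inv' q \<in> C" .
    show "of_int (sign (inv' q)) * u (fst \<circ> T \<circ> inv' q) = of_int (sign q) * u (fst \<circ> T \<circ> inv' q)"
      using C_permutes[OF q] by (subst sign_inverse) (auto intro: permutes_imp_permutation[rotated])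
  qed
  finally show ?thesis .
qed

end

lemma carrier_sym_group: "carrier (sym_group n) = {g. g permutes {1..n}}"
  by (auto simp: sym_group_carrier)

lemma tableaux_exist:
  assumes "is_partition l"
  shows "tableaux l \<noteq> {}"
proof -
  have fin: "finite {i. l i \<noteq> 0}" using assms by (simp add: is_partition_def)
  have eq: "young_diagram l = Sigma {i. l i \<noteq> 0} (\<lambda>i. {..<l i})" by (auto simp: young_diagram_def)
  have "card (young_diagram l) = psize l" unfolding eq psize_def using fin by (simp add: card_SigmaI)
  moreover have "finite (young_diagram l)" unfolding eq using fin by auto
  ultimately obtain h where h: "bij_betw h {1..psize l} (young_diagram l)"
    using finite_same_card_bij[of "{1..psize l}" "young_diagram l"] by auto
  have "bij_betw (restrict h {1..psize l}) {1..psize l} (young_diagram l)"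
    using h by (subst bij_betw_restrict_eq)
  then have "restrict h {1..psize l} \<in> tableaux l" by (simp add: tableaux_def)
  then show ?thesis by blast
qed

lemma tableaux_comp:
  assumes g: "g permutes {1..psize l}" and T: "T \<in> tableaux l"
  shows "T \<circ> g \<in> tableaux l"
proof -
  have "bij_betw (T \<circ> g) {1..psize l} (young_diagram l)"
    using T unfolding tableaux_def by (blast intro: bij_betw_trans[OF permutes_imp_bij[OF g]])
  moreover have "T (g k) = undefined" if "k \<notin> {1..psize l}" for k
    using permutes_not_in[OF g that] T that by (simp add: tableaux_def extensional_def)
  ultimately show ?thesis by (auto simp: tableaux_def extensional_def)
qed

lemma tableaux_transitive:
  assumes S: "S \<in> tableaux l" and T: "T \<in> tableaux l"
  obtains g where "g permutes {1..psize l}" "S = T \<circ> g"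
proof -
  let ?N = "{1..psize l}"
  have bS: "bij_betw S ?N (young_diagram l)" and bT: "bij_betw T ?N (young_diagram l)"
    using S T by (auto simp: tableaux_def)
  define h where "h = inv_into ?N T \<circ> S"
  have h: "bij_betw h ?N ?N" unfolding h_def
    by (rule bij_betw_trans[OF bS bij_betw_inv_into[OF bT]])
  define g where "g k = (if k \<in> ?N then h k else k)" for k
  have "bij_betw g ?N ?N \<longleftrightarrow> bij_betw h ?N ?N" by (rule bij_betw_cong) (simp only: g_def if_True)
  then have "bij_betw g ?N ?N" using h by blast
  then have "g permutes ?N" by (rule bij_imp_permutes) (simp only: g_def if_False)
  moreover have "S k = T (g k)" for k
  proof (cases "k \<in> ?N")
    case True
    then have "S k \<in> T ` ?N" using bS bT by (auto simp: bij_betw_def)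
    then show ?thesis using True by (simp add: g_def h_def f_inv_into_f)
  next
    case False
    then show ?thesis using S T by (auto simp: tableaux_def extensional_def g_def)
  qed
  then have "S = T \<circ> g" by (simp add: fun_eq_iff)
  ultimately show ?thesis using that by blast
qed

context tableau
begin

lemma pull_polytabloid:
  assumes g: "g permutes {1..n}"
  shows "pull place g e = polytabloid n (T \<circ> inv' g)"
proof -
  have ig: "inv' g permutes {1..n}" by (rule permutes_inv[OF g])
  have "T \<circ> inv' g \<in> tableaux l" using tableaux_comp ig T by (simp add: n)
  then interpret T': tableau l n "T \<circ> inv' g" by unfold_locales (use part n in auto)
  have gi: "g \<circ> inv' g = id" "inv' g \<circ> g = id" using permutes_inv_o[OF g] by auto
  have conj: "g \<circ> q \<circ> inv' g \<in> T'.C" if q: "q \<in> C" for q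
  proof (rule T'.C_I)
    show "g \<circ> q \<circ> inv' g permutes {1..n}"
      using permutes_compose[OF ig permutes_compose[OF C_permutes[OF q] g]] .
    fix k assume "k \<in> {1..n}"
    then have "inv' g k \<in> {1..n}" using permutes_in_image[OF ig] by blast
    then show "snd ((T \<circ> inv' g) ((g \<circ> q \<circ> inv' g) k)) = snd ((T \<circ> inv' g) k)"
      using C_column[OF q] permutes_inverses[OF g] by simp
  qed
  have conj': "inv' g \<circ> q \<circ> g \<in> C" if q: "q \<in> T'.C" for q
  proof (rule C_I)
    show "inv' g \<circ> q \<circ> g permutes {1..n}"
      using permutes_compose[OF g permutes_compose[OF T'.C_permutes[OF q] ig]] .
    fix k assume "k \<in> {1..n}"
    then have "g k \<in> {1..n}" using permutes_in_image[OF g] by blast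
    then show "snd (T ((inv' g \<circ> q \<circ> g) k)) = snd (T k)"
      using T'.C_column[OF q, of "g k"] permutes_inverses[OF g] by simp
  qed
  have sgn: "sign (g \<circ> q \<circ> inv' g) = sign q" if q: "q \<in> C" for q
  proof -
    have "permutation g" "permutation q" "permutation (inv' g)"
      using g ig C_permutes[OF q] by (auto intro: permutes_imp_permutation[rotated])
    then show ?thesis by (simp add: sign_compose permutation_compose sign_inverse)
  qed
  show ?thesis
  proof
    fix s
    have "pull place g e s = (\<Sum>q\<in>C. of_int (sign q) * point_mass (fst \<circ> T) (s \<circ> g \<circ> q))"
      by (simp add: pull_def polytabloid_eq antisymmetrizer_def)
    also have "\<dots> = (\<Sum>q\<in>T'.C. of_int (sign q) * point_mass (fst \<circ> (T \<circ> inv' g)) (s \<circ> q))"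
    proof (rule sum.reindex_bij_witness[of _ "\<lambda>q. inv' g \<circ> q \<circ> g" "\<lambda>q. g \<circ> q \<circ> inv' g"])
      fix q assume q: "q \<in> C"
      show "inv' g \<circ> (g \<circ> q \<circ> inv' g) \<circ> g = q"
        using gi by (simp add: fun_eq_iff)
      show "g \<circ> q \<circ> inv' g \<in> T'.C" by (rule conj[OF q])
      have "s \<circ> (g \<circ> q \<circ> inv' g) = fst \<circ> (T \<circ> inv' g) \<longleftrightarrow> s \<circ> g \<circ> q = fst \<circ> T"
      proof
        assume "s \<circ> (g \<circ> q \<circ> inv' g) = fst \<circ> (T \<circ> inv' g)"
        then have "s \<circ> (g \<circ> q \<circ> inv' g) \<circ> g = fst \<circ> (T \<circ> inv' g) \<circ> g" by simp
        then show "s \<circ> g \<circ> q = fst \<circ> T" using gi by (simp add: comp_assoc)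
      next
        assume "s \<circ> g \<circ> q = fst \<circ> T"
        then have "s \<circ> g \<circ> q \<circ> inv' g = fst \<circ> T \<circ> inv' g" by simp
        then show "s \<circ> (g \<circ> q \<circ> inv' g) = fst \<circ> (T \<circ> inv' g)" by (simp add: comp_assoc)
      qed
      then show "of_int (sign (g \<circ> q \<circ> inv' g)) * point_mass (fst \<circ> (T \<circ> inv' g)) (s \<circ> (g \<circ> q \<circ> inv' g))
          = of_int (sign q) * point_mass (fst \<circ> T) (s \<circ> g \<circ> q)"
        unfolding sgn[OF q] point_mass_def by simp
    next
      fix q assume q: "q \<in> T'.C"
      show "g \<circ> (inv' g \<circ> q \<circ> g) \<circ> inv' g = q"
        using gi by (simp add: fun_eq_iff)
      show "inv' g \<circ> q \<circ> g \<in> C" by (rule conj'[OF q])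
    qed
    finally show "pull place g e s = polytabloid n (T \<circ> inv' g) s"
      by (simp add: polytabloid_eq antisymmetrizer_def)
  qed
qed

lemma polytabloid_specht: "e \<in> specht l"
  unfolding specht_def n[symmetric] by (rule cfun.span_base) (use T in auto)

lemma polytabloid_supported: "e \<in> supported (tabloids n l)"
proof -
  have "point_mass (fst \<circ> T) \<in> supported (tabloids n l)"
    using row_tabloid by (auto simp: supported_def point_mass_def)
  then show ?thesis unfolding polytabloid_eq by (rule antisymmetrizer_supported)
qed

text \<open>
  The symmetric group permutes the tableaux transitively, hence also their polytabloids.
\<close>

lemma polytabloid_generates:
  assumes U: "subrep (sym_group n) (pull place) U" and e: "e \<in> U"
  shows "specht l \<subseteq> U"
  unfolding specht_def
proof (rule cfun.span_minimal)
  show "polytabloid (psize l) ` tableaux l \<subseteq> U"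
  proof (rule image_subsetI)
    fix S assume "S \<in> tableaux l"
    then obtain g where g: "g permutes {1..psize l}" "S = T \<circ> g" using tableaux_transitive T by metis
    have ig: "inv' g permutes {1..n}" using permutes_inv[OF g(1)] by (simp add: n)
    have "polytabloid (psize l) S = pull place (inv' g) e"
      using pull_polytabloid[OF ig] permutes_inv_inv[OF g(1)] g(2) by (simp add: n)
    then show "polytabloid (psize l) S \<in> U"
      using subrep_pull[OF U _ e] ig by (simp add: sym_group_carrier)
  qed
qed (rule subspace_pull[OF U])

lemma specht_subrep: "subrep (sym_group n) (pull place) (specht l)"
  unfolding specht_def
proof (rule subrep_span, elim imageE)
  fix g s S assume g: "g \<in> carrier (sym_group n)" and S: "S \<in> tableaux l" and s: "s = polytabloid (psize l) S"
  then interpret S: tableau l n S by unfold_locales (use part n in auto)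
  have gp: "g permutes {1..n}" using g by (simp add: sym_group_carrier)
  have "S \<circ> inv' g \<in> tableaux l" using tableaux_comp[OF _ S] permutes_inv[OF gp] by (simp add: n)
  then show "pull place g s \<in> cfun.span (polytabloid (psize l) ` tableaux l)"
    unfolding s n[symmetric] S.pull_polytabloid[OF gp] by (intro cfun.span_base) auto
qed

lemma specht_supported: "specht l \<subseteq> supported (tabloids n l)"
proof -
  interpret A: fin_action "sym_group n" place "tabloids n l" unfolding tabloids_def by (rule fin_action_fillings)
  show ?thesis
    by (rule polytabloid_generates[OF subrep_supported polytabloid_supported]) (rule A.fin_action_axioms)
qed

lemma specht_nonzero: "specht l \<noteq> {0}"
  using polytabloid_specht polytabloid_leading by (metis singletonD zero_fun_apply zero_neq_one)

text \<open>
  If some antisymmetrizer does not vanish on \<open>U\<close>, its values are multiples of a polytabloid, so \<open>U\<close>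
  contains a polytabloid and is everything. Otherwise \<open>U\<close> is orthogonal to all polytabloids, hence to
  itself.
\<close>

lemma specht_irrep: "irrep (sym_group n) (pull place) (specht l)"
  unfolding irrep_def
proof (intro conjI allI impI specht_subrep specht_nonzero)
  fix U assume U: "subrep (sym_group n) (pull place) U \<and> U \<subseteq> specht l"
  then have rU: "subrep (sym_group n) (pull place) U" and sub: "U \<subseteq> specht l" by auto
  have supp: "u \<in> supported (tabloids n l)" if "u \<in> U" for u using that sub specht_supported by blast
  show "U = {0} \<or> U = specht l"
  proof (cases "\<exists>S\<in>tableaux l. \<exists>u\<in>U. antisymmetrizer n S u \<noteq> 0")
    case True
    then obtain S u where S: "S \<in> tableaux l" and u: "u \<in> U" "antisymmetrizer n S u \<noteq> 0" by blast
    interpret S: tableau l n S by unfold_locales (use part n S in auto)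
    obtain c where c: "antisymmetrizer n S u = cscale c (polytabloid n S)"
      using S.antisymmetrizer_multiple[OF supp[OF u(1)]] by auto
    have "c \<noteq> 0" using u(2) unfolding c by (auto simp: cscale_def fun_eq_iff)
    have "cscale (1 / c) (antisymmetrizer n S u) \<in> U"
      by (intro cfun.subspace_scale subspace_pull[OF rU] S.antisymmetrizer_mem[OF rU] u(1))
    also have "cscale (1 / c) (antisymmetrizer n S u) = polytabloid n S"
      unfolding c using \<open>c \<noteq> 0\<close> by (simp add: cscale_def)
    finally have "specht l \<subseteq> U" by (rule S.polytabloid_generates[OF rU])
    then show ?thesis using sub by blast
  next
    case False
    have "u = 0" if u: "u \<in> U" for u
    proof -
      have "cfun.subspace {w. (\<Sum>s\<in>tabloids n l. u s * cnj (w s)) = 0}"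
        by (rule cfun.subspaceI)
           (simp_all add: cscale_def algebra_simps sum.distrib flip: sum_distrib_left)
      moreover have "polytabloid (psize l) ` tableaux l \<subseteq> {w. (\<Sum>s\<in>tabloids n l. u s * cnj (w s)) = 0}"
      proof (rule image_subsetI)
        fix S assume S: "S \<in> tableaux l"
        interpret S: tableau l n S by unfold_locales (use part n S in auto)
        have of_bool: "cnj (of_bool b) = of_bool b" for b by (cases b) auto
        have real: "cnj (polytabloid n S s) = polytabloid n S s" for s
          by (simp add: polytabloid_eq antisymmetrizer_def point_mass_def of_bool)
        have "(\<Sum>s\<in>tabloids n l. u s * polytabloid n S s) = antisymmetrizer n S u (fst \<circ> S)"
          by (rule S.inner_polytabloid[OF supp[OF u]])
        also have "\<dots> = 0" using False S u by auto
        finally show "polytabloid (psize l) S \<in> {w. (\<Sum>s\<in>tabloids n l. u s * cnj (w s)) = 0}"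
          using real by (simp add: n)
      qed
      ultimately have "specht l \<subseteq> {w. (\<Sum>s\<in>tabloids n l. u s * cnj (w s)) = 0}"
        unfolding specht_def by (intro cfun.span_minimal)
      then have "(\<Sum>s\<in>tabloids n l. u s * cnj (u s)) = 0" using u sub by blast
      then have "complex_of_real (\<Sum>s\<in>tabloids n l. (cmod (u s))\<^sup>2) = 0"
        unfolding of_real_sum complex_norm_square .
      then have "(\<Sum>s\<in>tabloids n l. (cmod (u s))\<^sup>2) = 0" by (simp only: of_real_eq_0_iff)
      then have "\<forall>s\<in>tabloids n l. (cmod (u s))\<^sup>2 = 0"
        by (subst (asm) sum_nonneg_eq_0_iff) (simp_all add: tabloids_def finite_fillings)
      then have "u s = 0" for s using supp[OF u] by (cases "s \<in> tabloids n l") (auto simp: supported_def)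
      then show ?thesis by (simp add: fun_eq_iff)
    qed
    then have "U = {0}" using cfun.subspace_0[OF subspace_pull[OF rU]] by blast
    then show ?thesis ..
  qed
qed

text \<open>
  A homomorphism commutes with the antisymmetrizer, which multiplies the polytabloid by the nonzero
  order of the column stabilizer; the image of the polytabloid is then a multiple of the polytabloid,
  and the polytabloid generates the module.
\<close>

lemma specht_hom:
  assumes hom: "is_hom (sym_group n) place (specht l) place W \<phi>" and W: "W \<subseteq> supported (tabloids n v)"
    and dom: "\<And>k. (\<Sum>i<k. l i) \<le> (\<Sum>i<k. v i)"
  shows "\<exists>c. (v \<noteq> l \<longrightarrow> c = 0) \<and> (\<forall>f\<in>specht l. \<phi> f = cscale c f)"
proof -
  note sS = subspace_pull[OF specht_subrep]
  note add = is_homD(2)[OF hom] and scale = is_homD(3)[OF hom] and eqv = is_homD(4)[OF hom]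
  have "\<phi> e \<in> supported (tabloids n v)" using is_homD(1)[OF hom polytabloid_specht] W by blast
  then obtain c where c: "v \<noteq> l \<Longrightarrow> c = 0" "\<kappa> (\<phi> e) = cscale c e"
    using antisymmetrizer_multiple[OF _ dom] by blast
  let ?k = "of_nat (card C) :: complex"
  have "cscale ?k (\<phi> e) = cscale c e"
    using hom_antisymmetrizer[OF specht_subrep polytabloid_specht hom] scale[OF polytabloid_specht, of ?k]
    unfolding antisymmetrizer_polytabloid c(2) by simp
  then have "cscale (1 / ?k) (cscale ?k (\<phi> e)) = cscale (1 / ?k) (cscale c e)" by simp
  then have \<phi>e: "\<phi> e = cscale (c / ?k) e" using card_C by (simp add: cscale_def)
  define U where "U = {f \<in> specht l. \<phi> f = cscale (c / ?k) f}"
  have "subrep (sym_group n) (pull place) U"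
    unfolding subrep_def
  proof (intro conjI ballI cfun.subspaceI)
    have "\<phi> (cscale 0 0) = cscale 0 (\<phi> 0)" by (rule scale[OF cfun.subspace_0[OF sS]])
    then show "0 \<in> U" using cfun.subspace_0[OF sS] by (simp add: U_def cscale_def zero_fun_def)
    show "x + y \<in> U" if "x \<in> U" "y \<in> U" for x y
      using that add[of x y] cfun.subspace_add[OF sS, of x y] unfolding U_def
      by (simp add: cfun.scale_right_distrib)
    show "cscale a x \<in> U" if "x \<in> U" for a x
      using that scale[of x a] cfun.subspace_scale[OF sS, of x a] unfolding U_def
      by (simp add: mult.commute)
    show "pull place g x \<in> U" if "g \<in> carrier (sym_group n)" "x \<in> U" for g x
      using that eqv[of g x] subrep_pull[OF specht_subrep, of g x] unfolding U_def
      by (simp add: pull_def cscale_def)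
  qed
  moreover have "e \<in> U" using \<phi>e polytabloid_specht by (simp add: U_def)
  ultimately have "specht l \<subseteq> U" by (rule polytabloid_generates)
  then have "\<forall>f\<in>specht l. \<phi> f = cscale (c / ?k) f" by (auto simp: U_def)
  then show ?thesis using c(1) by (intro exI[of _ "c / ?k"]) simp
qed

lemma specht_char_inner_perm:
  assumes P: "projector (tabloids n l) (specht l) P" "hermitian (tabloids n l) P"
    and dom: "\<And>k. (\<Sum>i<k. l i) \<le> (\<Sum>i<k. v i)"
  shows "(\<Sum>g | g permutes {1..n}. char_on (tabloids n l) place P (inv' g) * of_nat (perm_char n v g))
    = (if v = l then fact n else 0)"
proof -
  interpret X: fin_action "sym_group n" place "tabloids n l" unfolding tabloids_def by (rule fin_action_fillings)
  interpret Y: fin_action "sym_group n" place "tabloids n v" unfolding tabloids_def by (rule fin_action_fillings)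
  interpret two_actions "sym_group n" place "tabloids n l" place "tabloids n v" by unfold_locales
  have "(\<Sum>g | g permutes {1..n}. char_on (tabloids n l) place P (inv' g) * of_nat (perm_char n v g))
    = (\<Sum>g\<in>carrier (sym_group n). char_on (tabloids n l) place P (m_inv (sym_group n) g) * char_on (tabloids n v) place point_mass g)"
    by (rule sum.cong) (simp_all add: carrier_sym_group inv_sym_group tabloids_def char_on_point_mass)
  also have "\<dots> = (if v = l then fact n else 0)"
  proof (cases "v = l")
    case True
    have "(\<Sum>g\<in>carrier (sym_group n). char_on (tabloids n l) place P (m_inv (sym_group n) g) * char_on (tabloids n l) place point_mass g)
      = of_nat (card (carrier (sym_group n)))"
    proof (rule X.char_unit_norm[OF specht_subrep P specht_supported specht_nonzero])
      show "subrep (sym_group n) (pull place) (supported (tabloids n l))"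
        by (rule subrep_supported) (rule X.fin_action_axioms)
      show "projector (tabloids n l) (supported (tabloids n l)) point_mass" by (rule projector_point_mass[OF X.fin_X])
      show "hermitian (tabloids n l) point_mass" by (rule hermitian_point_mass)
      show "specht l \<subseteq> supported (tabloids n l)" by (rule specht_supported)
      fix \<phi> assume "is_hom (sym_group n) place (specht l) place (supported (tabloids n l)) \<phi>"
      from specht_hom[OF this order_refl] show "\<exists>c. \<forall>f\<in>specht l. \<phi> f = cscale c f" by blast
    qed
    then show ?thesis using True by (simp add: card_sym_group)
  next
    case False
    have "(\<Sum>g\<in>carrier (sym_group n). char_on (tabloids n l) place P (m_inv (sym_group n) g) * char_on (tabloids n v) place point_mass g) = 0"
    proof (rule char_orthogonal[OF _ _ P(1)])
      show "subrep (sym_group n) (pull place) (supported (tabloids n v))"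
        by (rule subrep_supported) (rule Y.fin_action_axioms)
      show "projector (tabloids n v) (supported (tabloids n v)) point_mass" by (rule projector_point_mass[OF Y.fin_X])
      fix \<phi> f assume "is_hom (sym_group n) place (specht l) place (supported (tabloids n v)) \<phi>" "f \<in> specht l"
      with specht_hom[OF this(1) order_refl dom] False show "\<phi> f = 0" by auto
    qed
    then show ?thesis using False by simp
  qed
  finally show ?thesis .
qed

lemma specht_char_norm:
  assumes P: "projector (tabloids n l) (specht l) P" "hermitian (tabloids n l) P"
  shows "(\<Sum>g | g permutes {1..n}. char_on (tabloids n l) place P (inv' g) * char_on (tabloids n l) place P g) = fact n"
proof -
  interpret X: fin_action "sym_group n" place "tabloids n l" unfolding tabloids_def by (rule fin_action_fillings)
  have "(\<Sum>g\<in>carrier (sym_group n). char_on (tabloids n l) place P (m_inv (sym_group n) g) * char_on (tabloids n l) place P g)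
      = of_nat (card (carrier (sym_group n)))"
  proof (rule X.char_unit_norm[OF specht_subrep P specht_supported specht_nonzero specht_subrep P order_refl])
    fix \<phi> assume "is_hom (sym_group n) place (specht l) place (specht l) \<phi>"
    from specht_hom[OF this specht_supported] show "\<exists>c. \<forall>f\<in>specht l. \<phi> f = cscale c f" by blast
  qed
  moreover have "(\<Sum>g | g permutes {1..n}. char_on (tabloids n l) place P (inv' g) * char_on (tabloids n l) place P g)
    = (\<Sum>g\<in>carrier (sym_group n). char_on (tabloids n l) place P (m_inv (sym_group n) g) * char_on (tabloids n l) place P g)"
    by (rule sum.cong) (simp_all add: inv_sym_group carrier_sym_group)
  ultimately show ?thesis by (simp add: card_sym_group)
qed

text \<open>
  Expanding the determinant, only its diagonal term has a nonzero inner product with the Specht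
  character \<open>\<chi>\<close>, since all other row lengths dominate \<open>l\<close> properly. So \<open>\<langle>\<chi>, \<omega>\<rangle> = 1\<close> for the
  determinant \<open>\<omega>\<close>; as \<open>\<langle>\<chi>, \<chi>\<rangle> = \<langle>\<omega>, \<omega>\<rangle> = 1\<close>, the difference \<open>\<chi> - \<omega>\<close> has norm 0.
\<close>

theorem specht_char_jacobi_trudi:
  assumes P: "projector (tabloids n l) (specht l) P" "hermitian (tabloids n l) P"
    and L: "0 < L" "\<And>i. L \<le> i \<Longrightarrow> l i = 0" and g: "g permutes {1..n}"
  shows "char_on (tabloids n l) place P g = of_int (jacobi_trudi n L (beta_seq l) g)"
proof -
  interpret X: fin_action "sym_group n" place "tabloids n l" unfolding tabloids_def by (rule fin_action_fillings)
  define \<chi> where "\<chi> = char_on (tabloids n l) place P"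
  define \<omega> where "\<omega> g = (of_int (jacobi_trudi n L (beta_seq l) g) :: complex)" for g
  let ?G = "{g. g permutes {1..n}}"
  have \<chi>_inv: "\<chi> (inv' g) = cnj (\<chi> g)" if "g \<in> ?G" for g
    unfolding \<chi>_def using X.char_on_inv[OF P(2), of g] that by (simp add: sym_group_carrier inv_sym_group)
  have row: "(\<Sum>g\<in>?G. \<chi> (inv' g) * of_int (row_char n L (\<lambda>i. beta_seq l i + int (\<sigma> i)) g))
    = (if \<sigma> = id then fact n else 0)" if \<sigma>: "\<sigma> permutes {..<L}" for \<sigma>
  proof -
    define b where "b i = beta_seq l i + int (\<sigma> i)" for i
    show ?thesis
    proof (cases "\<forall>i<L. 0 \<le> b i")
      case False
      then have "\<sigma> \<noteq> id" by (auto simp: b_def beta_seq_def)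
      then show ?thesis unfolding row_char_def b_def[symmetric] if_not_P[OF False] by simp
    next
      case True
      define v where "v i = (if i < L then nat (b i) else 0)" for i
      have vb: "int (v i) = b i" if "i < L" for i using True that by (simp add: v_def)
      have part_sum: "int (\<Sum>i<k. v i) = int (\<Sum>i<k. l i) + (\<Sum>i<k. int (\<sigma> i) - int i)" if "k \<le> L" for k
      proof -
        have "int (\<Sum>i<k. v i) = (\<Sum>i<k. b i)" unfolding of_nat_sum by (rule sum.cong) (use vb that in auto)
        then show ?thesis by (simp add: b_def beta_seq_def algebra_simps sum.distrib sum_subtractf)
      qed
      have dom: "(\<Sum>i<k. l i) \<le> (\<Sum>i<k. v i)" for k
      proof (cases "k \<le> L")
        case True
        then show ?thesis using part_sum[OF True] sum_displacement_nonneg[OF \<sigma>, of k] by linarith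
      next
        case False
        have "(\<Sum>i<k. v i) = (\<Sum>i<L. v i)"
          by (rule sum.mono_neutral_right) (use False in \<open>auto simp: v_def\<close>)
        moreover have "(\<Sum>i<k. l i) = (\<Sum>i<L. l i)"
          by (rule sum.mono_neutral_right) (use False L(2) in \<open>auto simp: not_less\<close>)
        ultimately show ?thesis using part_sum[OF order_refl] sum_displacement_zero[OF \<sigma>] by linarith
      qed
      have "v = l \<longleftrightarrow> \<sigma> = id"
      proof
        assume "v = l"
        show "\<sigma> = id"
        proof
          fix i show "\<sigma> i = id i"
            using vb[of i] \<open>v = l\<close> permutes_not_in[OF \<sigma>, of i]
            by (cases "i < L") (auto simp: b_def beta_seq_def)
        qed
      next
        assume "\<sigma> = id"
        then have "v i = l i" for i using vb[of i] L(2)[of i]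
          by (cases "i < L") (auto simp: b_def beta_seq_def v_def)
        then show "v = l" by auto
      qed
      then have iff: "(if v = l then fact n else 0) = (if \<sigma> = id then fact n else (0 :: complex))" by simp
      have v_eq: "(\<lambda>i. if i < L then nat (b i) else 0) = v" by (simp add: v_def fun_eq_iff)
      show ?thesis
        unfolding row_char_def b_def[symmetric] if_P[OF True] v_eq of_int_of_nat_eq \<chi>_def
        unfolding specht_char_inner_perm[OF P dom] by (rule iff)
    qed
  qed
  have cross: "(\<Sum>g\<in>?G. cnj (\<chi> g) * \<omega> g) = fact n"
  proof -
    have "(\<Sum>g\<in>?G. cnj (\<chi> g) * \<omega> g) = (\<Sum>g\<in>?G. \<Sum>\<sigma> | \<sigma> permutes {..<L}. of_int (sign \<sigma>) *
       (\<chi> (inv' g) * of_int (row_char n L (\<lambda>i. beta_seq l i + int (\<sigma> i)) g)))"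
      by (rule sum.cong[OF refl]) (simp add: \<omega>_def jacobi_trudi_def \<chi>_inv sum_distrib_left algebra_simps)
    also have "\<dots> = (\<Sum>\<sigma> | \<sigma> permutes {..<L}. of_int (sign \<sigma>) *
       (\<Sum>g\<in>?G. \<chi> (inv' g) * of_int (row_char n L (\<lambda>i. beta_seq l i + int (\<sigma> i)) g)))"
      unfolding sum_distrib_left by (rule sum.swap)
    also have "\<dots> = (\<Sum>\<sigma> | \<sigma> permutes {..<L}. if \<sigma> = id then fact n else 0)"
      by (rule sum.cong[OF refl]) (use row in \<open>auto simp del: One_nat_def\<close>)
    also have "\<dots> = fact n" by (simp add: finite_permutations permutes_id)
    finally show ?thesis .
  qed
  have norm: "(\<Sum>g\<in>?G. cnj (\<chi> g) * \<chi> g) = fact n"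
    unfolding specht_char_norm[OF P, symmetric] \<chi>_def[symmetric]
    by (rule sum.cong[OF refl]) (simp only: \<chi>_inv)
  have "(\<Sum>g\<in>?G. jacobi_trudi n L (beta_seq l) g * jacobi_trudi n L (beta_seq l) g) = fact n"
    using jacobi_trudi_orthonormal[OF part L(2) part L(2) n[symmetric] n[symmetric] L(1)] by simp
  then have "of_int (\<Sum>g\<in>?G. jacobi_trudi n L (beta_seq l) g * jacobi_trudi n L (beta_seq l) g) = (of_int (fact n) :: complex)"
    by (rule arg_cong)
  then have \<omega>\<omega>: "(\<Sum>g\<in>?G. \<omega> g * \<omega> g) = fact n" by (simp add: \<omega>_def)
  have cnj_\<omega>: "cnj (\<omega> g) = \<omega> g" for g by (simp add: \<omega>_def)
  have cross': "(\<Sum>g\<in>?G. \<omega> g * \<chi> g) = fact n"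
  proof -
    have "(\<Sum>g\<in>?G. \<omega> g * \<chi> g) = cnj (\<Sum>g\<in>?G. cnj (\<chi> g) * \<omega> g)"
      by (simp add: cnj_\<omega> mult.commute)
    then show ?thesis unfolding cross by simp
  qed
  have "(\<Sum>g\<in>?G. cnj (\<chi> g - \<omega> g) * (\<chi> g - \<omega> g)) = (\<Sum>g\<in>?G. cnj (\<chi> g) * \<chi> g) - (\<Sum>g\<in>?G. cnj (\<chi> g) * \<omega> g)
     - (\<Sum>g\<in>?G. \<omega> g * \<chi> g) + (\<Sum>g\<in>?G. \<omega> g * \<omega> g)"
    by (simp add: cnj_\<omega> algebra_simps sum.distrib sum_subtractf)
  also have "\<dots> = 0" unfolding norm cross cross' \<omega>\<omega> by simp
  finally have "complex_of_real (\<Sum>g\<in>?G. (cmod (\<chi> g - \<omega> g))\<^sup>2) = 0"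
    unfolding of_real_sum complex_norm_square by (simp add: mult.commute)
  then have "(\<Sum>g\<in>?G. (cmod (\<chi> g - \<omega> g))\<^sup>2) = 0" by (simp only: of_real_eq_0_iff)
  then have "\<forall>g\<in>?G. (cmod (\<chi> g - \<omega> g))\<^sup>2 = 0"
    by (subst (asm) sum_nonneg_eq_0_iff) (simp_all add: finite_permutations)
  then show ?thesis using g by (simp add: \<chi>_def \<omega>_def)
qed

end

section \<open>Kronecker coefficients as inner products of determinants\<close>

lemma char_on_tensor:
  "char_on (X \<times> Y) (\<lambda>g (s, t). (\<rho> g s, \<sigma> g t)) (\<lambda>(s, t) (s', t'). P s s' * Q t t') g
    = char_on X \<rho> P g * char_on Y \<sigma> Q g"
  unfolding char_on_def sum_product sum.cartesian_product by (rule sum.cong) auto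

lemma projector_tensor:
  assumes P: "projector X V P" and Q: "projector Y W Q"
  shows "projector (X \<times> Y) (tensor V W) (\<lambda>(s, t) (s', t'). P s s' * Q t t')" (is "projector _ _ ?R")
  unfolding projector_def
proof (intro conjI ballI allI)
  fix p assume "p \<in> X \<times> Y"
  then obtain s t where p: "p = (s, t)" "s \<in> X" "t \<in> Y" by auto
  show "?R p \<in> tensor V W"
    unfolding tensor_def p(1)
    by (rule cfun.span_base) (use projector_mem[OF P p(2)] projector_mem[OF Q p(3)] in auto)
next
  fix F p assume F: "F \<in> tensor V W"
  have "cfun.subspace {F. \<forall>p. F p = (\<Sum>x\<in>X \<times> Y. F x * ?R x p)}"
    by (rule cfun.subspaceI)
       (simp_all add: cscale_def algebra_simps sum.distrib flip: sum_distrib_left)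
  moreover have "{(\<lambda>(x, y). v x * w y) | v w. v \<in> V \<and> w \<in> W} \<subseteq> {F. \<forall>p. F p = (\<Sum>x\<in>X \<times> Y. F x * ?R x p)}"
  proof (intro subsetI)
    fix F assume "F \<in> {(\<lambda>(x, y). v x * w y) | v w. v \<in> V \<and> w \<in> W}"
    then obtain v w where F: "F = (\<lambda>(x, y). v x * w y)" and vw: "v \<in> V" "w \<in> W" by blast
    have "(\<Sum>x\<in>X \<times> Y. F x * ?R x (s, t)) = F (s, t)" for s t
    proof -
      have "(\<Sum>x\<in>X \<times> Y. F x * ?R x (s, t)) = (\<Sum>x\<in>X. \<Sum>y\<in>Y. (v x * P x s) * (w y * Q y t))"
        unfolding sum.cartesian_product by (rule sum.cong) (auto simp: F)
      also have "\<dots> = v s * w t"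
        unfolding sum_product[symmetric] projector_fix[OF P vw(1)] projector_fix[OF Q vw(2)] ..
      finally show ?thesis by (simp add: F)
    qed
    then show "F \<in> {F. \<forall>p. F p = (\<Sum>x\<in>X \<times> Y. F x * ?R x p)}" by auto
  qed
  ultimately have "tensor V W \<subseteq> {F. \<forall>p. F p = (\<Sum>x\<in>X \<times> Y. F x * ?R x p)}"
    unfolding tensor_def by (intro cfun.span_minimal)
  then show "F p = (\<Sum>x\<in>X \<times> Y. F x * ?R x p)" using F by blast
qed

lemma fin_action_times:
  assumes "fin_action G \<rho> X" "fin_action G \<sigma> Y"
  shows "fin_action G (\<lambda>g (s, t). (\<rho> g s, \<sigma> g t)) (X \<times> Y)"
proof -
  interpret A: fin_action G \<rho> X by fact
  interpret B: fin_action G \<sigma> Y by fact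
  show ?thesis
    by unfold_locales (auto simp: A.fin_G A.fin_X B.fin_X A.closed B.closed A.act_mult B.act_mult A.act_one B.act_one)
qed

lemma subrep_tensor:
  assumes V: "subrep G (pull \<rho>) V" and W: "subrep G (pull \<sigma>) W"
  shows "subrep G (pull (\<lambda>g (s, t). (\<rho> g s, \<sigma> g t))) (tensor V W)" (is "subrep G (pull ?\<tau>) _")
  unfolding tensor_def
proof (rule subrep_span)
  fix g F assume g: "g \<in> carrier G" and F: "F \<in> {(\<lambda>(x, y). v x * w y) | v w. v \<in> V \<and> w \<in> W}"
  then obtain v w where F: "F = (\<lambda>(x, y). v x * w y)" and vw: "v \<in> V" "w \<in> W" by blast
  have eq: "pull ?\<tau> g F = (\<lambda>(x, y). pull \<rho> g v x * pull \<sigma> g w y)"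
    by (simp add: F pull_def fun_eq_iff)
  show "pull ?\<tau> g F \<in> cfun.span {(\<lambda>(x, y). v x * w y) | v w. v \<in> V \<and> w \<in> W}"
    by (rule cfun.span_base, intro CollectI exI[of _ "pull \<rho> g v"] exI[of _ "pull \<sigma> g w"] conjI eq
        subrep_pull[OF V g vw(1)] subrep_pull[OF W g vw(2)])
qed

lemma tensor_supported:
  assumes "V \<subseteq> supported X" "W \<subseteq> supported Y"
  shows "tensor V W \<subseteq> supported (X \<times> Y)"
  unfolding tensor_def
  by (rule cfun.span_minimal[OF _ subspace_supported]) (use assms in \<open>force simp: supported_def\<close>)

theorem kronecker_eq:
  assumes p: "is_partition \<mu>" "is_partition \<nu>" "is_partition l"
    and n: "psize \<mu> = n" "psize \<nu> = n" "psize l = n"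
    and L: "0 < L" "\<And>i. L \<le> i \<Longrightarrow> \<mu> i = 0" "\<And>i. L \<le> i \<Longrightarrow> \<nu> i = 0" "\<And>i. L \<le> i \<Longrightarrow> l i = 0"
  shows "int (kronecker \<mu> \<nu> l) * fact n = (\<Sum>g | g permutes {1..n}. jacobi_trudi n L (beta_seq l) g *
    (jacobi_trudi n L (beta_seq \<mu>) g * jacobi_trudi n L (beta_seq \<nu>) g))"
proof -
  obtain T\<mu> T\<nu> Tl where T: "T\<mu> \<in> tableaux \<mu>" "T\<nu> \<in> tableaux \<nu>" "Tl \<in> tableaux l"
    using tableaux_exist[OF p(1)] tableaux_exist[OF p(2)] tableaux_exist[OF p(3)] by blast
  interpret M: tableau \<mu> n T\<mu> by unfold_locales (use p n T in auto)
  interpret N: tableau \<nu> n T\<nu> by unfold_locales (use p n T in auto)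
  interpret K: tableau l n Tl by unfold_locales (use p n T in auto)
  let ?X = "tabloids n l" and ?Y = "tabloids n \<mu> \<times> tabloids n \<nu>"
  let ?\<tau> = "\<lambda>g (s :: nat \<Rightarrow> nat, t :: nat \<Rightarrow> nat). (place g s, place g t)"
  have act: "fin_action (sym_group n) place (tabloids n v)" for v
    unfolding tabloids_def by (rule fin_action_fillings)
  have actY: "fin_action (sym_group n) ?\<tau> ?Y" by (rule fin_action_times[OF act act])
  interpret two_actions "sym_group n" place ?X ?\<tau> ?Y
    unfolding two_actions_def using act actY by blast
  have proj: "\<exists>P. projector (tabloids n v) (specht v) P \<and> hermitian (tabloids n v) P"
    if "subrep (sym_group n) (pull place) (specht v)" "specht v \<subseteq> supported (tabloids n v)" for v
    using hermitian_projector_exists[OF _ subspace_pull[OF that(1)] that(2)] finite_fillings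
    unfolding tabloids_def by metis
  obtain P where P: "projector (tabloids n \<mu>) (specht \<mu>) P" "hermitian (tabloids n \<mu>) P"
    using proj[OF M.specht_subrep M.specht_supported] by blast
  obtain Q where Q: "projector (tabloids n \<nu>) (specht \<nu>) Q" "hermitian (tabloids n \<nu>) Q"
    using proj[OF N.specht_subrep N.specht_supported] by blast
  obtain R where R: "projector ?X (specht l) R" "hermitian ?X R"
    using proj[OF K.specht_subrep K.specht_supported] by blast
  have ta: "tensor_act = pull ?\<tau>" by (simp add: fun_eq_iff tensor_act_def pull_def)
  have "of_nat (kronecker \<mu> \<nu> l) * of_nat (card (carrier (sym_group n)))
     = (\<Sum>g\<in>carrier (sym_group n). char_on ?X place R (m_inv (sym_group n) g) *
         char_on ?Y ?\<tau> (\<lambda>(s, t) (s', t'). P s s' * Q t t') g)"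
    unfolding kronecker_def n(3) act_eq_pull ta
  proof (rule irrep_mult_eq[OF K.specht_irrep K.specht_supported R])
    show "\<exists>c. \<forall>f\<in>specht l. \<phi> f = cscale c f" if "is_hom (sym_group n) place (specht l) place (specht l) \<phi>" for \<phi>
      using K.specht_hom[OF that K.specht_supported] by blast
    show "subrep (sym_group n) (pull ?\<tau>) (tensor (specht \<mu>) (specht \<nu>))"
      by (rule subrep_tensor[OF M.specht_subrep N.specht_subrep])
    show "tensor (specht \<mu>) (specht \<nu>) \<subseteq> supported ?Y"
      by (rule tensor_supported[OF M.specht_supported N.specht_supported])
    show "projector ?Y (tensor (specht \<mu>) (specht \<nu>)) (\<lambda>(s, t) (s', t'). P s s' * Q t t')"
      by (rule projector_tensor[OF P(1) Q(1)])
  qed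
  also have "\<dots> = (\<Sum>g | g permutes {1..n}. of_int (jacobi_trudi n L (beta_seq l) g *
    (jacobi_trudi n L (beta_seq \<mu>) g * jacobi_trudi n L (beta_seq \<nu>) g)))"
  proof (rule sum.cong)
    show "carrier (sym_group n) = {g. g permutes {1..n}}" by (simp add: sym_group_def)
    fix g assume "g \<in> {g. g permutes {1..n}}"
    then have g: "g permutes {1..n}" "g \<in> carrier (sym_group n)" by (simp_all add: sym_group_carrier)
    have 1: "char_on (tabloids n \<mu>) place P g = of_int (jacobi_trudi n L (beta_seq \<mu>) g)"
      by (rule M.specht_char_jacobi_trudi[OF P L(1,2) g(1)])
    have 2: "char_on (tabloids n \<nu>) place Q g = of_int (jacobi_trudi n L (beta_seq \<nu>) g)"
      by (rule N.specht_char_jacobi_trudi[OF Q L(1,3) g(1)])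
    have 3: "char_on ?X place R (m_inv (sym_group n) g) = of_int (jacobi_trudi n L (beta_seq l) g)"
      unfolding inv_sym_group[OF g(2)] jacobi_trudi_inv[OF g(1), symmetric]
      by (rule K.specht_char_jacobi_trudi[OF R L(1,4) permutes_inv[OF g(1)]])
    show "char_on ?X place R (m_inv (sym_group n) g) * char_on ?Y ?\<tau> (\<lambda>(s, t) (s', t'). P s s' * Q t t') g
      = of_int (jacobi_trudi n L (beta_seq l) g *
    (jacobi_trudi n L (beta_seq \<mu>) g * jacobi_trudi n L (beta_seq \<nu>) g))"
      unfolding char_on_tensor 1 2 3 by simp
  qed
  also have "\<dots> = of_int (\<Sum>g | g permutes {1..n}. jacobi_trudi n L (beta_seq l) g *
    (jacobi_trudi n L (beta_seq \<mu>) g * jacobi_trudi n L (beta_seq \<nu>) g))" by simp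
  finally have "complex_of_int (int (kronecker \<mu> \<nu> l) * fact n) = of_int (\<Sum>g | g permutes {1..n}. jacobi_trudi n L (beta_seq l) g *
    (jacobi_trudi n L (beta_seq \<mu>) g * jacobi_trudi n L (beta_seq \<nu>) g))"
    unfolding card_sym_group by simp
  then show ?thesis by (simp only: of_int_eq_iff)
qed

section \<open>Stable characters and their products\<close>

definition weight :: "('i \<Rightarrow> nat) \<Rightarrow> nat" where
  "weight Z = (\<Sum>i | Z i \<noteq> 0. Z i)"

lemma psize_weight: "psize p = weight p"
  by (simp add: psize_def weight_def)

lemma weight_eq_sum:
  assumes "finite I" "\<And>i. i \<notin> I \<Longrightarrow> Z i = 0"
  shows "weight Z = (\<Sum>i\<in>I. Z i)"
proof -
  have "i \<in> I" if "Z i \<noteq> 0" for i using assms(2)[of i] that by auto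
  then have "{i. Z i \<noteq> 0} \<subseteq> I" by blast
  then show ?thesis unfolding weight_def by (intro sum.mono_neutral_left) (use assms(1) in auto)
qed

text \<open>
  The permutation character of the shape \<open>Z[n]\<close>, as a function of \<open>n\<close> and the permutation, and 0 where
  \<open>Z[n]\<close> has a negative first part. The added part is indexed by \<open>None\<close>.
\<close>

definition stable_perm_char :: "('i \<Rightarrow> nat) \<Rightarrow> nat \<times> (nat \<Rightarrow> nat) \<Rightarrow> complex" where
  "stable_perm_char Z = (\<lambda>(n, g). if g permutes {1..n} \<and> weight Z \<le> n
     then of_nat (perm_char n (case_option (n - weight Z) Z) g) else 0)"

text \<open>
  The beta numbers of \<open>p[n]\<close>, with untruncated subtraction.
\<close>

definition pad_seq :: "(nat \<Rightarrow> nat) \<Rightarrow> nat \<Rightarrow> nat \<Rightarrow> int" where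
  "pad_seq p n i = (case i of 0 \<Rightarrow> int n - int (psize p) | Suc j \<Rightarrow> int (p j) - int (Suc j))"

text \<open>
  The functions \<open>X\<^sub>n(p)\<close> of Murnaghan's expansion, as functions of \<open>n\<close> and the permutation.
\<close>

definition stable_jt :: "nat \<Rightarrow> (nat \<Rightarrow> nat) \<Rightarrow> nat \<times> (nat \<Rightarrow> nat) \<Rightarrow> complex" where
  "stable_jt L p = (\<lambda>(n, g). if g permutes {1..n} then of_int (jacobi_trudi n L (pad_seq p n) g) else 0)"

definition small_partitions :: "nat \<Rightarrow> (nat \<Rightarrow> nat) set" where
  "small_partitions K = {p. is_partition p \<and> psize p \<le> K}"

lemma partition_zero:
  assumes "is_partition p" "psize p \<le> i"
  shows "p i = 0"
proof (rule ccontr)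
  assume "p i \<noteq> 0"
  have fin: "finite {k. p k \<noteq> 0}" using assms(1) by (simp add: is_partition_def)
  have pos: "p k \<noteq> 0" if "k \<le> i" for k
  proof -
    have "p i \<le> p k" using assms(1) that by (simp add: is_partition_def antimono_def)
    then show ?thesis using \<open>p i \<noteq> 0\<close> by simp
  qed
  have "Suc i = (\<Sum>k\<in>{..i}. 1)" by simp
  also have "\<dots> \<le> (\<Sum>k\<in>{..i}. p k)" by (rule sum_mono) (use pos in \<open>auto simp: Suc_le_eq\<close>)
  also have "\<dots> \<le> psize p" unfolding psize_def by (rule sum_mono2[OF fin]) (use pos in auto)
  finally show False using assms(2) by simp
qed

lemma finite_small_partitions: "finite (small_partitions K)"
proof (rule finite_bounded_functions[of "{..<K}" _ K])
  fix p x assume p: "p \<in> small_partitions K" and nz: "p x \<noteq> 0"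
  then have part: "is_partition p" "psize p \<le> K" by (auto simp: small_partitions_def)
  have "p x \<le> psize p" unfolding psize_def
    by (rule member_le_sum) (use nz part in \<open>auto simp: is_partition_def\<close>)
  moreover have "\<not> psize p \<le> x" using partition_zero[OF part(1), of x] nz by blast
  ultimately show "x \<in> {..<K} \<and> p x \<le> K" using part(2) by simp
qed simp

lemma stable_perm_char_relabel:
  assumes h: "bij_betw h {i. Z i \<noteq> 0} {j. Y j \<noteq> 0}" and eq: "\<And>i. Z i \<noteq> 0 \<Longrightarrow> Y (h i) = Z i"
  shows "weight Y = weight Z" "stable_perm_char Y = stable_perm_char Z" "(\<Sum>j | Y j \<noteq> 0. (Y j)\<^sup>2) = (\<Sum>i | Z i \<noteq> 0. (Z i)\<^sup>2)"
proof -
  show tot: "weight Y = weight Z"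
    unfolding weight_def by (rule sum.reindex_bij_betw[OF h, symmetric, THEN trans]) (use eq in auto)
  show "(\<Sum>j | Y j \<noteq> 0. (Y j)\<^sup>2) = (\<Sum>i | Z i \<noteq> 0. (Z i)\<^sup>2)"
    by (rule sum.reindex_bij_betw[OF h, symmetric, THEN trans]) (use eq in auto)
  have inj: "inj_on h {i. Z i \<noteq> 0}" and im: "h ` {i. Z i \<noteq> 0} = {j. Y j \<noteq> 0}" using h by (auto simp: bij_betw_def)
  have "perm_char n (case_option m Z) g = perm_char n (case_option m Y) g" if g: "g permutes {1..n}" for n m g
  proof (rule perm_char_relabel[OF g, where h = "map_option h"])
    show "inj_on (map_option h) {i. case_option m Z i \<noteq> 0}"
      using inj by (auto simp: inj_on_def split: option.splits)
    show "case_option m Y (map_option h i) = case_option m Z i" if "case_option m Z i \<noteq> 0" for i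
      using that eq by (cases i) auto
    show "j \<in> map_option h ` {i. case_option m Z i \<noteq> 0}" if "case_option m Y j \<noteq> 0" for j
    proof (cases j)
      case None
      then show ?thesis using that by (intro image_eqI[of _ _ None]) auto
    next
      case (Some k)
      then have "k \<in> h ` {i. Z i \<noteq> 0}" using im that by simp
      then obtain i where "Z i \<noteq> 0" "k = h i" by blast
      then show ?thesis using Some by (intro image_eqI[of _ _ "Some i"]) auto
    qed
  qed
  then show "stable_perm_char Y = stable_perm_char Z" by (auto simp: stable_perm_char_def tot fun_eq_iff)
qed

lemma sort_to_partition:
  fixes Z :: "'i \<Rightarrow> nat"
  assumes fin: "finite {i. Z i \<noteq> 0}"
  obtains u where "is_partition u" "psize u = weight Z" "stable_perm_char u = stable_perm_char Z"
    "(\<Sum>j | u j \<noteq> 0. (u j)\<^sup>2) = (\<Sum>i | Z i \<noteq> 0. (Z i)\<^sup>2)"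
proof -
  obtain xs0 where xs0: "set xs0 = {i. Z i \<noteq> 0}" "distinct xs0" using finite_distinct_list[OF fin] by blast
  define xs where "xs = rev (sort_key Z xs0)"
  have xs: "set xs = {i. Z i \<noteq> 0}" "distinct xs" using xs0 by (auto simp: xs_def)
  have sorted: "sorted_wrt (\<ge>) (map Z xs)"
  proof -
    have "sorted (map Z (sort_key Z xs0))" by simp
    then show ?thesis unfolding xs_def rev_map[symmetric] sorted_wrt_rev .
  qed
  define u where "u k = (if k < length xs then Z (xs ! k) else 0)" for k
  have nz: "u k \<noteq> 0 \<longleftrightarrow> k < length xs" for k
    using xs(1) nth_mem[of k xs] by (auto simp: u_def)
  have "antimono u"
  proof (rule antimonoI)
    fix i j :: nat assume "i \<le> j"
    show "u j \<le> u i"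
    proof (cases "i < j \<and> j < length xs")
      case True
      then show ?thesis using sorted by (auto simp: u_def sorted_wrt_iff_nth_less)
    next
      case False
      then show ?thesis using \<open>i \<le> j\<close> by (cases "i = j") (auto simp: u_def)
    qed
  qed
  then have "is_partition u" using nz by (simp add: is_partition_def)
  moreover have "bij_betw (\<lambda>k. xs ! k) {k. u k \<noteq> 0} {i. Z i \<noteq> 0}"
    by (rule bij_betw_nth) (use xs nz in auto)
  moreover have "Z (xs ! k) = u k" if "u k \<noteq> 0" for k using that nz by (simp add: u_def)
  ultimately show ?thesis
    using that stable_perm_char_relabel[of "\<lambda>k. xs ! k" u Z] by (metis psize_weight)
qed

text \<open>
  A term of the determinant for \<open>p[n]\<close> is again of the form \<open>w[n]\<close>, with \<open>w\<close> independent of \<open>n\<close> and of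
  size \<open>|p| - \<sigma> 0\<close>.
\<close>

lemma row_char_stable:
  assumes p: "\<And>i. K \<le> i \<Longrightarrow> p i = 0" and \<sigma>: "\<sigma> permutes {..<Suc K}" and g: "g permutes {1..n}"
    and w: "w = (\<lambda>i. int (p i) - int (Suc i) + int (\<sigma> (Suc i)))"
  shows "of_int (row_char n (Suc K) (\<lambda>i. pad_seq p n i + int (\<sigma> i)) g)
    = (if \<forall>i<K. 0 \<le> w i then stable_perm_char (\<lambda>i. if i < K then nat (w i) else 0) (n, g) else 0)"
    "(\<Sum>i<K. w i) = int (psize p) - int (\<sigma> 0)"
proof -
  have disp: "(\<Sum>i<Suc K. int (\<sigma> i) - int i) = 0" by (rule sum_displacement_zero[OF \<sigma>])
  then have disp': "int (\<sigma> 0) + (\<Sum>i<K. int (\<sigma> (Suc i)) - int (Suc i)) = 0"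
    unfolding sum.lessThan_Suc_shift by simp
  have "(\<Sum>i<K. w i) = int (\<Sum>i<K. p i) + (\<Sum>i<K. int (\<sigma> (Suc i)) - int (Suc i))"
    unfolding w of_nat_sum sum.distrib[symmetric] by (rule sum.cong) auto
  then show sw: "(\<Sum>i<K. w i) = int (psize p) - int (\<sigma> 0)"
    using disp' psize_eq_sum[of K p] p by simp
  define b where "b i = pad_seq p n i + int (\<sigma> i)" for i
  have b0: "b 0 = int n - (\<Sum>i<K. w i)" unfolding sw by (simp add: b_def pad_seq_def)
  have bS: "b (Suc i) = w i" for i by (simp add: b_def pad_seq_def w)
  have all: "(\<forall>i<Suc K. 0 \<le> b i) \<longleftrightarrow> (\<Sum>i<K. w i) \<le> int n \<and> (\<forall>i<K. 0 \<le> w i)"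
    unfolding All_less_Suc2 bS b0 by auto
  define v where "v i = (if i < K then nat (w i) else 0)" for i
  show "of_int (row_char n (Suc K) (\<lambda>i. pad_seq p n i + int (\<sigma> i)) g)
    = (if \<forall>i<K. 0 \<le> w i then stable_perm_char (\<lambda>i. if i < K then nat (w i) else 0) (n, g) else (0 :: complex))"
  proof (cases "\<forall>i<K. 0 \<le> w i")
    case False
    then have nb: "\<not> (\<forall>i<Suc K. 0 \<le> b i)" using all by blast
    show ?thesis unfolding row_char_def b_def[symmetric] if_not_P[OF nb] if_not_P[OF False] by simp
  next
    case True
    have "weight v = (\<Sum>i<K. v i)" by (rule weight_eq_sum) (auto simp: v_def)
    then have "int (weight v) = (\<Sum>i<K. int (v i))" by simp
    also have "\<dots> = (\<Sum>i<K. w i)" by (rule sum.cong) (use True in \<open>auto simp: v_def\<close>)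
    finally have tv: "int (weight v) = (\<Sum>i<K. w i)" .
    show ?thesis
    proof (cases "weight v \<le> n")
      case False
      then have nb: "\<not> (\<forall>i<Suc K. 0 \<le> b i)" using all tv by auto
      show ?thesis
        unfolding row_char_def b_def[symmetric] v_def[symmetric] if_not_P[OF nb] if_P[OF True]
        using False by (simp add: stable_perm_char_def)
    next
      case le: True
      then have bpos: "\<forall>i<Suc K. 0 \<le> b i" using all tv True by auto
      have "perm_char n (case_option (n - weight v) v) g = perm_char n (\<lambda>i. if i < Suc K then nat (b i) else 0) g"
      proof (rule perm_char_relabel[OF g, where h = "case_option 0 Suc"])
        show "inj_on (case_option 0 Suc) {i. case_option (n - weight v) v i \<noteq> 0}"
          by (auto simp: inj_on_def split: option.splits)
        have nb0: "nat (b 0) = n - weight v" unfolding b0 tv[symmetric] by simp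
        have nbS: "(if Suc i < Suc K then nat (b (Suc i)) else 0) = v i" for i by (simp add: bS v_def)
        show "(if case_option 0 Suc i < Suc K then nat (b (case_option 0 Suc i)) else 0) = case_option (n - weight v) v i" for i
          using nb0 nbS[of "the i"] by (cases i) auto
        show "j \<in> case_option 0 Suc ` {i. case_option (n - weight v) v i \<noteq> 0}"
          if "(if j < Suc K then nat (b j) else 0) \<noteq> 0" for j
        proof (cases j)
          case 0
          then show ?thesis using that nb0 by (intro image_eqI[of _ _ None]) auto
        next
          case (Suc i)
          then show ?thesis using that nbS[of i] by (intro image_eqI[of _ _ "Some i"]) auto
        qed
      qed
      then show ?thesis
        unfolding row_char_def b_def[symmetric] v_def[symmetric] if_P[OF bpos] if_P[OF True]
        using g le by (simp add: stable_perm_char_def)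
    qed
  qed
qed

text \<open>
  With \<open>d i = \<sigma> i - i\<close> the difference of the two sides is \<open>2 \<Sum> p i d i + \<Sum> (d i)\<^sup>2\<close>. The first sum is
  nonnegative by partial summation, as \<open>p\<close> decreases and the partial sums of \<open>d\<close> are nonnegative.
\<close>

lemma sum_square_increase:
  assumes p: "antimono p" and \<sigma>: "\<sigma> permutes {..<K}" "\<sigma> \<noteq> id"
  shows "(\<Sum>i<K. (int (p i))\<^sup>2) < (\<Sum>i<K. (int (p i) - int i + int (\<sigma> i))\<^sup>2)"
proof -
  define d where "d i = int (\<sigma> i) - int i" for i
  define S where "S m = (\<Sum>i<m. d i)" for m
  have S0: "0 \<le> S m" for m unfolding S_def d_def by (rule sum_displacement_nonneg[OF \<sigma>(1)])
  have "int (p m) * S m \<le> (\<Sum>i<m. int (p i) * d i)" for m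
  proof (induction m)
    case (Suc m)
    have "int (p (Suc m)) * S (Suc m) \<le> int (p m) * S (Suc m)"
      using p S0 by (intro mult_right_mono) (auto simp: antimono_def)
    also have "\<dots> = int (p m) * S m + int (p m) * d m" by (simp add: S_def algebra_simps)
    finally show ?case using Suc by simp
  qed (simp add: S_def)
  then have nonneg: "0 \<le> (\<Sum>i<K. int (p i) * d i)"
    using S0[of K] by (meson mult_nonneg_nonneg of_nat_0_le_iff order_trans)
  have "\<exists>i<K. \<sigma> i \<noteq> i"
  proof (rule ccontr)
    assume "\<not> (\<exists>i<K. \<sigma> i \<noteq> i)"
    then have "\<sigma> i = id i" for i using permutes_not_in[OF \<sigma>(1), of i] by (cases "i < K") auto
    then show False using \<sigma>(2) by auto
  qed
  then obtain i0 where i0: "i0 < K" "\<sigma> i0 \<noteq> i0" by blast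
  have "0 < (\<Sum>i<K. (d i)\<^sup>2)"
    by (rule sum_pos2[of _ i0]) (use i0 in \<open>auto simp: d_def\<close>)
  moreover have "(\<Sum>i<K. (int (p i) - int i + int (\<sigma> i))\<^sup>2)
     = (\<Sum>i<K. (int (p i))\<^sup>2) + 2 * (\<Sum>i<K. int (p i) * d i) + (\<Sum>i<K. (d i)\<^sup>2)"
    unfolding sum_distrib_left sum.distrib[symmetric]
    by (rule sum.cong) (auto simp: d_def power2_eq_square algebra_simps)
  ultimately show ?thesis using nonneg by linarith
qed

lemma sum_squares_le:
  fixes Z :: "'i \<Rightarrow> nat"
  assumes "finite {i. Z i \<noteq> 0}"
  shows "(\<Sum>i | Z i \<noteq> 0. (Z i)\<^sup>2) \<le> (weight Z)\<^sup>2"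
proof -
  have "(\<Sum>i | Z i \<noteq> 0. (Z i)\<^sup>2) \<le> (\<Sum>i | Z i \<noteq> 0. Z i * weight Z)"
  proof (rule sum_mono)
    fix i assume "i \<in> {i. Z i \<noteq> 0}"
    then have "Z i \<le> weight Z" unfolding weight_def using assms by (intro member_le_sum) auto
    then show "(Z i)\<^sup>2 \<le> Z i * weight Z" by (simp add: power2_eq_square)
  qed
  also have "\<dots> = (weight Z)\<^sup>2" by (simp add: weight_def sum_distrib_right[symmetric] power2_eq_square)
  finally show ?thesis .
qed

lemma shift_permutation:
  assumes \<sigma>: "\<sigma> permutes {..<Suc K}" and 0: "\<sigma> 0 = 0"
  obtains \<tau> where "\<tau> permutes {..<K}" "\<And>i. \<sigma> (Suc i) = Suc (\<tau> i)" "\<tau> = id \<Longrightarrow> \<sigma> = id"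
proof -
  define \<tau> where "\<tau> i = \<sigma> (Suc i) - 1" for i
  have pos: "\<sigma> (Suc i) \<noteq> 0" for i using 0 permutes_inj[OF \<sigma>] by (metis injD nat.distinct(1))
  then have S: "\<sigma> (Suc i) = Suc (\<tau> i)" for i by (simp add: \<tau>_def)
  have "\<tau> permutes {..<K}"
  proof (rule inj_imp_permutes)
    show "inj_on \<tau> {..<K}"
    proof (rule inj_onI)
      fix i j assume "\<tau> i = \<tau> j"
      then have "\<sigma> (Suc i) = \<sigma> (Suc j)" by (simp add: S)
      then show "i = j" using permutes_inj[OF \<sigma>] by (simp add: inj_eq)
    qed
    show "\<tau> i \<in> {..<K}" if "i \<in> {..<K}" for i
      using permutes_in_image[OF \<sigma>, of "Suc i"] that by (simp add: S)
    show "\<tau> i = i" if "i \<notin> {..<K}" for i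
      using permutes_not_in[OF \<sigma>, of "Suc i"] that by (simp add: \<tau>_def)
  qed simp
  moreover have "\<sigma> = id" if "\<tau> = id"
  proof
    fix i show "\<sigma> i = id i" using 0 S that by (cases i) auto
  qed
  ultimately show ?thesis using that S by blast
qed

text \<open>
  The parts after the first one of the row lengths belonging to \<open>\<sigma>\<close> in the determinant for \<open>p[n]\<close>.
\<close>

definition shifted_row :: "nat \<Rightarrow> (nat \<Rightarrow> nat) \<Rightarrow> (nat \<Rightarrow> nat) \<Rightarrow> nat \<Rightarrow> nat" where
  "shifted_row K p \<sigma> i = (if i < K then nat (int (p i) - int (Suc i) + int (\<sigma> (Suc i))) else 0)"

definition shift_nonneg :: "nat \<Rightarrow> (nat \<Rightarrow> nat) \<Rightarrow> (nat \<Rightarrow> nat) \<Rightarrow> bool" where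
  "shift_nonneg K p \<sigma> \<longleftrightarrow> (\<forall>i<K. 0 \<le> int (p i) - int (Suc i) + int (\<sigma> (Suc i)))"

lemma stable_jt_expand:
  assumes p: "\<And>i. K \<le> i \<Longrightarrow> p i = 0"
  shows "stable_jt (Suc K) p x = (\<Sum>\<sigma> | \<sigma> permutes {..<Suc K}. of_int (sign \<sigma>) *
    (if shift_nonneg K p \<sigma> then stable_perm_char (shifted_row K p \<sigma>) x else 0))"
proof (cases x)
  case (Pair n g)
  show ?thesis
  proof (cases "g permutes {1..n}")
    case True
    have "of_int (jacobi_trudi n (Suc K) (pad_seq p n) g) = (\<Sum>\<sigma> | \<sigma> permutes {..<Suc K}. of_int (sign \<sigma>) *
       (of_int (row_char n (Suc K) (\<lambda>i. pad_seq p n i + int (\<sigma> i)) g) :: complex))"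
      by (simp add: jacobi_trudi_def)
    also have "\<dots> = (\<Sum>\<sigma> | \<sigma> permutes {..<Suc K}. of_int (sign \<sigma>) *
      (if shift_nonneg K p \<sigma> then stable_perm_char (shifted_row K p \<sigma>) (n, g) else 0))"
    proof (rule sum.cong[OF refl])
      fix \<sigma> assume "\<sigma> \<in> {\<sigma>. \<sigma> permutes {..<Suc K}}"
      then have "of_int (row_char n (Suc K) (\<lambda>i. pad_seq p n i + int (\<sigma> i)) g) =
         (if shift_nonneg K p \<sigma> then stable_perm_char (shifted_row K p \<sigma>) (n, g) else 0)"
        using row_char_stable(1)[OF p _ True refl] unfolding shift_nonneg_def shifted_row_def by simp
      then show "of_int (sign \<sigma>) * (of_int (row_char n (Suc K) (\<lambda>i. pad_seq p n i + int (\<sigma> i)) g) :: complex)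
        = of_int (sign \<sigma>) * (if shift_nonneg K p \<sigma> then stable_perm_char (shifted_row K p \<sigma>) (n, g) else 0)" by simp
    qed
    finally show ?thesis unfolding Pair stable_jt_def using True by simp
  next
    case False
    then show ?thesis by (simp add: Pair stable_jt_def stable_perm_char_def if_distrib cong: if_cong)
  qed
qed

lemma shifted_row_weight:
  assumes p: "\<And>i. K \<le> i \<Longrightarrow> p i = 0" and \<sigma>: "\<sigma> permutes {..<Suc K}" and adm: "shift_nonneg K p \<sigma>"
  shows "int (weight (shifted_row K p \<sigma>)) = int (psize p) - int (\<sigma> 0)"
proof -
  have "weight (shifted_row K p \<sigma>) = (\<Sum>i<K. shifted_row K p \<sigma> i)"
    by (rule weight_eq_sum) (auto simp: shifted_row_def)
  then have "int (weight (shifted_row K p \<sigma>)) = (\<Sum>i<K. int (shifted_row K p \<sigma> i))" by simp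
  also have "\<dots> = (\<Sum>i<K. int (p i) - int (Suc i) + int (\<sigma> (Suc i)))"
    by (rule sum.cong) (use adm in \<open>auto simp: shift_nonneg_def shifted_row_def\<close>)
  also have "\<dots> = int (psize p) - int (\<sigma> 0)"
    using row_char_stable(2)[OF p \<sigma> permutes_id refl] by simp
  finally show ?thesis .
qed

lemma shifted_row_finite: "finite {i. shifted_row K p \<sigma> i \<noteq> 0}"
  by (rule finite_subset[of _ "{..<K}"]) (auto simp: shifted_row_def split: if_splits)

lemma shifted_row_squares:
  assumes p: "antimono p" "\<And>i. K \<le> i \<Longrightarrow> p i = 0" and \<sigma>: "\<sigma> permutes {..<Suc K}" "\<sigma> 0 = 0" "\<sigma> \<noteq> id"
    and adm: "shift_nonneg K p \<sigma>"
  shows "(\<Sum>i | p i \<noteq> 0. (p i)\<^sup>2) < (\<Sum>i | shifted_row K p \<sigma> i \<noteq> 0. (shifted_row K p \<sigma> i)\<^sup>2)"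
proof -
  obtain \<tau> where \<tau>: "\<tau> permutes {..<K}" "\<And>i. \<sigma> (Suc i) = Suc (\<tau> i)" "\<tau> = id \<Longrightarrow> \<sigma> = id"
    using shift_permutation[OF \<sigma>(1,2)] by blast
  have "\<tau> \<noteq> id" using \<tau>(3) \<sigma>(3) by blast
  have sq: "(\<Sum>i | Z i \<noteq> 0. (Z i)\<^sup>2) = (\<Sum>i<K. (Z i)\<^sup>2)" if "\<And>i. K \<le> i \<Longrightarrow> Z i = 0" for Z :: "nat \<Rightarrow> nat"
  proof -
    have "{i. Z i \<noteq> 0} \<subseteq> {..<K}" using that by (auto simp: not_less[symmetric] intro: ccontr)
    then show ?thesis by (intro sum.mono_neutral_left) auto
  qed
  have "int (\<Sum>i<K. (p i)\<^sup>2) < (\<Sum>i<K. (int (p i) - int i + int (\<tau> i))\<^sup>2)"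
    using sum_square_increase[OF p(1) \<tau>(1) \<open>\<tau> \<noteq> id\<close>] by simp
  also have "\<dots> = (\<Sum>i<K. (int (shifted_row K p \<sigma> i))\<^sup>2)"
    by (rule sum.cong) (use adm in \<open>auto simp: shift_nonneg_def shifted_row_def \<tau>(2)\<close>)
  also have "\<dots> = int (\<Sum>i<K. (shifted_row K p \<sigma> i)\<^sup>2)" by simp
  finally have "(\<Sum>i<K. (p i)\<^sup>2) < (\<Sum>i<K. (shifted_row K p \<sigma> i)\<^sup>2)" by (simp only: of_nat_less_iff)
  then show ?thesis using sq[of p] sq[of "shifted_row K p \<sigma>"] p(2) by (simp add: shifted_row_def)
qed

lemma shifted_row_id: "(\<And>i. K \<le> i \<Longrightarrow> p i = 0) \<Longrightarrow> shifted_row K p id = p"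
  by (auto simp: shifted_row_def fun_eq_iff not_less)

lemma shift_nonneg_id: "shift_nonneg K p id"
  by (simp add: shift_nonneg_def)

lemma span_minus_sum:
  assumes "finite A" "a \<in> A" "(\<lambda>x. \<Sum>i\<in>A. c i * F i x) \<in> cfun.span S" "c a = 1"
    "\<And>i. i \<in> A \<Longrightarrow> i \<noteq> a \<Longrightarrow> F i \<in> cfun.span S"
  shows "F a \<in> cfun.span S"
proof -
  have "(\<lambda>x. \<Sum>i\<in>A - {a}. c i * F i x) \<in> cfun.span S"
    by (intro subspace_lincomb cfun.subspace_span assms(5)) auto
  then have "(\<lambda>x. \<Sum>i\<in>A. c i * F i x) - (\<lambda>x. \<Sum>i\<in>A - {a}. c i * F i x) \<in> cfun.span S"
    by (intro cfun.span_diff assms(3))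
  also have "(\<lambda>x. \<Sum>i\<in>A. c i * F i x) - (\<lambda>x. \<Sum>i\<in>A - {a}. c i * F i x) = F a"
    using assms(1,2,4) by (simp add: fun_eq_iff sum.remove[of A a])
  finally show ?thesis .
qed

text \<open>
  In the expansion of \<open>stable_jt\<close> at \<open>u\<close> the identity contributes the permutation character of \<open>u\<close>. Every
  other \<open>\<sigma>\<close> contributes a shape that is smaller, or has the same size and, by \<open>shifted_row_squares\<close>, a
  larger sum of squares. Unlike dominance, this measure does not change when the parts are sorted.
\<close>

lemma stable_perm_char_partition_span:
  assumes "u \<in> small_partitions K"
  shows "stable_perm_char u \<in> cfun.span (stable_jt (Suc K) ` small_partitions K)"
  using assms
proof (induction u rule: measure_induct_rule[of "\<lambda>u. psize u * Suc (K\<^sup>2) + (K\<^sup>2 - (\<Sum>i | u i \<noteq> 0. (u i)\<^sup>2))"])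
  case (less u)
  have u: "is_partition u" "psize u \<le> K" using less.prems by (auto simp: small_partitions_def)
  have u0: "u i = 0" if "K \<le> i" for i using partition_zero[OF u(1), of i] u(2) that by simp
  have mono: "antimono u" using u(1) by (simp add: is_partition_def)
  let ?S = "cfun.span (stable_jt (Suc K) ` small_partitions K)"
  define F where "F \<sigma> = (\<lambda>x. if shift_nonneg K u \<sigma> then stable_perm_char (shifted_row K u \<sigma>) x else 0)" for \<sigma>
  have "F id \<in> ?S"
  proof (rule span_minus_sum[where F = F and a = id and A = "{\<sigma>. \<sigma> permutes {..<Suc K}}" and c = "\<lambda>\<sigma>. of_int (sign \<sigma>)"])
    show "finite {\<sigma>. \<sigma> permutes {..<Suc K}}" by (simp add: finite_permutations)
    show "id \<in> {\<sigma>. \<sigma> permutes {..<Suc K}}" by (simp add: permutes_id)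
    have "stable_jt (Suc K) u \<in> ?S" using less.prems by (intro cfun.span_base) auto
    then show "(\<lambda>x. \<Sum>\<sigma> | \<sigma> permutes {..<Suc K}. of_int (sign \<sigma>) * F \<sigma> x) \<in> ?S"
    proof (rule back_subst[where P = "\<lambda>f. f \<in> ?S"])
      show "stable_jt (Suc K) u = (\<lambda>x. \<Sum>\<sigma> | \<sigma> permutes {..<Suc K}. of_int (sign \<sigma>) * F \<sigma> x)"
        unfolding F_def by (rule ext, rule stable_jt_expand, rule u0)
    qed
    show "of_int (sign (id :: nat \<Rightarrow> nat)) = (1 :: complex)" by simp
    fix \<sigma> :: "nat \<Rightarrow> nat" assume "\<sigma> \<in> {\<sigma>. \<sigma> permutes {..<Suc K}}" and ne: "\<sigma> \<noteq> id"
    then have \<sigma>: "\<sigma> permutes {..<Suc K}" by simp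
    show "F \<sigma> \<in> ?S"
    proof (cases "shift_nonneg K u \<sigma>")
      case True
      let ?w = "shifted_row K u \<sigma>"
      obtain u' where u': "is_partition u'" "psize u' = weight ?w" "stable_perm_char u' = stable_perm_char ?w"
        "(\<Sum>j | u' j \<noteq> 0. (u' j)\<^sup>2) = (\<Sum>i | ?w i \<noteq> 0. (?w i)\<^sup>2)"
        using sort_to_partition[OF shifted_row_finite] by metis
      have tot: "int (psize u') = int (psize u) - int (\<sigma> 0)"
        unfolding u'(2) by (rule shifted_row_weight[OF _ \<sigma> True]) (rule u0)
      then have le: "psize u' \<le> psize u" by linarith
      have small: "u' \<in> small_partitions K" using u'(1) le u(2) by (simp add: small_partitions_def)
      have "psize u' * Suc (K\<^sup>2) + (K\<^sup>2 - (\<Sum>i | u' i \<noteq> 0. (u' i)\<^sup>2)) < psize u * Suc (K\<^sup>2) + (K\<^sup>2 - (\<Sum>i | u i \<noteq> 0. (u i)\<^sup>2))"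
      proof (cases "\<sigma> 0 = 0")
        case False
        then have "Suc (psize u') \<le> psize u" using tot by linarith
        then have "Suc (psize u') * Suc (K\<^sup>2) \<le> psize u * Suc (K\<^sup>2)" by (rule mult_le_mono1)
        then show ?thesis by simp
      next
        case z: True
        have "(\<Sum>i | u i \<noteq> 0. (u i)\<^sup>2) < (\<Sum>i | u' i \<noteq> 0. (u' i)\<^sup>2)"
          unfolding u'(4) by (rule shifted_row_squares[OF mono u0 \<sigma> z ne True])
        moreover have "(\<Sum>i | u' i \<noteq> 0. (u' i)\<^sup>2) \<le> K\<^sup>2"
        proof -
          have "(\<Sum>i | u' i \<noteq> 0. (u' i)\<^sup>2) \<le> (weight u')\<^sup>2"
            using u'(1) by (intro sum_squares_le) (simp add: is_partition_def)
          also have "\<dots> \<le> K\<^sup>2" using le u(2) by (intro power_mono) (auto simp: psize_weight)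
          finally show ?thesis .
        qed
        moreover have "psize u' = psize u" using tot z by simp
        ultimately show ?thesis by simp
      qed
      from less.IH[OF this small] show ?thesis using True u'(3) by (simp add: F_def)
    next
      case False
      then show ?thesis using cfun.span_zero[of "stable_jt (Suc K) ` small_partitions K"]
        by (simp add: F_def zero_fun_def)
    qed
  qed
  then show ?case by (simp add: F_def shift_nonneg_id shifted_row_id u0)
qed

lemma stable_perm_char_span:
  assumes "finite {i. Z i \<noteq> 0}" "weight Z \<le> K"
  shows "stable_perm_char Z \<in> cfun.span (stable_jt (Suc K) ` small_partitions K)"
proof -
  obtain u where u: "is_partition u" "psize u = weight Z" "stable_perm_char u = stable_perm_char Z"
    using sort_to_partition[OF assms(1)] by metis
  then show ?thesis using stable_perm_char_partition_span[of u K] assms(2) by (simp add: small_partitions_def)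
qed

text \<open>
  Matrices with prescribed margins for the shapes \<open>u[n]\<close> and \<open>w[n]\<close>, with the corner entry, the only one
  that depends on \<open>n\<close>, replaced by 0, and without the two margins that pass through the corner. This
  set is independent of \<open>n\<close>.
\<close>

definition bordered_margins :: "nat \<Rightarrow> (nat \<Rightarrow> nat) \<Rightarrow> (nat \<Rightarrow> nat) \<Rightarrow> (nat option \<times> nat option \<Rightarrow> nat) set" where
  "bordered_margins K u w = {Z. Z (None, None) = 0 \<and>
     (\<forall>p. p \<notin> insert None (Some ` {..<K}) \<times> insert None (Some ` {..<K}) \<longrightarrow> Z p = 0) \<and>
     (\<forall>i<K. (\<Sum>j\<in>insert None (Some ` {..<K}). Z (Some i, j)) = u i) \<and>
     (\<forall>j<K. (\<Sum>i\<in>insert None (Some ` {..<K}). Z (i, Some j)) = w j)}"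

lemma bordered_margins_weight:
  assumes Z: "Z \<in> bordered_margins K u w" and u: "\<And>i. K \<le> i \<Longrightarrow> u i = 0" and w: "\<And>i. K \<le> i \<Longrightarrow> w i = 0"
  shows "weight Z = weight u + (\<Sum>j<K. Z (None, Some j))" "weight Z = weight w + (\<Sum>i<K. Z (Some i, None))"
    "weight Z \<le> weight u + weight w" "finite {p. Z p \<noteq> 0}"
proof -
  let ?I = "insert None (Some ` {..<K})"
  have Z0: "Z (None, None) = 0" and supp: "\<And>p. p \<notin> ?I \<times> ?I \<Longrightarrow> Z p = 0"
    and rows: "\<And>i. i < K \<Longrightarrow> (\<Sum>j\<in>?I. Z (Some i, j)) = u i" and cols: "\<And>j. j < K \<Longrightarrow> (\<Sum>i\<in>?I. Z (i, Some j)) = w j"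
    using Z unfolding bordered_margins_def by blast+
  have sumI: "(\<Sum>i\<in>?I. f i) = f None + (\<Sum>i<K. f (Some i))" for f :: "nat option \<Rightarrow> nat"
    by (simp add: sum.reindex)
  have tu: "weight u = (\<Sum>i<K. u i)" by (rule weight_eq_sum) (use u in auto)
  have tw: "weight w = (\<Sum>i<K. w i)" by (rule weight_eq_sum) (use w in auto)
  have "weight Z = (\<Sum>p\<in>?I \<times> ?I. Z p)" by (rule weight_eq_sum) (use supp in auto)
  also have "\<dots> = (\<Sum>i\<in>?I. \<Sum>j\<in>?I. Z (i, j))" by (simp only: sum.cartesian_product case_prod_eta)
  finally have t1: "weight Z = (\<Sum>i\<in>?I. \<Sum>j\<in>?I. Z (i, j))" .
  then have t2: "weight Z = (\<Sum>j\<in>?I. \<Sum>i\<in>?I. Z (i, j))" by (subst sum.swap)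
  have "(\<Sum>i<K. \<Sum>j\<in>?I. Z (Some i, j)) = weight u" unfolding tu by (rule sum.cong) (use rows in auto)
  moreover have "weight Z = (\<Sum>j\<in>?I. Z (None, j)) + (\<Sum>i<K. \<Sum>j\<in>?I. Z (Some i, j))" unfolding t1 by (rule sumI)
  ultimately show a: "weight Z = weight u + (\<Sum>j<K. Z (None, Some j))" using sumI[of "\<lambda>j. Z (None, j)"] Z0 by simp
  have "(\<Sum>j<K. \<Sum>i\<in>?I. Z (i, Some j)) = weight w" unfolding tw by (rule sum.cong) (use cols in auto)
  moreover have "weight Z = (\<Sum>i\<in>?I. Z (i, None)) + (\<Sum>j<K. \<Sum>i\<in>?I. Z (i, Some j))" unfolding t2 by (rule sumI)
  ultimately show "weight Z = weight w + (\<Sum>i<K. Z (Some i, None))" using sumI[of "\<lambda>i. Z (i, None)"] Z0 by simp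
  have "(\<Sum>j<K. Z (None, Some j)) \<le> (\<Sum>j<K. w j)"
  proof (rule sum_mono)
    fix j assume "j \<in> {..<K}"
    then have "Z (None, Some j) + (\<Sum>i<K. Z (Some i, Some j)) = w j"
      using cols[of j] sumI[of "\<lambda>i. Z (i, Some j)"] by simp
    then show "Z (None, Some j) \<le> w j" by simp
  qed
  then show "weight Z \<le> weight u + weight w" using a tw by simp
  show "finite {p. Z p \<noteq> 0}"
  proof (rule finite_subset)
    show "{p. Z p \<noteq> 0} \<subseteq> ?I \<times> ?I"
    proof
      fix p assume "p \<in> {p. Z p \<noteq> 0}"
      then have "Z p \<noteq> 0" by simp
      then show "p \<in> ?I \<times> ?I" using supp[of p] by argo
    qed
  qed simp
qed

lemma finite_bordered_margins:
  assumes u: "\<And>i. K \<le> i \<Longrightarrow> u i = 0" and w: "\<And>i. K \<le> i \<Longrightarrow> w i = 0"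
  shows "finite (bordered_margins K u w)"
proof (rule finite_bounded_functions)
  fix Z x assume Z: "Z \<in> bordered_margins K u w" and nz: "Z x \<noteq> 0"
  have "Z x \<le> weight Z" unfolding weight_def
    by (rule member_le_sum) (use nz bordered_margins_weight(4)[OF Z u w] in auto)
  moreover have "Z x = 0" if "x \<notin> insert None (Some ` {..<K}) \<times> insert None (Some ` {..<K})"
    using Z that unfolding bordered_margins_def by blast
  ultimately show "x \<in> insert None (Some ` {..<K}) \<times> insert None (Some ` {..<K}) \<and> Z x \<le> weight u + weight w"
    using bordered_margins_weight(3)[OF Z u w] nz by (metis le_trans)
qed simp

text \<open>
  By \<open>perm_char_mult\<close> the product is a sum over matrices with the margins \<open>u[n]\<close> and \<open>w[n]\<close>; the corner
  of such a matrix is \<open>n\<close> minus the sum of the other entries. Bordered matrices of weight more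
  than \<open>n\<close> have no corner entry, and their stable characters vanish at \<open>n\<close>.
\<close>

lemma stable_perm_char_mult:
  assumes u: "\<And>i. K \<le> i \<Longrightarrow> u i = 0" and w: "\<And>i. K \<le> i \<Longrightarrow> w i = 0"
  shows "stable_perm_char u x * stable_perm_char w x = (\<Sum>Z\<in>bordered_margins K u w. stable_perm_char Z x)"
proof (cases x)
  case (Pair n g)
  let ?R = "bordered_margins K u w" and ?I = "insert None (Some ` {..<K})"
  let ?c = "(None, None) :: nat option \<times> nat option"
  note tot = bordered_margins_weight[OF _ u w]
  have fin: "finite ?R" using finite_bordered_margins[of K u w] u w by blast
  have sumI: "(\<Sum>i\<in>?I. f i) = f None + (\<Sum>i<K. f (Some i))" for f :: "nat option \<Rightarrow> nat"
    by (simp add: sum.reindex)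
  have tu: "weight u = (\<Sum>i<K. u i)" by (rule weight_eq_sum) (use u in auto)
  have tw: "weight w = (\<Sum>i<K. w i)" by (rule weight_eq_sum) (use w in auto)
  show ?thesis
  proof (cases "g permutes {1..n} \<and> weight u \<le> n \<and> weight w \<le> n")
    case False
    have "stable_perm_char Z x = 0" if Z: "Z \<in> ?R" for Z
    proof -
      have "weight u \<le> weight Z" "weight w \<le> weight Z" using tot(1)[OF Z] tot(2)[OF Z] by linarith+
      then show ?thesis using False by (auto simp: Pair stable_perm_char_def)
    qed
    then have "(\<Sum>Z\<in>?R. stable_perm_char Z x) = 0" by simp
    then show ?thesis using False by (auto simp: Pair stable_perm_char_def)
  next
    case True
    then have g: "g permutes {1..n}" and un: "weight u \<le> n" and wn: "weight w \<le> n" by auto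
    let ?b = "case_option (n - weight u) u" and ?v = "case_option (n - weight w) w"
    let ?M = "margins ?I ?I ?b ?v" and ?R' = "{Z \<in> ?R. weight Z \<le> n}"
    have RZ: "Z \<in> ?R \<longleftrightarrow> Z ?c = 0 \<and> (\<forall>p. p \<notin> ?I \<times> ?I \<longrightarrow> Z p = 0) \<and>
      (\<forall>i<K. (\<Sum>j\<in>?I. Z (Some i, j)) = u i) \<and> (\<forall>j<K. (\<Sum>i\<in>?I. Z (i, Some j)) = w j)" for Z
      by (simp only: bordered_margins_def mem_Collect_eq)
    have MZ: "Z \<in> ?M \<longleftrightarrow> (\<forall>p. p \<notin> ?I \<times> ?I \<longrightarrow> Z p = 0) \<and>
      (\<forall>i\<in>?I. (\<Sum>j\<in>?I. Z (i, j)) = ?b i) \<and> (\<forall>j\<in>?I. (\<Sum>i\<in>?I. Z (i, j)) = ?v j)" for Z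
      by (simp only: margins_def mem_Collect_eq)
    have down: "Z(?c := 0) \<in> ?R'" "n - weight (Z(?c := 0)) = Z ?c" if Z: "Z \<in> ?M" for Z
    proof -
      have supp: "\<And>p. p \<notin> ?I \<times> ?I \<Longrightarrow> Z p = 0" and rows: "\<And>i. i \<in> ?I \<Longrightarrow> (\<Sum>j\<in>?I. Z (i, j)) = ?b i"
        and cols: "\<And>j. j \<in> ?I \<Longrightarrow> (\<Sum>i\<in>?I. Z (i, j)) = ?v j" using Z unfolding MZ by blast+
      have R: "Z(?c := 0) \<in> ?R"
        unfolding RZ
      proof (intro conjI allI impI)
        show "(Z(?c := 0)) p = 0" if "p \<notin> ?I \<times> ?I" for p using supp[OF that] by (simp only: fun_upd_apply if_cancel)
        show "(\<Sum>j\<in>?I. (Z(?c := 0)) (Some i, j)) = u i" if "i < K" for i using rows[of "Some i"] that by simp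
        show "(\<Sum>i\<in>?I. (Z(?c := 0)) (i, Some j)) = w j" if "j < K" for j using cols[of "Some j"] that by simp
      qed simp
      have "Z ?c + (\<Sum>j<K. Z (None, Some j)) = n - weight u" using rows[of None] sumI[of "\<lambda>j. Z (None, j)"] by simp
      moreover have "weight (Z(?c := 0)) = weight u + (\<Sum>j<K. Z (None, Some j))" using tot(1)[OF R] by simp
      ultimately have *: "Z ?c + weight (Z(?c := 0)) = n" using un by linarith
      then show "Z(?c := 0) \<in> ?R'" using R by simp
      show "n - weight (Z(?c := 0)) = Z ?c" using * by linarith
    qed
    have up: "Z(?c := n - weight Z) \<in> ?M" "(Z(?c := n - weight Z))(?c := 0) = Z" if Z: "Z \<in> ?R'" for Z
    proof -
      have R: "Z \<in> ?R" and le: "weight Z \<le> n" using Z by auto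
      then have Z0: "Z ?c = 0" and supp: "\<And>p. p \<notin> ?I \<times> ?I \<Longrightarrow> Z p = 0"
        and rows: "\<And>i. i < K \<Longrightarrow> (\<Sum>j\<in>?I. Z (Some i, j)) = u i" and cols: "\<And>j. j < K \<Longrightarrow> (\<Sum>i\<in>?I. Z (i, Some j)) = w j"
        unfolding RZ by blast+
      show "(Z(?c := n - weight Z))(?c := 0) = Z" using Z0 by (auto simp: fun_eq_iff)
      show "Z(?c := n - weight Z) \<in> ?M"
        unfolding MZ
      proof (intro conjI allI impI ballI)
        fix p assume p: "p \<notin> ?I \<times> ?I"
        then have "p \<noteq> ?c" by auto
        then show "(Z(?c := n - weight Z)) p = 0" using supp[OF p] by simp
      next
        fix i assume i: "i \<in> ?I"
        show "(\<Sum>j\<in>?I. (Z(?c := n - weight Z)) (i, j)) = ?b i"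
        proof (cases i)
          case None
          have "(\<Sum>j\<in>?I. (Z(?c := n - weight Z)) (None, j)) = n - weight Z + (\<Sum>j<K. Z (None, Some j))"
            unfolding sumI by simp
          also have "\<dots> = n - weight u" using tot(1)[OF R] le by linarith
          finally show ?thesis using None by simp
        next
          case (Some k)
          then show ?thesis using rows[of k] i by auto
        qed
      next
        fix j assume j: "j \<in> ?I"
        show "(\<Sum>i\<in>?I. (Z(?c := n - weight Z)) (i, j)) = ?v j"
        proof (cases j)
          case None
          have "(\<Sum>i\<in>?I. (Z(?c := n - weight Z)) (i, None)) = n - weight Z + (\<Sum>i<K. Z (Some i, None))"
            unfolding sumI by simp
          also have "\<dots> = n - weight w" using tot(2)[OF R] le by linarith
          finally show ?thesis using None by simp
        next
          case (Some k)
          then show ?thesis using cols[of k] j by auto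
        qed
      qed
    qed
    have char: "perm_char n (case_option (n - weight Z) Z) g = perm_char n (Z(?c := n - weight Z)) g" if Z: "Z \<in> ?R'" for Z
    proof (rule perm_char_relabel[OF g, where h = "case_option ?c (\<lambda>p. p)"])
      have Z0: "Z ?c = 0" using Z unfolding mem_Collect_eq RZ by blast
      show "inj_on (case_option ?c (\<lambda>p. p)) {i. case_option (n - weight Z) Z i \<noteq> 0}"
      proof (rule inj_onI)
        fix i j assume "i \<in> {i. case_option (n - weight Z) Z i \<noteq> 0}" "j \<in> {i. case_option (n - weight Z) Z i \<noteq> 0}"
          "case_option ?c (\<lambda>p. p) i = case_option ?c (\<lambda>p. p) j"
        then show "i = j" using Z0 by (cases i; cases j) auto
      qed
      show "(Z(?c := n - weight Z)) (case_option ?c (\<lambda>p. p) i) = case_option (n - weight Z) Z i"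
        if "case_option (n - weight Z) Z i \<noteq> 0" for i
        using that Z0 by (cases i) auto
      show "j \<in> case_option ?c (\<lambda>p. p) ` {i. case_option (n - weight Z) Z i \<noteq> 0}"
        if "(Z(?c := n - weight Z)) j \<noteq> 0" for j
      proof (cases "j = ?c")
        case True
        then show ?thesis using that by (intro image_eqI[of _ _ None]) auto
      next
        case False
        then show ?thesis using that by (intro image_eqI[of _ _ "Some j"]) auto
      qed
    qed
    have "perm_char n ?b g * perm_char n ?v g = (\<Sum>Z\<in>?M. perm_char n Z g)"
    proof (rule perm_char_mult[OF g])
      show "?b i = 0" if "i \<notin> ?I" for i using that u by (cases i) (auto simp: not_less[symmetric])
      show "?v i = 0" if "i \<notin> ?I" for i using that w by (cases i) (auto simp: not_less[symmetric])
    qed simp_all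
    also have "\<dots> = (\<Sum>Z\<in>?R'. perm_char n (case_option (n - weight Z) Z) g)"
    proof (rule sum.reindex_bij_witness[of _ "\<lambda>Z. Z(?c := n - weight Z)" "\<lambda>Z. Z(?c := 0)"])
      fix Z assume Z: "Z \<in> ?M"
      show "(Z(?c := 0))(?c := n - weight (Z(?c := 0))) = Z" using down(2)[OF Z] by (auto simp: fun_eq_iff)
      then show "perm_char n (case_option (n - weight (Z(?c := 0))) (Z(?c := 0))) g = perm_char n Z g"
        using char[OF down(1)[OF Z]] by simp
    qed (use down up in auto)
    finally have "complex_of_nat (perm_char n ?b g * perm_char n ?v g) = of_nat (\<Sum>Z\<in>?R'. perm_char n (case_option (n - weight Z) Z) g)"
      by (rule arg_cong)
    also have "\<dots> = (\<Sum>Z\<in>?R'. stable_perm_char Z x)"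
      unfolding of_nat_sum by (rule sum.cong) (use g in \<open>auto simp: Pair stable_perm_char_def\<close>)
    also have "\<dots> = (\<Sum>Z\<in>?R. stable_perm_char Z x)"
      by (rule sum.mono_neutral_left[OF fin]) (auto simp: Pair stable_perm_char_def)
    finally show ?thesis using un wn g by (simp add: Pair stable_perm_char_def)
  qed
qed

text \<open>
  Both factors are combinations of stable permutation characters of sizes at most \<open>|\<alpha>|\<close> and \<open>|\<beta>|\<close>, and
  the products of these have size at most \<open>|\<alpha>| + |\<beta>|\<close>.
\<close>

theorem stable_jt_mult_span:
  assumes \<alpha>: "is_partition \<alpha>" and \<beta>: "is_partition \<beta>" and K: "psize \<alpha> + psize \<beta> \<le> K"
  shows "(\<lambda>x. stable_jt (Suc K) \<alpha> x * stable_jt (Suc K) \<beta> x) \<in> cfun.span (stable_jt (Suc K) ` small_partitions K)"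
proof -
  let ?S = "cfun.span (stable_jt (Suc K) ` small_partitions K)" and ?P = "{\<sigma>. \<sigma> permutes {..<Suc K}}"
  have a0: "\<alpha> i = 0" if "K \<le> i" for i using partition_zero[OF \<alpha>, of i] K that by simp
  have b0: "\<beta> i = 0" if "K \<le> i" for i using partition_zero[OF \<beta>, of i] K that by simp
  define F where "F p \<sigma> x = (if shift_nonneg K p \<sigma> then stable_perm_char (shifted_row K p \<sigma>) x else 0)" for p \<sigma> x
  have mem: "(\<lambda>x. F \<alpha> \<sigma> x * F \<beta> \<tau> x) \<in> ?S" if \<sigma>: "\<sigma> \<in> ?P" and \<tau>: "\<tau> \<in> ?P" for \<sigma> \<tau>
  proof (cases "shift_nonneg K \<alpha> \<sigma> \<and> shift_nonneg K \<beta> \<tau>")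
    case True
    let ?u = "shifted_row K \<alpha> \<sigma>" and ?w = "shifted_row K \<beta> \<tau>"
    have z: "shifted_row K p \<sigma> i = 0" if "K \<le> i" for p \<sigma> i using that by (simp add: shifted_row_def)
    have "int (weight ?u) = int (psize \<alpha>) - int (\<sigma> 0)"
      by (rule shifted_row_weight[OF a0]) (use \<sigma> True in auto)
    moreover have "int (weight ?w) = int (psize \<beta>) - int (\<tau> 0)"
      by (rule shifted_row_weight[OF b0]) (use \<tau> True in auto)
    ultimately have le: "weight ?u + weight ?w \<le> K" using K by linarith
    have "(\<lambda>x. \<Sum>Z\<in>bordered_margins K ?u ?w. 1 * stable_perm_char Z x) \<in> ?S"
    proof (rule subspace_lincomb[OF cfun.subspace_span])
      fix Z assume Z: "Z \<in> bordered_margins K ?u ?w"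
      show "stable_perm_char Z \<in> ?S"
        by (rule stable_perm_char_span)
           (use bordered_margins_weight(3,4)[OF Z z z] le in auto)
    qed
    then show ?thesis using True stable_perm_char_mult[OF z z] by (simp add: F_def)
  next
    case False
    then have "(\<lambda>x. F \<alpha> \<sigma> x * F \<beta> \<tau> x) = 0" by (auto simp: F_def fun_eq_iff)
    then show ?thesis using cfun.span_zero by metis
  qed
  have "(\<lambda>x. \<Sum>q\<in>?P \<times> ?P. of_int (sign (fst q) * sign (snd q)) * (F \<alpha> (fst q) x * F \<beta> (snd q) x)) \<in> ?S"
  proof (rule subspace_lincomb[OF cfun.subspace_span])
    fix q assume "q \<in> ?P \<times> ?P"
    then show "(\<lambda>x. F \<alpha> (fst q) x * F \<beta> (snd q) x) \<in> ?S" by (intro mem) auto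
  qed
  moreover have "stable_jt (Suc K) \<alpha> x * stable_jt (Suc K) \<beta> x =
     (\<Sum>q\<in>?P \<times> ?P. of_int (sign (fst q) * sign (snd q)) * (F \<alpha> (fst q) x * F \<beta> (snd q) x))" for x
  proof -
    have "stable_jt (Suc K) \<alpha> x = (\<Sum>\<sigma>\<in>?P. of_int (sign \<sigma>) * F \<alpha> \<sigma> x)"
      unfolding F_def by (rule stable_jt_expand) (rule a0)
    moreover have "stable_jt (Suc K) \<beta> x = (\<Sum>\<tau>\<in>?P. of_int (sign \<tau>) * F \<beta> \<tau> x)"
      unfolding F_def by (rule stable_jt_expand) (rule b0)
    ultimately have "stable_jt (Suc K) \<alpha> x * stable_jt (Suc K) \<beta> x
      = (\<Sum>\<sigma>\<in>?P. of_int (sign \<sigma>) * F \<alpha> \<sigma> x) * (\<Sum>\<tau>\<in>?P. of_int (sign \<tau>) * F \<beta> \<tau> x)" by (simp only:)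
    also have "\<dots> = (\<Sum>q\<in>?P \<times> ?P. of_int (sign (fst q) * sign (snd q)) * (F \<alpha> (fst q) x * F \<beta> (snd q) x))"
      unfolding sum_product sum.cartesian_product by (rule sum.cong) (auto simp: algebra_simps)
    finally show ?thesis .
  qed
  ultimately show ?thesis by simp
qed

section \<open>Reduced Kronecker coefficients and the stability bound\<close>

lemma span_image_finite:
  assumes A: "finite A" and h: "h \<in> cfun.span (F ` A)"
  obtains c where "\<And>x. h x = (\<Sum>a\<in>A. c a * F a x)"
proof -
  let ?S = "{h. \<exists>c. \<forall>x. h x = (\<Sum>a\<in>A. c a * F a x)}"
  have "cfun.subspace ?S"
  proof (rule cfun.subspaceI)
    show "0 \<in> ?S" by (rule CollectI, rule exI[of _ "\<lambda>_. 0"]) simp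
  next
    fix f h assume "f \<in> ?S" "h \<in> ?S"
    then obtain c d where "\<forall>x. f x = (\<Sum>a\<in>A. c a * F a x)" "\<forall>x. h x = (\<Sum>a\<in>A. d a * F a x)" by blast
    then have "\<forall>x. (f + h) x = (\<Sum>a\<in>A. (c a + d a) * F a x)" by (simp add: algebra_simps sum.distrib)
    then show "f + h \<in> ?S" by (intro CollectI exI[of _ "\<lambda>a. c a + d a"])
  next
    fix k f assume "f \<in> ?S"
    then obtain c where "\<forall>x. f x = (\<Sum>a\<in>A. c a * F a x)" by blast
    then have "\<forall>x. cscale k f x = (\<Sum>a\<in>A. k * c a * F a x)" by (simp add: cscale_def sum_distrib_left mult.assoc)
    then show "cscale k f \<in> ?S" by (intro CollectI exI[of _ "\<lambda>a. k * c a"])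
  qed
  moreover have "F ` A \<subseteq> ?S"
  proof (rule image_subsetI)
    fix a assume a: "a \<in> A"
    have "F a x = (\<Sum>b\<in>A. of_bool (b = a) * F b x)" for x
    proof -
      have "(\<Sum>b\<in>A. of_bool (b = a) * F b x) = (\<Sum>b\<in>A. if b = a then F a x else 0)"
        by (rule sum.cong) auto
      then show ?thesis using A a by simp
    qed
    then show "F a \<in> ?S" by (intro CollectI exI[of _ "\<lambda>b. of_bool (b = a)"]) simp
  qed
  ultimately have "cfun.span (F ` A) \<subseteq> ?S" by (intro cfun.span_minimal)
  then have "\<exists>c. \<forall>x. h x = (\<Sum>a\<in>A. c a * F a x)" using h by blast
  then show ?thesis using that by blast
qed

lemma pad_seq_beta: "psize p \<le> n \<Longrightarrow> pad_seq p n = beta_seq (pad p n)"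
  by (auto simp: pad_seq_def beta_seq_def pad_def fun_eq_iff split: nat.split)

lemma pad_zero: "(\<And>i. K \<le> i \<Longrightarrow> p i = 0) \<Longrightarrow> Suc K \<le> i \<Longrightarrow> pad p n i = 0"
  by (cases i) (auto simp: pad_def)

lemma psize_pad:
  assumes p: "is_partition p" and n: "psize p \<le> n"
  shows "psize (pad p n) = n"
proof -
  have z: "p i = 0" if "psize p \<le> i" for i using partition_zero[OF p that] .
  have "psize (pad p n) = (\<Sum>i<Suc (psize p). pad p n i)"
    by (rule psize_eq_sum) (rule pad_zero[OF z])
  also have "\<dots> = n - psize p + (\<Sum>i<psize p. p i)"
    unfolding sum.lessThan_Suc_shift by (simp add: pad_def)
  also have "(\<Sum>i<psize p. p i) = psize p" by (rule psize_eq_sum[symmetric]) (rule z)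
  finally show ?thesis using n by simp
qed

text \<open>
  Up to the factor \<open>n!\<close>, the inner product of the irreducible character of \<open>\<mu>\<close> with \<open>X\<^sub>n(\<delta>)\<close>.
\<close>

definition jt_inner :: "nat \<Rightarrow> nat \<Rightarrow> (nat \<Rightarrow> nat) \<Rightarrow> (nat \<Rightarrow> nat) \<Rightarrow> int" where
  "jt_inner n K \<mu> \<delta> = (\<Sum>g | g permutes {1..n}.
     jacobi_trudi n (Suc K) (beta_seq \<mu>) g * jacobi_trudi n (Suc K) (pad_seq \<delta> n) g)"

text \<open>
  The beta numbers of \<open>\<delta>[n]\<close> decrease except for the first one, which can be moved to its place \<open>p\<close> in
  the decreasing order. If it coincides with another one, the determinant is 0; if the sorted sequence
  is not the beta sequence of a partition, a row of the determinant is 0. Otherwise that partition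
  must be \<open>\<mu>\<close> by orthonormality. Moving a beta number from the front to place \<open>p\<close> lowers the \<open>p\<close> parts
  that it passes by 1, so undoing it is the dagger operation.
\<close>

lemma jt_inner_nonzero:
  assumes \<mu>: "is_partition \<mu>" "psize \<mu> = n" "\<And>i. Suc K \<le> i \<Longrightarrow> \<mu> i = 0"
    and \<delta>: "is_partition \<delta>" "\<And>i. K \<le> i \<Longrightarrow> \<delta> i = 0"
    and nz: "jt_inner n K \<mu> \<delta> \<noteq> 0"
  shows "\<exists>i\<ge>1. \<delta> = dagger \<mu> i"
proof -
  define a where "a = pad_seq \<delta> n"
  have aS: "a (Suc j) = int (\<delta> j) - int (Suc j)" for j by (simp add: a_def pad_seq_def)
  have a0: "a 0 = int n - int (psize \<delta>)" by (simp add: a_def pad_seq_def)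
  have adec: "a (Suc (Suc j)) < a (Suc j)" for j
  proof -
    have "\<delta> (Suc j) \<le> \<delta> j" using \<delta>(1) by (simp add: is_partition_def antimono_def)
    then show ?thesis by (simp add: aS)
  qed
  have "\<exists>g. g permutes {1..n} \<and> jacobi_trudi n (Suc K) a g \<noteq> 0"
  proof (rule ccontr)
    assume "\<not> ?thesis"
    then have "jt_inner n K \<mu> \<delta> = 0" unfolding jt_inner_def a_def by (intro sum.neutral) auto
    then show False using nz by simp
  qed
  then obtain g where g: "g permutes {1..n}" "jacobi_trudi n (Suc K) a g \<noteq> 0" by blast
  \<comment> \<open>The number of later beta numbers that exceed the first one.\<close>
  define p where "p = (LEAST j. K \<le> j \<or> a (Suc j) \<le> a 0)"
  have pP: "K \<le> p \<or> a (Suc p) \<le> a 0" unfolding p_def by (rule LeastI[of _ K]) simp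
  have pK: "p \<le> K" unfolding p_def by (rule Least_le) simp
  have below: "a 0 < a (Suc j)" if "j < p" for j
    using not_less_Least[of j "\<lambda>j. K \<le> j \<or> a (Suc j) \<le> a 0"] that by (auto simp: p_def)
  have "a (Suc p) \<noteq> a 0" if "p < K"
  proof
    assume eq: "a (Suc p) = a 0"
    let ?t = "Transposition.transpose 0 (Suc p)"
    have t: "?t permutes {..<Suc K}" using that by (intro permutes_swap_id) auto
    have "(\<lambda>i. a (?t i)) = a" using eq by (auto simp: transpose_def fun_eq_iff)
    then have "jacobi_trudi n (Suc K) a g = - jacobi_trudi n (Suc K) a g"
      using jacobi_trudi_permute[OF t g(1), of a] by (simp add: sign_swap_id)
    then show False using g(2) by simp
  qed
  then have above: "a (Suc p) < a 0" if "p < K" using pP that by (auto simp: le_less)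
  \<comment> \<open>The cycle that moves the first entry to place \<open>p\<close>.\<close>
  define \<tau> where "\<tau> k = (if k < p then Suc k else if k = p then 0 else k)" for k
  have \<tau>: "\<tau> permutes {..<Suc K}"
    by (rule inj_imp_permutes) (use pK in \<open>auto simp: \<tau>_def inj_on_def split: if_splits\<close>)
  define b where "b k = a (\<tau> k)" for k
  have bdec: "b (Suc k) < b k" if "k < K" for k
  proof -
    consider "Suc k < p" | "Suc k = p" | "k = p" | "p < k" by linarith
    then show ?thesis
    proof cases
      case 1 then show ?thesis using adec by (simp add: b_def \<tau>_def)
    next
      case 2 then show ?thesis using below[of k] by (simp add: b_def \<tau>_def)
    next
      case 3 then show ?thesis using above that by (simp add: b_def \<tau>_def)
    next
      case 4
      then obtain k' where "k = Suc k'" by (cases k) auto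
      then show ?thesis using 4 adec by (simp add: b_def \<tau>_def)
    qed
  qed
  have perm: "jacobi_trudi n (Suc K) b h = sign \<tau> * jacobi_trudi n (Suc K) a h" if "h permutes {1..n}" for h
    unfolding b_def by (rule jacobi_trudi_permute[OF \<tau> that])
  have "jacobi_trudi n (Suc K) b g \<noteq> 0" using perm[OF g(1)] g(2) by simp
  then have "\<not> b K + int (Suc K) \<le> 0" using jacobi_trudi_neg[of K "Suc K" b n g] by auto
  then have last: "0 \<le> b K + int K" by simp
  have pos: "0 \<le> b k + int k" if "k \<le> K" for k
    using that
  proof (induction rule: inc_induct)
    case (step m)
    then show ?case using bdec[of m] by simp
  qed (rule last)
  define \<mu>' where "\<mu>' k = (if k < Suc K then nat (b k + int k) else 0)" for k
  have \<mu>'b: "int (\<mu>' k) = b k + int k" if "k < Suc K" for k using pos[of k] that by (simp add: \<mu>'_def)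
  have "antimono \<mu>'"
    unfolding antimono_iff_le_Suc
  proof
    fix k show "\<mu>' (Suc k) \<le> \<mu>' k"
    proof (cases "k < K")
      case True
      then show ?thesis using bdec[OF True] by (simp add: \<mu>'_def)
    qed (simp add: \<mu>'_def)
  qed
  moreover have "finite {k. \<mu>' k \<noteq> 0}" by (rule finite_subset[of _ "{..<Suc K}"]) (auto simp: \<mu>'_def split: if_splits)
  ultimately have part': "is_partition \<mu>'" by (simp add: is_partition_def)
  have zero': "\<mu>' i = 0" if "Suc K \<le> i" for i using that by (simp add: \<mu>'_def)
  have size': "psize \<mu>' = n"
  proof -
    have "psize \<mu>' = (\<Sum>k<Suc K. \<mu>' k)" by (rule psize_eq_sum) (rule zero')
    then have "int (psize \<mu>') = (\<Sum>k<Suc K. int (\<mu>' k))" by simp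
    also have "\<dots> = (\<Sum>k<Suc K. b k + int k)" by (rule sum.cong) (use \<mu>'b in auto)
    also have "\<dots> = (\<Sum>k<Suc K. a (\<tau> k)) + (\<Sum>k<Suc K. int k)" unfolding b_def by (rule sum.distrib)
    also have "(\<Sum>k<Suc K. a (\<tau> k)) = (\<Sum>k<Suc K. a k)" using sum.permute[OF \<tau>, of a] by (simp only: comp_def)
    also have "(\<Sum>k<Suc K. a k) + (\<Sum>k<Suc K. int k) = (\<Sum>k<Suc K. a k + int k)" by (rule sum.distrib[symmetric])
    also have "\<dots> = int n - int (psize \<delta>) + (\<Sum>j<K. int (\<delta> j))"
      unfolding sum.lessThan_Suc_shift by (simp add: a0 aS)
    also have "\<dots> = int n" using psize_eq_sum[of K \<delta>] \<delta>(2) by simp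
    finally show ?thesis by simp
  qed
  have cong: "jacobi_trudi n (Suc K) (beta_seq \<mu>') h = jacobi_trudi n (Suc K) b h" for h
    by (rule jacobi_trudi_cong) (use \<mu>'b in \<open>simp add: beta_seq_def\<close>)
  have "(\<Sum>h | h permutes {1..n}. jacobi_trudi n (Suc K) (beta_seq \<mu>) h * jacobi_trudi n (Suc K) (beta_seq \<mu>') h)
     = sign \<tau> * jt_inner n K \<mu> \<delta>"
    unfolding jt_inner_def sum_distrib_left cong a_def[symmetric]
    by (rule sum.cong) (simp_all add: perm)
  then have "(if \<mu> = \<mu>' then fact n else 0) = sign \<tau> * jt_inner n K \<mu> \<delta>"
    using jacobi_trudi_orthonormal[OF \<mu>(1,3) part' zero' \<mu>(2) size'] by simp
  then have eq: "\<mu> = \<mu>'" using nz by (auto split: if_splits)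
  have "\<delta> k = dagger \<mu> (Suc p) k" for k
  proof (cases "k < p")
    case True
    then have "k < Suc K" using pK by simp
    then have "int (\<mu> k) = int (\<delta> k) - 1" using \<mu>'b[of k] True by (simp add: eq b_def \<tau>_def aS)
    then show ?thesis using True by (simp add: dagger_def)
  next
    case False
    show ?thesis
    proof (cases "k < K")
      case True
      then have "int (\<mu> (Suc k)) = int (\<delta> k)" using \<mu>'b[of "Suc k"] False by (simp add: eq b_def \<tau>_def aS)
      then show ?thesis using False by (simp add: dagger_def)
    next
      case k: False
      then show ?thesis using False \<mu>(3)[of "Suc k"] \<delta>(2)[of k] by (simp add: dagger_def)
    qed
  qed
  then have "\<delta> = dagger \<mu> (Suc p)" by (rule ext)
  then show ?thesis by (intro exI[of _ "Suc p"]) simp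
qed

lemma jt_inner_pad:
  assumes \<gamma>: "is_partition \<gamma>" "psize \<gamma> \<le> K" "is_partition (pad \<gamma> n)"
    and \<delta>: "is_partition \<delta>" "psize \<delta> \<le> K" "is_partition (pad \<delta> n)"
  shows "jt_inner n K (pad \<gamma> n) \<delta> = (if \<gamma> = \<delta> then fact n else 0)"
proof -
  have le: "psize \<gamma> \<le> n" "psize \<delta> \<le> n" using \<gamma> \<delta> by (auto simp: partition_pad_iff)
  have g0: "pad \<gamma> n i = 0" if "Suc K \<le> i" for i
    by (rule pad_zero[OF _ that]) (use partition_zero[OF \<gamma>(1)] \<gamma>(2) in auto)
  have d0: "pad \<delta> n i = 0" if "Suc K \<le> i" for i
    by (rule pad_zero[OF _ that]) (use partition_zero[OF \<delta>(1)] \<delta>(2) in auto)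
  have cut: "cut_first (pad p n) = p" for p by (simp add: cut_first_def pad_def)
  then have iff: "pad \<gamma> n = pad \<delta> n \<longleftrightarrow> \<gamma> = \<delta>" by metis
  have "jt_inner n K (pad \<gamma> n) \<delta> = (if pad \<gamma> n = pad \<delta> n then fact n else 0)"
    unfolding jt_inner_def pad_seq_beta[OF le(2)]
    by (rule jacobi_trudi_orthonormal[OF \<gamma>(3) g0 \<delta>(3) d0 psize_pad[OF \<gamma>(1) le(1)] psize_pad[OF \<delta>(1) le(2)]]) simp_all
  then show ?thesis by (simp only: iff)
qed

text \<open>
  The coefficients \<open>c\<close> of the product in the \<open>stable_jt\<close> do not depend on \<open>n\<close>. For \<open>n \<ge> 2 K\<close> all shapes
  \<open>\<delta>[n]\<close> with \<open>|\<delta>| \<le> K\<close> are partitions, so by orthonormality \<open>c \<gamma>\<close> is the Kronecker coefficient at \<open>n\<close>,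
  which is thus eventually constant with value \<open>c \<gamma>\<close>.
\<close>

theorem kronecker_expansion:
  assumes \<alpha>: "is_partition \<alpha>" and \<beta>: "is_partition \<beta>" and K: "psize \<alpha> + psize \<beta> \<le> K"
    and n: "is_partition (pad \<alpha> n)" "is_partition (pad \<beta> n)" "is_partition \<mu>" "psize \<mu> = n"
    "\<And>i. Suc K \<le> i \<Longrightarrow> \<mu> i = 0"
  shows "of_nat (kronecker (pad \<alpha> n) (pad \<beta> n) \<mu>) * fact n =
    (\<Sum>\<delta>\<in>small_partitions K. of_nat (reduced_kronecker \<alpha> \<beta> \<delta>) * (of_int (jt_inner n K \<mu> \<delta>) :: complex))"
proof -
  obtain c where c0: "\<And>x. stable_jt (Suc K) \<alpha> x * stable_jt (Suc K) \<beta> x = (\<Sum>\<delta>\<in>small_partitions K. c \<delta> * stable_jt (Suc K) \<delta> x)"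
    using span_image_finite[OF finite_small_partitions stable_jt_mult_span[OF \<alpha> \<beta> K]] by metis
  have c: "of_nat (kronecker (pad \<alpha> n) (pad \<beta> n) \<mu>) * fact n = (\<Sum>\<delta>\<in>small_partitions K. c \<delta> * of_int (jt_inner n K \<mu> \<delta>))"
    if pa: "is_partition (pad \<alpha> n)" and pb: "is_partition (pad \<beta> n)" and \<mu>: "is_partition \<mu>" "psize \<mu> = n"
      and \<mu>0: "\<And>i. Suc K \<le> i \<Longrightarrow> \<mu> i = 0" for n \<mu>
  proof -
    have le: "psize \<alpha> \<le> n" "psize \<beta> \<le> n" using pa pb \<alpha> \<beta> by (auto simp: partition_pad_iff)
    have a0: "pad \<alpha> n i = 0" if "Suc K \<le> i" for i
      by (rule pad_zero[OF _ that]) (use partition_zero[OF \<alpha>] K in auto)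
    have b0: "pad \<beta> n i = 0" if "Suc K \<le> i" for i
      by (rule pad_zero[OF _ that]) (use partition_zero[OF \<beta>] K in auto)
    let ?J = "\<lambda>a g. (of_int (jacobi_trudi n (Suc K) a g) :: complex)"
    have prod: "?J (beta_seq (pad \<alpha> n)) g * ?J (beta_seq (pad \<beta> n)) g = (\<Sum>\<delta>\<in>small_partitions K. c \<delta> * ?J (pad_seq \<delta> n) g)"
      if "g permutes {1..n}" for g
      using c0[of "(n, g)"] that le by (simp add: stable_jt_def pad_seq_beta)
    have "int (kronecker (pad \<alpha> n) (pad \<beta> n) \<mu>) * fact n = (\<Sum>g | g permutes {1..n}. jacobi_trudi n (Suc K) (beta_seq \<mu>) g *
      (jacobi_trudi n (Suc K) (beta_seq (pad \<alpha> n)) g * jacobi_trudi n (Suc K) (beta_seq (pad \<beta> n)) g))"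
      by (rule kronecker_eq[OF pa pb \<mu>(1) psize_pad[OF \<alpha> le(1)] psize_pad[OF \<beta> le(2)] \<mu>(2) _ a0 b0 \<mu>0]) simp_all
    then have "complex_of_int (int (kronecker (pad \<alpha> n) (pad \<beta> n) \<mu>) * fact n) = of_int (\<Sum>g | g permutes {1..n}. jacobi_trudi n (Suc K) (beta_seq \<mu>) g *
      (jacobi_trudi n (Suc K) (beta_seq (pad \<alpha> n)) g * jacobi_trudi n (Suc K) (beta_seq (pad \<beta> n)) g))"
      by (rule arg_cong)
    then have "of_nat (kronecker (pad \<alpha> n) (pad \<beta> n) \<mu>) * fact n = (\<Sum>g | g permutes {1..n}. ?J (beta_seq \<mu>) g *
      (?J (beta_seq (pad \<alpha> n)) g * ?J (beta_seq (pad \<beta> n)) g))" by simp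
    also have "\<dots> = (\<Sum>g | g permutes {1..n}. \<Sum>\<delta>\<in>small_partitions K. c \<delta> * (?J (beta_seq \<mu>) g * ?J (pad_seq \<delta> n) g))"
      by (rule sum.cong[OF refl]) (simp add: prod sum_distrib_left algebra_simps)
    also have "\<dots> = (\<Sum>\<delta>\<in>small_partitions K. c \<delta> * of_int (jt_inner n K \<mu> \<delta>))"
      unfolding jt_inner_def of_int_sum of_int_mult sum_distrib_left by (rule sum.swap)
    finally show ?thesis .
  qed
  have big: "is_partition (pad p n)" if p: "p \<in> small_partitions K" and n: "2 * K \<le> n" for p n
  proof -
    have "p 0 \<le> psize p"
    proof (cases "p 0 = 0")
      case False
      then show ?thesis unfolding psize_def
        using p by (intro member_le_sum) (auto simp: small_partitions_def is_partition_def)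
    qed simp
    then show ?thesis using p n by (simp add: small_partitions_def partition_pad_iff)
  qed
  have \<alpha>K: "\<alpha> \<in> small_partitions K" and \<beta>K: "\<beta> \<in> small_partitions K"
    using \<alpha> \<beta> K by (auto simp: small_partitions_def)
  have "of_nat (reduced_kronecker \<alpha> \<beta> \<gamma>) = c \<gamma>" if \<gamma>: "\<gamma> \<in> small_partitions K" for \<gamma>
  proof -
    have \<gamma>p: "is_partition \<gamma>" "psize \<gamma> \<le> K" using \<gamma> by (auto simp: small_partitions_def)
    have val: "of_nat (kronecker (pad \<alpha> n) (pad \<beta> n) (pad \<gamma> n)) = c \<gamma>" if n: "2 * K \<le> n" for n
    proof -
      have "psize \<gamma> \<le> n" using \<gamma>p n by simp
      have z: "pad \<gamma> n i = 0" if "Suc K \<le> i" for i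
        by (rule pad_zero[OF _ that]) (use partition_zero[OF \<gamma>p(1)] \<gamma>p(2) in auto)
      have "of_nat (kronecker (pad \<alpha> n) (pad \<beta> n) (pad \<gamma> n)) * fact n = (\<Sum>\<delta>\<in>small_partitions K. c \<delta> * of_int (jt_inner n K (pad \<gamma> n) \<delta>))"
        by (rule c[OF big[OF \<alpha>K n] big[OF \<beta>K n] big[OF \<gamma> n] psize_pad[OF \<gamma>p(1) \<open>psize \<gamma> \<le> n\<close>] z])
      also have "\<dots> = (\<Sum>\<delta>\<in>small_partitions K. if \<gamma> = \<delta> then c \<gamma> * fact n else 0)"
      proof (rule sum.cong[OF refl])
        fix \<delta> assume \<delta>: "\<delta> \<in> small_partitions K"
        then have "jt_inner n K (pad \<gamma> n) \<delta> = (if \<gamma> = \<delta> then fact n else 0)"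
          using \<gamma>p big[OF \<gamma> n] big[OF \<delta> n] by (intro jt_inner_pad) (auto simp: small_partitions_def)
        then show "c \<delta> * of_int (jt_inner n K (pad \<gamma> n) \<delta>) = (if \<gamma> = \<delta> then c \<gamma> * fact n else 0)" by simp
      qed
      also have "\<dots> = c \<gamma> * fact n" using \<gamma> finite_small_partitions by simp
      finally show ?thesis by simp
    qed
    define v where "v = kronecker (pad \<alpha> (2 * K)) (pad \<beta> (2 * K)) (pad \<gamma> (2 * K))"
    have v: "of_nat v = c \<gamma>" using val[of "2 * K"] by (simp add: v_def)
    have const: "kronecker (pad \<alpha> n) (pad \<beta> n) (pad \<gamma> n) = v" if "2 * K \<le> n" for n
      using val[OF that] v by (metis of_nat_eq_iff)
    have "reduced_kronecker \<alpha> \<beta> \<gamma> = v"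
      unfolding reduced_kronecker_def
    proof (rule the_equality)
      show "\<forall>\<^sub>F n in sequentially. kronecker (pad \<alpha> n) (pad \<beta> n) (pad \<gamma> n) = v"
        using const unfolding eventually_sequentially by blast
      fix v' assume "\<forall>\<^sub>F n in sequentially. kronecker (pad \<alpha> n) (pad \<beta> n) (pad \<gamma> n) = v'"
      then obtain N where N: "\<And>n. N \<le> n \<Longrightarrow> kronecker (pad \<alpha> n) (pad \<beta> n) (pad \<gamma> n) = v'"
        unfolding eventually_sequentially by blast
      then show "v' = v" using const[of "max N (2 * K)"] N[of "max N (2 * K)"] by simp
    qed
    then show ?thesis using v by simp
  qed
  then show ?thesis using c[OF n] by simp
qed

text \<open>
  In \<open>kronecker_expansion\<close> at \<open>\<mu> = \<gamma>[n]\<close> only the partitions \<open>\<delta> = \<mu>\<^sup>\<dagger>\<^sup>i\<close> contribute; the first of them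
  is \<open>\<gamma>\<close> and the others have vanishing coefficients.
\<close>

lemma kronecker_stable_if_daggers_vanish:
  assumes \<alpha>: "is_partition \<alpha>" and \<beta>: "is_partition \<beta>" and \<gamma>: "is_partition \<gamma>"
    and n: "is_partition (pad \<alpha> n)" "is_partition (pad \<beta> n)" "is_partition (pad \<gamma> n)"
    and vanish: "\<And>i. 2 \<le> i \<Longrightarrow> is_partition (dagger (pad \<gamma> n) i) \<Longrightarrow> reduced_kronecker \<alpha> \<beta> (dagger (pad \<gamma> n) i) = 0"
  shows "kronecker (pad \<alpha> n) (pad \<beta> n) (pad \<gamma> n) = reduced_kronecker \<alpha> \<beta> \<gamma>"
proof -
  define K where "K = psize \<alpha> + psize \<beta> + psize \<gamma>"
  have \<gamma>K: "\<gamma> \<in> small_partitions K" using \<gamma> by (simp add: small_partitions_def K_def)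
  have le: "psize \<gamma> \<le> n" using n(3) \<gamma> by (simp add: partition_pad_iff)
  have size: "psize (pad \<gamma> n) = n" by (rule psize_pad[OF \<gamma> le])
  have z: "pad \<gamma> n i = 0" if "Suc K \<le> i" for i
    by (rule pad_zero[OF _ that]) (use partition_zero[OF \<gamma>] in \<open>auto simp: K_def\<close>)
  have "of_nat (kronecker (pad \<alpha> n) (pad \<beta> n) (pad \<gamma> n)) * fact n =
    (\<Sum>\<delta>\<in>small_partitions K. of_nat (reduced_kronecker \<alpha> \<beta> \<delta>) * (of_int (jt_inner n K (pad \<gamma> n) \<delta>) :: complex))"
    by (rule kronecker_expansion[OF \<alpha> \<beta> _ n size z]) (simp add: K_def)
  also have "\<dots> = (\<Sum>\<delta>\<in>small_partitions K. if \<delta> = \<gamma> then of_nat (reduced_kronecker \<alpha> \<beta> \<gamma>) * fact n else 0)"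
  proof (rule sum.cong[OF refl])
    fix \<delta> assume \<delta>: "\<delta> \<in> small_partitions K"
    then have \<delta>p: "is_partition \<delta>" "psize \<delta> \<le> K" by (auto simp: small_partitions_def)
    show "of_nat (reduced_kronecker \<alpha> \<beta> \<delta>) * (of_int (jt_inner n K (pad \<gamma> n) \<delta>) :: complex)
      = (if \<delta> = \<gamma> then of_nat (reduced_kronecker \<alpha> \<beta> \<gamma>) * fact n else 0)"
    proof (cases "\<delta> = \<gamma>")
      case True
      have "jt_inner n K (pad \<gamma> n) \<gamma> = fact n"
        using jt_inner_pad[OF \<gamma> _ n(3) \<gamma> _ n(3), of K] by (simp add: K_def)
      then show ?thesis using True by simp
    next
      case False
      have "jt_inner n K (pad \<gamma> n) \<delta> = 0 \<or> reduced_kronecker \<alpha> \<beta> \<delta> = 0"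
      proof (rule disjCI)
        assume "reduced_kronecker \<alpha> \<beta> \<delta> \<noteq> 0"
        show "jt_inner n K (pad \<gamma> n) \<delta> = 0"
        proof (rule ccontr)
          assume nz: "jt_inner n K (pad \<gamma> n) \<delta> \<noteq> 0"
          have "\<exists>i\<ge>1. \<delta> = dagger (pad \<gamma> n) i"
            by (rule jt_inner_nonzero[OF n(3) size z \<delta>p(1) _ nz]) (use partition_zero[OF \<delta>p(1)] \<delta>p(2) in auto)
          then obtain i where i: "1 \<le> i" "\<delta> = dagger (pad \<gamma> n) i" by blast
          have "i \<noteq> 1"
          proof
            assume "i = 1"
            then have "\<delta> = \<gamma>" unfolding i(2) by (auto simp: dagger_def pad_def fun_eq_iff)
            then show False using False by simp
          qed
          then have "reduced_kronecker \<alpha> \<beta> \<delta> = 0" using vanish[of i] i \<delta>p(1) by simp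
          then show False using \<open>reduced_kronecker \<alpha> \<beta> \<delta> \<noteq> 0\<close> by simp
        qed
      qed
      then show ?thesis using False by auto
    qed
  qed
  also have "\<dots> = of_nat (reduced_kronecker \<alpha> \<beta> \<gamma>) * fact n" using \<gamma>K finite_small_partitions by simp
  finally have "complex_of_nat (kronecker (pad \<alpha> n) (pad \<beta> n) (pad \<gamma> n)) = of_nat (reduced_kronecker \<alpha> \<beta> \<gamma>)" by simp
  then show ?thesis by (simp only: of_nat_eq_iff)
qed

lemma cut_first_dagger_pad: "2 \<le> i \<Longrightarrow> cut_first (dagger (pad \<gamma> n) i) = dagger \<gamma> (i - 1)"
  by (auto simp: cut_first_def dagger_def pad_def fun_eq_iff)

theorem lemma5p1:
  fixes f :: "(nat \<Rightarrow> nat) \<Rightarrow> (nat \<Rightarrow> nat) \<Rightarrow> (nat \<Rightarrow> nat) \<Rightarrow> real"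
  assumes f_dagger: "\<And>\<alpha> \<beta> \<gamma> i. is_partition \<alpha> \<Longrightarrow> is_partition \<beta> \<Longrightarrow> is_partition \<gamma> \<Longrightarrow> i \<ge> 1 \<Longrightarrow>
      f \<alpha> \<beta> (cut_first \<gamma>) \<ge> f \<alpha> \<beta> (dagger \<gamma> i)"
    and f_bound: "\<And>\<alpha> \<beta> \<gamma>. is_partition \<alpha> \<Longrightarrow> is_partition \<beta> \<Longrightarrow> is_partition \<gamma> \<Longrightarrow>
      reduced_kronecker \<alpha> \<beta> \<gamma> > 0 \<Longrightarrow>
      M_bound f \<alpha> \<beta> \<gamma> \<ge> Max {real (psize \<alpha> + \<alpha> 0), real (psize \<beta> + \<beta> 0), real (psize \<gamma> + \<gamma> 0)}"
  shows "\<And>\<alpha> \<beta> \<gamma>. is_partition \<alpha> \<Longrightarrow> is_partition \<beta> \<Longrightarrow> is_partition \<gamma> \<Longrightarrow>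
      reduced_kronecker \<alpha> \<beta> \<gamma> > 0 \<Longrightarrow> real (stab \<alpha> \<beta> \<gamma>) \<le> M_bound f \<alpha> \<beta> \<gamma>"
proof -
  fix \<alpha> \<beta> \<gamma> :: "nat \<Rightarrow> nat"
  assume \<alpha>: "is_partition \<alpha>" and \<beta>: "is_partition \<beta>" and \<gamma>: "is_partition \<gamma>"
    and pos: "reduced_kronecker \<alpha> \<beta> \<gamma> > 0"
  define M where "M = M_bound f \<alpha> \<beta> \<gamma>"
  have bound: "real (psize \<alpha> + \<alpha> 0) \<le> M" "real (psize \<beta> + \<beta> 0) \<le> M" "real (psize \<gamma> + \<gamma> 0) \<le> M"
    using f_bound[OF \<alpha> \<beta> \<gamma> pos] by (auto simp: M_def)
  have M0: "0 \<le> M" using bound(1) by (rule order_trans[rotated]) simp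
  \<comment> \<open>Rounding down loses nothing: a violation at \<open>n\<close> forces \<open>n + 1 \<le> M\<close>.\<close>
  define N where "N = nat \<lfloor>M\<rfloor>"
  have NM: "real N \<le> M" "M < real N + 1" using M0 by (auto simp: N_def)
  have Nle: "psize \<alpha> + \<alpha> 0 \<le> N" "psize \<beta> + \<beta> 0 \<le> N" "psize \<gamma> + \<gamma> 0 \<le> N"
    using bound NM by linarith+
  have part: "is_partition (pad \<alpha> n)" "is_partition (pad \<beta> n)" "is_partition (pad \<gamma> n)" if "N \<le> n" for n
    using Nle that \<alpha> \<beta> \<gamma> by (auto simp: partition_pad_iff)
  have "kronecker (pad \<alpha> n) (pad \<beta> n) (pad \<gamma> n) = reduced_kronecker \<alpha> \<beta> \<gamma>" if n: "N \<le> n" for n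
  proof (rule kronecker_stable_if_daggers_vanish[OF \<alpha> \<beta> \<gamma> part[OF n]])
    fix i :: nat assume i: "2 \<le> i" and dp: "is_partition (dagger (pad \<gamma> n) i)"
    show "reduced_kronecker \<alpha> \<beta> (dagger (pad \<gamma> n) i) = 0"
    proof (rule ccontr)
      let ?d = "dagger (pad \<gamma> n) i"
      assume "reduced_kronecker \<alpha> \<beta> ?d \<noteq> 0"
      then have "real (psize ?d + ?d 0) \<le> M_bound f \<alpha> \<beta> ?d"
        using f_bound[OF \<alpha> \<beta> dp] by auto
      then have "real (?d 0) \<le> f \<alpha> \<beta> (dagger \<gamma> (i - 1))"
        by (simp add: M_bound_def cut_first_dagger_pad[OF i])
      also have "\<dots> \<le> f \<alpha> \<beta> (cut_first \<gamma>)" using i by (intro f_dagger \<alpha> \<beta> \<gamma>) simp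
      also have "\<dots> = M - real (psize \<gamma>)" by (simp add: M_def M_bound_def)
      finally have "real (?d 0) + real (psize \<gamma>) \<le> M" by simp
      moreover have "?d 0 = 1 + (n - psize \<gamma>)" using i by (simp add: dagger_def pad_def)
      moreover have "psize \<gamma> \<le> n" using Nle(3) n by simp
      ultimately have "real n + 1 \<le> M" by simp
      then show False using NM(2) n by linarith
    qed
  qed
  then have "stab \<alpha> \<beta> \<gamma> \<le> N"
    unfolding stab_def by (intro Least_le) (use part in auto)
  then show "real (stab \<alpha> \<beta> \<gamma>) \<le> M_bound f \<alpha> \<beta> \<gamma>" using NM(1) by (simp add: M_def)
qed

end
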